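(* (i) The restriction of a basic functional in $\mathcal{L}(\mathcal{G}_c(\mathbb{R}^n),\widetilde{\mathbb{C}})$ to a bounded open set $\Omega\subseteq\mathbb{R}^n$ is a derivative of finite order of a functional in $\mathcal{L}(\mathcal{G}^0_c(\Omega),\widetilde{\mathbb{C}})$ defined by a net in $\mathcal{M}_{\mathcal{C}(\Omega)}$. (ii) If $T\in\mathcal{L}_{\rm b}(\mathcal{G}(\mathbb{R}^n),\widetilde{\mathbb{C}})$ then there are an integer $m\ge0$ and functionals $T_\alpha\in\mathcal{L}(\mathcal{G}^0_c(\mathbb{R}^n),\widetilde{\mathbb{C}})$, $|\alpha|\le m$, defined by nets in $\mathcal{M}_{\mathcal{C}(\mathbb{R}^n)}$, such that $$T=\sum_{|\alpha|\le m}\partial^\alpha T_\alpha.$$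
   Context: All nets are indexed by $\varepsilon\in(0,1]$; $O(\cdot)$ is as $\varepsilon\to0$. $\widetilde{\mathbb{C}}$ is the ring of complex nets that are moderate ($\exists N\in\mathbb{N}$: $|r_\varepsilon|=O(\varepsilon^{-N})$) modulo negligible nets ($\forall q\in\mathbb{N}$: $|r_\varepsilon|=O(\varepsilon^{q})$), with $|r|_{\rm e}=e^{-\mathrm{v}(r)}$, $\mathrm{v}(r)=\sup\{b:|r_\varepsilon|=O(\varepsilon^b)\}$. $\mathcal{G}(\Omega)$ ($\Omega\subseteq\mathbb{R}^n$ open) is the Colombeau algebra: nets $(u_\varepsilon)_\varepsilon$ in $C^\infty(\Omega)$ with $\forall K\Subset\Omega\,\forall\alpha\,\exists N$: $\sup_K|\partial^\alpha u_\varepsilon|=O(\varepsilon^{-N})$, modulo nets with $\forall K\,\forall\alpha\,\forall q$: $\sup_K|\partial^\alpha u_\varepsilon|=O(\varepsilon^q)$. $\mathcal{G}_c(\Omega)$ consists of the elements with compact support (representatives are chosen with supports in one compact set independent of $\varepsilon$). Topologies: $\mathcal{G}(\Omega)$ carries the ultra-pseudo-seminorms $e^{-\mathrm{v}_{K,j}(u)}$, $K\Subset\Omega$, $j\in\mathbb{N}$, $\mathrm{v}_{K,j}(u)=\sup\{b\in\mathbb{R}:\sup_{x\in K,|\alpha|\le j}|\partial^\alpha u_\varepsilon(x)|=O(\varepsilon^b)\}$. For $K\Subset\Omega$, $\mathcal{G}_K(\Omega)=\{u\in\mathcal{G}_c(\Omega):\mathrm{supp}\,u\subseteq K\}$ carries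 the ultra-pseudo-seminorms $\mathcal{P}_{\mathcal{G}_K(\Omega),j}(u)=e^{-\mathrm{v}_{K',j}(u)}$, $j\in\mathbb{N}$, with $K'\Subset\Omega$ a compact neighbourhood of $K$ (choice irrelevant); $\mathcal{G}_c(\Omega)$ is the strict inductive limit of the $\mathcal{G}_K(\Omega)$. For fixed $m\in\mathbb{N}$, $\mathcal{G}^m_K(\Omega)$ is $\mathcal{G}_K(\Omega)$ with the topology of the single ultra-pseudo-seminorm $\mathcal{P}_{\mathcal{G}_K(\Omega),m}$, and $\mathcal{G}^m_c(\Omega)$ is the strict inductive limit of the $\mathcal{G}^m_K(\Omega)$ (the set $\mathcal{G}_c(\Omega)$ with a coarser topology). $\mathcal{L}(\cdot,\widetilde{\mathbb{C}})$ denotes continuous $\widetilde{\mathbb{C}}$-linear functionals; so $\mathcal{L}(\mathcal{G}^m_c(\Omega),\widetilde{\mathbb{C}})\subseteq\mathcal{L}(\mathcal{G}_c(\Omega),\widetilde{\mathbb{C}})$. $T\in\mathcal{L}(\mathcal{G}_c(\Omega),\widetilde{\mathbb{C}})$ is basic if there is a net $(T_\varepsilon)_\varepsilon$ in $\mathcal{D}'(\Omega)$ such that $\forall K\Subset\Omega\ \exists j,N\in\mathbb{N},c>0,\eta\in(0,1]$: $|T_\varepsilon(f)|\le c\,\varepsilon^{-N}\sup_{x\in K,|\alpha|\le j}|\partial^\alpha f(x)|$ for all $f\in C^\infty_K(\Omega)$, $\varepsilon\in(0,\eta]$, and $T(u)=[(T_\varepsilon(u_\varepsilon))_\varepsilon]$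 for all $u\in\mathcal{G}_c(\Omega)$. $T\in\mathcal{L}(\mathcal{G}(\Omega),\widetilde{\mathbb{C}})$ is basic ($T\in\mathcal{L}_{\rm b}(\mathcal{G}(\Omega),\widetilde{\mathbb{C}})$) if there are a net $(T_\varepsilon)_\varepsilon$ in $\mathcal{E}'(\Omega)$ and $K\Subset\Omega$, $j,N\in\mathbb{N}$, $c>0$, $\eta\in(0,1]$ such that the same estimate holds for all $f\in C^\infty(\Omega)$, $\varepsilon\in(0,\eta]$, and $T(u)=[(T_\varepsilon(u_\varepsilon))_\varepsilon]$ for all $u\in\mathcal{G}(\Omega)$. $\mathcal{L}(\mathcal{G}(\Omega),\widetilde{\mathbb{C}})$ is identified with the set of functionals in $\mathcal{L}(\mathcal{G}_c(\Omega),\widetilde{\mathbb{C}})$ with compact support. The restriction of $T$ to an open $V$ is its restriction to $\mathcal{G}_c(V)$; $\partial^\alpha T(u)=(-1)^{|\alpha|}T(\partial^\alpha u)$. $\mathcal{M}_{\mathcal{C}(\Omega)}$ is the set of nets $(g_\varepsilon)_\varepsilon$ of continuous functions on $\Omega$ such that $\forall K\Subset\Omega\,\exists N\in\mathbb{N}$: $\sup_K|g_\varepsilon|=O(\varepsilon^{-N})$. The functional defined by $(g_\varepsilon)_\varepsilon$ is $u\mapsto[(\int_\Omega g_\varepsilon u_\varepsilon\,dx)_\varepsilon]$. *)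

theory Defs
  imports "HOL-Analysis.Analysis" "HOL-Library.Landau_Symbols"
begin

section \<open>Asymptotic scales\<close>

text \<open>Nets are total functions of a real parameter. Only the parameters in
  \<open>{0<..1}\<close> are meaningful, and estimates as the parameter tends to \<open>0\<close>
  ignore all others.\<close>

abbreviation big_O_eps :: "(real \<Rightarrow> real) \<Rightarrow> real \<Rightarrow> bool" where
  "big_O_eps r b \<equiv> r \<in> O[at_right 0](\<lambda>\<epsilon>. \<epsilon> powr b)"

definition moderate :: "(real \<Rightarrow> real) \<Rightarrow> bool" where
  "moderate r \<longleftrightarrow> (\<exists>N::nat. big_O_eps r (- real N))"

definition negligible_net :: "(real \<Rightarrow> real) \<Rightarrow> bool" where
  "negligible_net r \<longleftrightarrow> (\<forall>q::nat. big_O_eps r (real q))"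

definition valuation :: "(real \<Rightarrow> real) \<Rightarrow> ereal" where
  "valuation r = Sup {ereal b | b. big_O_eps r b}"

text \<open>\<open>exp (- valuation r)\<close>, with value \<open>0\<close> at valuation \<open>\<infinity>\<close>.\<close>

definition sharp_norm :: "(real \<Rightarrow> real) \<Rightarrow> real" where
  "sharp_norm r =
     (if valuation r = \<infinity> then 0 else exp (- real_of_ereal (valuation r)))"

lemma powr_bigo_mono:
  assumes "b \<le> a"
  shows "big_O_eps (\<lambda>\<epsilon>. \<epsilon> powr a) b"
proof (rule bigoI[where c = 1])
  have "\<forall>\<^sub>F \<epsilon> in at_right (0::real). \<epsilon> \<in> {0<..<1}"
    by (rule eventually_at_right_real) simp
  then show "\<forall>\<^sub>F \<epsilon> in at_right 0. norm (\<epsilon> powr a) \<le> 1 * norm (\<epsilon> powr b)"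
    by eventually_elim (use assms in \<open>auto intro!: powr_mono'\<close>)
qed

lemma big_O_eps_mono:
  assumes "big_O_eps r a" "b \<le> a"
  shows "big_O_eps r b"
  using assms(1) powr_bigo_mono[OF assms(2)] by (rule landau_o.big_trans)

lemma big_O_eps_mult:
  assumes "big_O_eps r a" "big_O_eps s b"
  shows "big_O_eps (\<lambda>\<epsilon>. r \<epsilon> * s \<epsilon>) (a + b)"
  using landau_o.big.mult[OF assms] by (simp add: powr_add)

lemma moderate_mult:
  assumes "moderate r" "moderate s"
  shows "moderate (\<lambda>\<epsilon>. r \<epsilon> * s \<epsilon>)"
proof -
  obtain N M :: nat where "big_O_eps r (- real N)" "big_O_eps s (- real M)"
    using assms by (auto simp: moderate_def)
  from big_O_eps_mult[OF this] have "big_O_eps (\<lambda>\<epsilon>. r \<epsilon> * s \<epsilon>) (- real (N + M))"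
    by simp
  then show ?thesis unfolding moderate_def by blast
qed

lemma moderate_sum:
  assumes "moderate r" "moderate s"
  shows "moderate (\<lambda>\<epsilon>. r \<epsilon> + s \<epsilon>)"
proof -
  obtain N M :: nat where "big_O_eps r (- real N)" "big_O_eps s (- real M)"
    using assms by (auto simp: moderate_def)
  then have "big_O_eps r (- real (N + M))" "big_O_eps s (- real (N + M))"
    by (simp_all add: big_O_eps_mono)
  then have "big_O_eps (\<lambda>\<epsilon>. r \<epsilon> + s \<epsilon>) (- real (N + M))"
    by (rule sum_in_bigo)
  then show ?thesis unfolding moderate_def by blast
qed

lemma negligible_sum:
  assumes "negligible_net r" "negligible_net s"
  shows "negligible_net (\<lambda>\<epsilon>. r \<epsilon> + s \<epsilon>)"
  using assms unfolding negligible_net_def by (simp add: sum_in_bigo(1))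

lemma negligible_mult_moderate:
  assumes "moderate r" "negligible_net s"
  shows "negligible_net (\<lambda>\<epsilon>. r \<epsilon> * s \<epsilon>)"
  unfolding negligible_net_def
proof
  fix q :: nat
  obtain N :: nat where "big_O_eps r (- real N)"
    using assms(1) by (auto simp: moderate_def)
  moreover have "big_O_eps s (real (N + q))"
    using assms(2) unfolding negligible_net_def by blast
  ultimately show "big_O_eps (\<lambda>\<epsilon>. r \<epsilon> * s \<epsilon>) (real q)"
    using big_O_eps_mult by fastforce
qed

lemma big_O_eps_le:
  assumes "big_O_eps s b" "\<And>\<epsilon>. \<bar>r \<epsilon>\<bar> \<le> \<bar>s \<epsilon>\<bar>"
  shows "big_O_eps r b"
proof -
  have "r \<in> O[at_right 0](s)"
    by (rule bigoI[where c = 1]) (use assms(2) in auto)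
  then show ?thesis using assms(1) by (rule landau_o.big_trans)
qed

lemma moderate_le: "moderate s \<Longrightarrow> (\<And>\<epsilon>. \<bar>r \<epsilon>\<bar> \<le> \<bar>s \<epsilon>\<bar>) \<Longrightarrow> moderate r"
  unfolding moderate_def using big_O_eps_le by blast

lemma negligible_le:
  "negligible_net s \<Longrightarrow> (\<And>\<epsilon>. \<bar>r \<epsilon>\<bar> \<le> \<bar>s \<epsilon>\<bar>) \<Longrightarrow> negligible_net r"
  unfolding negligible_net_def using big_O_eps_le by blast

lemma moderate_const: "moderate (\<lambda>\<epsilon>. c)"
proof -
  have "(\<lambda>\<epsilon>. c) \<in> O[at_right 0](\<lambda>\<epsilon>::real. 1::real)" by simp
  moreover have "\<forall>\<^sub>F \<epsilon> in at_right (0::real). \<epsilon> powr (- real 0) = 1"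
    by (intro eventually_at_rightI[of 0 1]) auto
  ultimately have "big_O_eps (\<lambda>\<epsilon>. c) (- real 0)"
    using landau_o.big.cong[of "\<lambda>\<epsilon>. \<epsilon> powr (- real 0)" "\<lambda>_. 1" "at_right (0::real)"] by simp
  then show ?thesis unfolding moderate_def by blast
qed

lemma negligible_zero: "negligible_net (\<lambda>\<epsilon>. 0)"
  by (simp add: negligible_net_def)

lemma negligible_minus_commute:
  "negligible_net (\<lambda>\<epsilon>. cmod (r \<epsilon> - s \<epsilon>)) \<Longrightarrow> negligible_net (\<lambda>\<epsilon>. cmod (s \<epsilon> - r \<epsilon>))"
  by (simp add: norm_minus_commute)

section \<open>The ring of complex generalized numbers\<close>

definition moderate_eq :: "(real \<Rightarrow> complex) \<Rightarrow> (real \<Rightarrow> complex) \<Rightarrow> bool" where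
  "moderate_eq r s \<longleftrightarrow>
     moderate (\<lambda>\<epsilon>. cmod (r \<epsilon>)) \<and> moderate (\<lambda>\<epsilon>. cmod (s \<epsilon>)) \<and>
     negligible_net (\<lambda>\<epsilon>. cmod (r \<epsilon> - s \<epsilon>))"

quotient_type gcomplex = "real \<Rightarrow> complex" / partial: moderate_eq
proof (rule part_equivpI)
  show "\<exists>r. moderate_eq r r"
    by (rule exI[of _ "\<lambda>_. 0"]) (simp add: moderate_eq_def moderate_const negligible_zero)
  show "symp moderate_eq"
    by (rule sympI) (auto simp: moderate_eq_def intro: negligible_minus_commute)
  show "transp moderate_eq"
  proof (rule transpI)
    fix r s t assume "moderate_eq r s" "moderate_eq s t"
    then have "negligible_net (\<lambda>\<epsilon>. cmod (r \<epsilon> - s \<epsilon>) + cmod (s \<epsilon> - t \<epsilon>))"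
      by (auto simp: moderate_eq_def intro: negligible_sum)
    then have "negligible_net (\<lambda>\<epsilon>. cmod (r \<epsilon> - t \<epsilon>))"
    proof (rule negligible_le)
      show "\<bar>cmod (r \<epsilon> - t \<epsilon>)\<bar> \<le> \<bar>cmod (r \<epsilon> - s \<epsilon>) + cmod (s \<epsilon> - t \<epsilon>)\<bar>" for \<epsilon>
        using norm_triangle_ineq[of "r \<epsilon> - s \<epsilon>" "s \<epsilon> - t \<epsilon>"] by simp
    qed
    with \<open>moderate_eq r s\<close> \<open>moderate_eq s t\<close> show "moderate_eq r t"
      by (auto simp: moderate_eq_def)
  qed
qed

lemma moderate_eq_refl: "moderate_eq r r \<longleftrightarrow> moderate (\<lambda>\<epsilon>. cmod (r \<epsilon>))"
  by (simp add: moderate_eq_def negligible_zero)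

lemma moderate_norm_add:
  assumes "moderate (\<lambda>\<epsilon>. cmod (r \<epsilon>))" "moderate (\<lambda>\<epsilon>. cmod (s \<epsilon>))"
  shows "moderate (\<lambda>\<epsilon>. cmod (r \<epsilon> + s \<epsilon>))"
  by (rule moderate_le[OF moderate_sum[OF assms]]) (simp add: norm_triangle_ineq)

lemma moderate_norm_mult:
  assumes "moderate (\<lambda>\<epsilon>. cmod (r \<epsilon>))" "moderate (\<lambda>\<epsilon>. cmod (s \<epsilon>))"
  shows "moderate (\<lambda>\<epsilon>. cmod (r \<epsilon> * s \<epsilon>))"
  using moderate_mult[OF assms] by (simp add: norm_mult)

instantiation gcomplex :: comm_ring_1
begin

lift_definition zero_gcomplex :: gcomplex is "\<lambda>\<epsilon>. 0"
  by (simp add: moderate_eq_def moderate_const negligible_zero)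

lift_definition one_gcomplex :: gcomplex is "\<lambda>\<epsilon>. 1"
  by (simp add: moderate_eq_def moderate_const negligible_zero)

lift_definition plus_gcomplex :: "gcomplex \<Rightarrow> gcomplex \<Rightarrow> gcomplex"
  is "\<lambda>r s \<epsilon>. r \<epsilon> + s \<epsilon>"
proof -
  fix r r' s s' assume a: "moderate_eq r r'" "moderate_eq s s'"
  have "moderate (\<lambda>\<epsilon>. cmod (r \<epsilon> + s \<epsilon>))" "moderate (\<lambda>\<epsilon>. cmod (r' \<epsilon> + s' \<epsilon>))"
    using a by (simp_all add: moderate_eq_def moderate_norm_add)
  moreover have "negligible_net (\<lambda>\<epsilon>. cmod (r \<epsilon> + s \<epsilon> - (r' \<epsilon> + s' \<epsilon>)))"
    by (rule negligible_le[OF negligible_sum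
          [of "\<lambda>\<epsilon>. cmod (r \<epsilon> - r' \<epsilon>)" "\<lambda>\<epsilon>. cmod (s \<epsilon> - s' \<epsilon>)"]])
       (use a in \<open>auto simp: moderate_eq_def norm_diff_triangle_ineq\<close>)
  ultimately show "moderate_eq (\<lambda>\<epsilon>. r \<epsilon> + s \<epsilon>) (\<lambda>\<epsilon>. r' \<epsilon> + s' \<epsilon>)"
    by (simp add: moderate_eq_def)
qed

lift_definition uminus_gcomplex :: "gcomplex \<Rightarrow> gcomplex" is "\<lambda>r \<epsilon>. - r \<epsilon>"
proof -
  fix r r' assume a: "moderate_eq r r'"
  have "cmod (- r \<epsilon> - - r' \<epsilon>) = cmod (r \<epsilon> - r' \<epsilon>)" for \<epsilon>
    by (metis minus_diff_minus norm_minus_cancel)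
  with a show "moderate_eq (\<lambda>\<epsilon>. - r \<epsilon>) (\<lambda>\<epsilon>. - r' \<epsilon>)"
    unfolding moderate_eq_def by (simp only: norm_minus_cancel)
qed

definition minus_gcomplex :: "gcomplex \<Rightarrow> gcomplex \<Rightarrow> gcomplex" where
  "minus_gcomplex r s = r + (- s)"

lift_definition times_gcomplex :: "gcomplex \<Rightarrow> gcomplex \<Rightarrow> gcomplex"
  is "\<lambda>r s \<epsilon>. r \<epsilon> * s \<epsilon>"
proof -
  fix r r' s s' assume a: "moderate_eq r r'" "moderate_eq s s'"
  have 1: "moderate (\<lambda>\<epsilon>. cmod (r \<epsilon> * s \<epsilon>))" "moderate (\<lambda>\<epsilon>. cmod (r' \<epsilon> * s' \<epsilon>))"
    using a by (simp_all add: moderate_eq_def moderate_norm_mult)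
  have "negligible_net (\<lambda>\<epsilon>. cmod (r \<epsilon>) * cmod (s \<epsilon> - s' \<epsilon>) + cmod (s' \<epsilon>) * cmod (r \<epsilon> - r' \<epsilon>))"
    using a by (auto simp: moderate_eq_def intro!: negligible_sum negligible_mult_moderate)
  then have "negligible_net (\<lambda>\<epsilon>. cmod (r \<epsilon> * s \<epsilon> - r' \<epsilon> * s' \<epsilon>))"
  proof (rule negligible_le)
    fix \<epsilon>
    have "r \<epsilon> * s \<epsilon> - r' \<epsilon> * s' \<epsilon> = r \<epsilon> * (s \<epsilon> - s' \<epsilon>) + s' \<epsilon> * (r \<epsilon> - r' \<epsilon>)"
      by (simp add: algebra_simps)
    then have "cmod (r \<epsilon> * s \<epsilon> - r' \<epsilon> * s' \<epsilon>)
        \<le> cmod (r \<epsilon>) * cmod (s \<epsilon> - s' \<epsilon>) + cmod (s' \<epsilon>) * cmod (r \<epsilon> - r' \<epsilon>)"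
      by (metis norm_mult norm_triangle_ineq)
    then show "\<bar>cmod (r \<epsilon> * s \<epsilon> - r' \<epsilon> * s' \<epsilon>)\<bar>
        \<le> \<bar>cmod (r \<epsilon>) * cmod (s \<epsilon> - s' \<epsilon>) + cmod (s' \<epsilon>) * cmod (r \<epsilon> - r' \<epsilon>)\<bar>"
      by simp
  qed
  with 1 show "moderate_eq (\<lambda>\<epsilon>. r \<epsilon> * s \<epsilon>) (\<lambda>\<epsilon>. r' \<epsilon> * s' \<epsilon>)"
    by (simp add: moderate_eq_def)
qed

instance
proof
  fix a b c :: gcomplex
  show "a + b + c = a + (b + c)"
    by transfer (simp only: add.assoc moderate_eq_refl moderate_norm_add)
  show "a + b = b + a"
    by transfer (simp add: add.commute moderate_eq_refl moderate_norm_add)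
  show "0 + a = a"
    by transfer simp
  show "- a + a = 0"
    by transfer (simp add: moderate_eq_refl moderate_const)
  show "a - b = a + - b"
    by (rule minus_gcomplex_def)
  show "a * b * c = a * (b * c)"
    by transfer (simp only: mult.assoc moderate_eq_refl moderate_norm_mult)
  show "a * b = b * a"
    by transfer (simp add: mult.commute moderate_eq_refl moderate_norm_mult)
  show "1 * a = a"
    by transfer simp
  show "(a + b) * c = a * c + b * c"
    by transfer (simp only: distrib_right moderate_eq_refl moderate_norm_add moderate_norm_mult)
  show "(0::gcomplex) \<noteq> 1"
  proof transfer
    have "\<not> big_O_eps (\<lambda>\<epsilon>. 1) (real 1)"
    proof
      assume "big_O_eps (\<lambda>\<epsilon>. 1) (real 1)"
      then obtain C where C: "\<forall>\<^sub>F \<epsilon> in at_right 0. 1 \<le> C * norm (\<epsilon> powr (real 1) :: real)"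
        by (auto elim: landau_o.bigE)
      have "((\<lambda>\<epsilon>::real. C * norm (\<epsilon> powr real 1)) \<longlongrightarrow> C * norm (0 powr real 1 :: real)) (at_right 0)"
        by (intro tendsto_intros tendsto_powr2) (auto simp: eventually_at_filter)
      then have "1 \<le> C * norm (0 powr real 1 :: real)"
        by (rule tendsto_lowerbound) (use C in auto)
      then show False by simp
    qed
    then show "\<not> moderate_eq (\<lambda>\<epsilon>. 0) (\<lambda>\<epsilon>. 1)"
      unfolding moderate_eq_def negligible_net_def by (metis diff_0 norm_minus_cancel norm_one)
  qed
qed

end

lift_definition enorm :: "gcomplex \<Rightarrow> real" is "\<lambda>r. sharp_norm (\<lambda>\<epsilon>. cmod (r \<epsilon>))"
proof -
  have *: "big_O_eps (\<lambda>\<epsilon>. cmod (s \<epsilon>)) b"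
    if "negligible_net (\<lambda>\<epsilon>. cmod (r \<epsilon> - s \<epsilon>))" and "big_O_eps (\<lambda>\<epsilon>. cmod (r \<epsilon>)) b"
    for r s b
  proof (rule big_O_eps_le)
    obtain q :: nat where "b \<le> real q" using real_arch_simple by blast
    with that(1) have "big_O_eps (\<lambda>\<epsilon>. cmod (r \<epsilon> - s \<epsilon>)) b"
      unfolding negligible_net_def using big_O_eps_mono by blast
    with that(2) show "big_O_eps (\<lambda>\<epsilon>. cmod (r \<epsilon>) + cmod (r \<epsilon> - s \<epsilon>)) b"
      by (rule sum_in_bigo)
    show "\<bar>cmod (s \<epsilon>)\<bar> \<le> \<bar>cmod (r \<epsilon>) + cmod (r \<epsilon> - s \<epsilon>)\<bar>" for \<epsilon>
      using norm_triangle_ineq4[of "r \<epsilon>" "r \<epsilon> - s \<epsilon>"] by simp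
  qed
  fix r s assume "moderate_eq r s"
  then have "big_O_eps (\<lambda>\<epsilon>. cmod (r \<epsilon>)) b \<longleftrightarrow> big_O_eps (\<lambda>\<epsilon>. cmod (s \<epsilon>)) b" for b
    using *[of r s b] *[of s r b] by (auto simp: moderate_eq_def norm_minus_commute)
  then show "sharp_norm (\<lambda>\<epsilon>. cmod (r \<epsilon>)) = sharp_norm (\<lambda>\<epsilon>. cmod (s \<epsilon>))"
    by (simp add: sharp_norm_def valuation_def)
qed

definition gcomplex_topology :: "gcomplex topology" where
  "gcomplex_topology = topology_generated_by {{s. enorm (s - r) < \<delta>} | r \<delta>. \<delta> > 0}"

section \<open>Smooth functions and partial derivatives\<close>

type_synonym 'n mindex = "'n \<Rightarrow> nat"

definition morder :: "'n::finite mindex \<Rightarrow> nat" where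
  "morder \<alpha> = (\<Sum>i\<in>UNIV. \<alpha> i)"

lemma finite_morder_le: "finite {\<alpha> :: 'n::finite mindex. morder \<alpha> \<le> m}"
proof (rule finite_subset)
  show "{\<alpha> :: 'n mindex. morder \<alpha> \<le> m} \<subseteq> Pi\<^sub>E UNIV (\<lambda>_. {..m})"
  proof safe
    fix \<alpha> :: "'n mindex" and i assume "morder \<alpha> \<le> m"
    moreover have "\<alpha> i \<le> morder \<alpha>"
      unfolding morder_def by (rule member_le_sum) auto
    ultimately show "\<alpha> i \<le> m" by linarith
  qed simp
  show "finite (Pi\<^sub>E (UNIV :: 'n set) (\<lambda>_. {..m}))"
    by (rule finite_PiE) auto
qed

definition pderivative :: "'n::finite \<Rightarrow> (real^'n \<Rightarrow> complex) \<Rightarrow> real^'n \<Rightarrow> complex" where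
  "pderivative i f x = vector_derivative (\<lambda>t. f (x + t *\<^sub>R axis i 1)) (at 0)"

definition smooth_on :: "(real^'n::finite) set \<Rightarrow> (real^'n \<Rightarrow> complex) \<Rightarrow> bool" where
  "smooth_on \<Omega> f \<longleftrightarrow> (\<forall>is. foldr pderivative is f differentiable_on \<Omega>)"

text \<open>The derivative \<open>\<partial>\<^sup>\<alpha>\<close>. The index type carries no order, so the partial derivatives are
  applied along an arbitrary fixed enumeration of the coordinates; the choice is immaterial on
  smooth functions.\<close>

definition coordinates :: "'n::finite list" where
  "coordinates = (SOME is. distinct is \<and> set is = UNIV)"

definition mderivative :: "'n::finite mindex \<Rightarrow> (real^'n \<Rightarrow> complex) \<Rightarrow> real^'n \<Rightarrow> complex" where
  "mderivative \<alpha> f = foldr (\<lambda>i. pderivative i ^^ \<alpha> i) coordinates f"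

text \<open>Inserting \<open>0\<close> only matters for \<open>K = {}\<close>.\<close>

definition sup_on :: "'a set \<Rightarrow> ('a \<Rightarrow> complex) \<Rightarrow> real" where
  "sup_on K h = Sup (insert 0 ((\<lambda>x. cmod (h x)) ` K))"

definition ck_norm :: "(real^'n::finite) set \<Rightarrow> nat \<Rightarrow> (real^'n \<Rightarrow> complex) \<Rightarrow> real" where
  "ck_norm K j f = (SUP \<alpha>\<in>{\<alpha>. morder \<alpha> \<le> j}. sup_on K (mderivative \<alpha> f))"

text \<open>The smooth functions on \<open>\<Omega>\<close> with support in the compact set \<open>K \<subseteq> \<Omega>\<close>, extended by zero to
  the whole space.\<close>

definition smooth_supported :: "(real^'n::finite) set \<Rightarrow> (real^'n) set \<Rightarrow> (real^'n \<Rightarrow> complex) set" where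
  "smooth_supported \<Omega> K = {f. smooth_on \<Omega> f \<and> (\<forall>x. x \<notin> K \<longrightarrow> f x = 0)}"

definition test_functions :: "(real^'n::finite) set \<Rightarrow> (real^'n \<Rightarrow> complex) set" where
  "test_functions \<Omega> = (\<Union>K\<in>{K. compact K \<and> K \<subseteq> \<Omega>}. smooth_supported \<Omega> K)"

definition linear_functional_on ::
    "(real^'n::finite \<Rightarrow> complex) set \<Rightarrow> ((real^'n \<Rightarrow> complex) \<Rightarrow> complex) \<Rightarrow> bool" where
  "linear_functional_on F S \<longleftrightarrow>
     (\<forall>f\<in>F. \<forall>g\<in>F. S (\<lambda>x. f x + g x) = S f + S g) \<and>
     (\<forall>c. \<forall>f\<in>F. S (\<lambda>x. c * f x) = c * S f)"

definition distributions :: "(real^'n::finite) set \<Rightarrow> ((real^'n \<Rightarrow> complex) \<Rightarrow> complex) set" where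
  "distributions \<Omega> = {S. linear_functional_on (test_functions \<Omega>) S \<and>
     (\<forall>K. compact K \<and> K \<subseteq> \<Omega> \<longrightarrow>
        (\<exists>j c. \<forall>f\<in>smooth_supported \<Omega> K. cmod (S f) \<le> c * ck_norm K j f))}"

text \<open>The dual of the space of all smooth functions on \<open>\<Omega>\<close>. By the estimate \<open>S f\<close> depends on the
  values of \<open>f\<close> in \<open>\<Omega>\<close> only.\<close>

definition compact_distributions ::
    "(real^'n::finite) set \<Rightarrow> ((real^'n \<Rightarrow> complex) \<Rightarrow> complex) set" where
  "compact_distributions \<Omega> = {S. linear_functional_on {f. smooth_on \<Omega> f} S \<and>
     (\<exists>K j c. compact K \<and> K \<subseteq> \<Omega> \<and>
        (\<forall>f. smooth_on \<Omega> f \<longrightarrow> cmod (S f) \<le> c * ck_norm K j f))}"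

section \<open>The Colombeau algebra\<close>

type_synonym 'n net = "real \<Rightarrow> real^'n \<Rightarrow> complex"

definition moderate_nets :: "(real^'n::finite) set \<Rightarrow> 'n net set" where
  "moderate_nets \<Omega> = {u. (\<forall>\<epsilon>\<in>{0<..1}. smooth_on \<Omega> (u \<epsilon>)) \<and>
     (\<forall>K. compact K \<and> K \<subseteq> \<Omega> \<longrightarrow>
        (\<forall>\<alpha>. moderate (\<lambda>\<epsilon>. sup_on K (mderivative \<alpha> (u \<epsilon>)))))}"

definition negligible_nets :: "(real^'n::finite) set \<Rightarrow> 'n net set" where
  "negligible_nets \<Omega> = {u. (\<forall>\<epsilon>\<in>{0<..1}. smooth_on \<Omega> (u \<epsilon>)) \<and>
     (\<forall>K. compact K \<and> K \<subseteq> \<Omega> \<longrightarrow>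
        (\<forall>\<alpha>. negligible_net (\<lambda>\<epsilon>. sup_on K (mderivative \<alpha> (u \<epsilon>)))))}"

text \<open>Classes modulo negligible nets. Nets are total functions; nets that agree at all parameters
  in \<open>{0<..1}\<close> and all points of the open set \<open>\<Omega>\<close> lie in the same class, so the quotient
  identifies them as nets of functions on \<open>\<Omega>\<close>.\<close>

definition gclass :: "(real^'n::finite) set \<Rightarrow> 'n net \<Rightarrow> 'n net set" where
  "gclass \<Omega> u = {v \<in> moderate_nets \<Omega>. (\<lambda>\<epsilon> x. v \<epsilon> x - u \<epsilon> x) \<in> negligible_nets \<Omega>}"

definition colombeau :: "(real^'n::finite) set \<Rightarrow> 'n net set set" where
  "colombeau \<Omega> = gclass \<Omega> ` moderate_nets \<Omega>"

text \<open>The operations are applied to an arbitrary representative.\<close>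

definition grep :: "'n::finite net set \<Rightarrow> 'n net" where
  "grep u = (SOME w. w \<in> u)"

definition gzero :: "(real^'n::finite) set \<Rightarrow> 'n net set" where
  "gzero \<Omega> = gclass \<Omega> (\<lambda>\<epsilon> x. 0)"

definition gadd :: "(real^'n::finite) set \<Rightarrow> 'n net set \<Rightarrow> 'n net set \<Rightarrow> 'n net set" where
  "gadd \<Omega> u v = gclass \<Omega> (\<lambda>\<epsilon> x. grep u \<epsilon> x + grep v \<epsilon> x)"

definition gdiff :: "(real^'n::finite) set \<Rightarrow> 'n net set \<Rightarrow> 'n net set \<Rightarrow> 'n net set" where
  "gdiff \<Omega> u v = gclass \<Omega> (\<lambda>\<epsilon> x. grep u \<epsilon> x - grep v \<epsilon> x)"

definition gscale :: "(real^'n::finite) set \<Rightarrow> gcomplex \<Rightarrow> 'n net set \<Rightarrow> 'n net set" where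
  "gscale \<Omega> c u = gclass \<Omega> (\<lambda>\<epsilon> x. rep_gcomplex c \<epsilon> * grep u \<epsilon> x)"

definition gderiv :: "(real^'n::finite) set \<Rightarrow> 'n mindex \<Rightarrow> 'n net set \<Rightarrow> 'n net set" where
  "gderiv \<Omega> \<alpha> u = gclass \<Omega> (\<lambda>\<epsilon>. mderivative \<alpha> (grep u \<epsilon>))"

definition grestrict :: "(real^'n::finite) set \<Rightarrow> 'n net set \<Rightarrow> 'n net set" where
  "grestrict W u = gclass W (grep u)"

definition gsupp :: "(real^'n::finite) set \<Rightarrow> 'n net set \<Rightarrow> (real^'n) set" where
  "gsupp \<Omega> u = \<Omega> - \<Union>{W. open W \<and> W \<subseteq> \<Omega> \<and> grestrict W u = gzero W}"

definition colombeau_c :: "(real^'n::finite) set \<Rightarrow> 'n net set set" where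
  "colombeau_c \<Omega> = {u \<in> colombeau \<Omega>. compact (gsupp \<Omega> u)}"

definition colombeau_K :: "(real^'n::finite) set \<Rightarrow> (real^'n) set \<Rightarrow> 'n net set set" where
  "colombeau_K \<Omega> K = {u \<in> colombeau_c \<Omega>. gsupp \<Omega> u \<subseteq> K}"

text \<open>The representatives of \<open>u\<close> that are supported, uniformly in the parameter, in one compact
  subset of \<open>\<Omega>\<close>; as total functions they vanish outside \<open>\<Omega>\<close>.\<close>

definition compact_reps :: "(real^'n::finite) set \<Rightarrow> 'n net set \<Rightarrow> 'n net set" where
  "compact_reps \<Omega> u = {w \<in> u. \<exists>K. compact K \<and> K \<subseteq> \<Omega> \<and>
     (\<forall>\<epsilon>\<in>{0<..1}. w \<epsilon> \<in> smooth_supported \<Omega> K)}"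

text \<open>The embedding of the compactly supported elements over \<open>V\<close> into those over \<open>U \<supseteq> V\<close>
  (extension by zero).\<close>

definition gextend ::
    "(real^'n::finite) set \<Rightarrow> (real^'n) set \<Rightarrow> 'n net set \<Rightarrow> 'n net set" where
  "gextend U V u = gclass U (SOME w. w \<in> compact_reps V u)"

section \<open>Topologies\<close>

definition ups :: "(real^'n::finite) set \<Rightarrow> nat \<Rightarrow> 'n net set \<Rightarrow> real" where
  "ups K j u = sharp_norm (\<lambda>\<epsilon>. ck_norm K j (grep u \<epsilon>))"

definition ups_topology ::
    "(real^'n::finite) set \<Rightarrow> 'n net set set \<Rightarrow> ('n net set \<Rightarrow> real) set \<Rightarrow> 'n net set topology" where
  "ups_topology \<Omega> M P =
     topology_generated_by {{v \<in> M. p (gdiff \<Omega> v u) < \<delta>} | u p \<delta>. u \<in> M \<and> p \<in> P \<and> \<delta> > 0}"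

definition colombeau_topology :: "(real^'n::finite) set \<Rightarrow> 'n net set topology" where
  "colombeau_topology \<Omega> =
     ups_topology \<Omega> (colombeau \<Omega>) {ups K j | K j. compact K \<and> K \<subseteq> \<Omega>}"

text \<open>For open \<open>\<Omega>\<close> and compact \<open>K \<subseteq> \<Omega>\<close> such a neighbourhood exists; the seminorms on
  \<open>colombeau_K \<Omega> K\<close> do not depend on the choice.\<close>

definition compact_nbhd :: "(real^'n::finite) set \<Rightarrow> (real^'n) set \<Rightarrow> (real^'n) set" where
  "compact_nbhd \<Omega> K = (SOME L. compact L \<and> K \<subseteq> interior L \<and> L \<subseteq> \<Omega>)"

definition colombeau_K_topology ::
    "(real^'n::finite) set \<Rightarrow> (real^'n) set \<Rightarrow> 'n net set topology" where
  "colombeau_K_topology \<Omega> K =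
     ups_topology \<Omega> (colombeau_K \<Omega> K) (range (\<lambda>j. ups (compact_nbhd \<Omega> K) j))"

definition colombeau_Km_topology ::
    "nat \<Rightarrow> (real^'n::finite) set \<Rightarrow> (real^'n) set \<Rightarrow> 'n net set topology" where
  "colombeau_Km_topology m \<Omega> K =
     ups_topology \<Omega> (colombeau_K \<Omega> K) {ups (compact_nbhd \<Omega> K) m}"

text \<open>The inductive limit, over the compact subsets \<open>K\<close> of \<open>\<Omega>\<close>, of the spaces \<open>colombeau_K \<Omega> K\<close>
  with topologies \<open>\<tau> K\<close>, i.e. the finest locally convex module topology for which all inclusions
  are continuous. A set is absolutely convex over the ring of generalized numbers if it is stable
  under addition and under scalars of ultra-norm at most \<open>1\<close>; the absolutely convex sets whose
  trace on each step is a neighbourhood of zero form a base of neighbourhoods of zero.\<close>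

definition absolutely_convex :: "(real^'n::finite) set \<Rightarrow> 'n net set set \<Rightarrow> bool" where
  "absolutely_convex \<Omega> V \<longleftrightarrow>
     (\<forall>u\<in>V. \<forall>v\<in>V. gadd \<Omega> u v \<in> V) \<and>
     (\<forall>c. \<forall>u\<in>V. enorm c \<le> 1 \<longrightarrow> gscale \<Omega> c u \<in> V)"

definition inductive_nbhds ::
    "(real^'n::finite) set \<Rightarrow> ((real^'n) set \<Rightarrow> 'n net set topology) \<Rightarrow> 'n net set set set" where
  "inductive_nbhds \<Omega> \<tau> = {V. V \<subseteq> colombeau_c \<Omega> \<and> absolutely_convex \<Omega> V \<and>
     (\<forall>K. compact K \<and> K \<subseteq> \<Omega> \<longrightarrow> (\<exists>O'. openin (\<tau> K) O' \<and> gzero \<Omega> \<in> O' \<and> O' \<subseteq> V))}"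

definition inductive_limit_topology ::
    "(real^'n::finite) set \<Rightarrow> ((real^'n) set \<Rightarrow> 'n net set topology) \<Rightarrow> 'n net set topology" where
  "inductive_limit_topology \<Omega> \<tau> =
     topology_generated_by {gadd \<Omega> u ` V | u V. u \<in> colombeau_c \<Omega> \<and> V \<in> inductive_nbhds \<Omega> \<tau>}"

definition colombeau_c_topology :: "(real^'n::finite) set \<Rightarrow> 'n net set topology" where
  "colombeau_c_topology \<Omega> = inductive_limit_topology \<Omega> (colombeau_K_topology \<Omega>)"

definition colombeau_cm_topology :: "nat \<Rightarrow> (real^'n::finite) set \<Rightarrow> 'n net set topology" where
  "colombeau_cm_topology m \<Omega> = inductive_limit_topology \<Omega> (colombeau_Km_topology m \<Omega>)"

section \<open>Duals\<close>

text \<open>Functionals are total HOL functions of which only the values on the respective module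
  matter.\<close>

type_synonym 'n functional = "'n net set \<Rightarrow> gcomplex"

definition glinear ::
    "(real^'n::finite) set \<Rightarrow> 'n net set set \<Rightarrow> 'n functional \<Rightarrow> bool" where
  "glinear \<Omega> M T \<longleftrightarrow>
     (\<forall>u\<in>M. \<forall>v\<in>M. T (gadd \<Omega> u v) = T u + T v) \<and>
     (\<forall>c. \<forall>u\<in>M. T (gscale \<Omega> c u) = c * T u)"

definition dual_G :: "(real^'n::finite) set \<Rightarrow> 'n functional set" where
  "dual_G \<Omega> = {T. glinear \<Omega> (colombeau \<Omega>) T \<and>
     continuous_map (colombeau_topology \<Omega>) gcomplex_topology T}"

definition dual_Gc :: "(real^'n::finite) set \<Rightarrow> 'n functional set" where
  "dual_Gc \<Omega> = {T. glinear \<Omega> (colombeau_c \<Omega>) T \<and>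
     continuous_map (colombeau_c_topology \<Omega>) gcomplex_topology T}"

definition dual_Gcm :: "nat \<Rightarrow> (real^'n::finite) set \<Rightarrow> 'n functional set" where
  "dual_Gcm m \<Omega> = {T. glinear \<Omega> (colombeau_c \<Omega>) T \<and>
     continuous_map (colombeau_cm_topology m \<Omega>) gcomplex_topology T}"

definition basic_Gc :: "(real^'n::finite) set \<Rightarrow> 'n functional \<Rightarrow> bool" where
  "basic_Gc \<Omega> T \<longleftrightarrow> (\<exists>S.
     (\<forall>\<epsilon>\<in>{0<..1}. S \<epsilon> \<in> distributions \<Omega>) \<and>
     (\<forall>K. compact K \<and> K \<subseteq> \<Omega> \<longrightarrow>
        (\<exists>(j::nat) (N::nat) (c::real) \<eta>. c > 0 \<and> \<eta> \<in> {0<..1} \<and>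
           (\<forall>f\<in>smooth_supported \<Omega> K. \<forall>\<epsilon>\<in>{0<..\<eta>}.
              cmod (S \<epsilon> f) \<le> c * \<epsilon> powr (- real N) * ck_norm K j f))) \<and>
     (\<forall>u\<in>colombeau_c \<Omega>. \<forall>w\<in>compact_reps \<Omega> u. T u = abs_gcomplex (\<lambda>\<epsilon>. S \<epsilon> (w \<epsilon>))))"

definition basic_G :: "(real^'n::finite) set \<Rightarrow> 'n functional \<Rightarrow> bool" where
  "basic_G \<Omega> T \<longleftrightarrow> (\<exists>S.
     (\<forall>\<epsilon>\<in>{0<..1}. S \<epsilon> \<in> compact_distributions \<Omega>) \<and>
     (\<exists>K (j::nat) (N::nat) (c::real) \<eta>. compact K \<and> K \<subseteq> \<Omega> \<and> c > 0 \<and> \<eta> \<in> {0<..1} \<and>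
        (\<forall>f. smooth_on \<Omega> f \<longrightarrow> (\<forall>\<epsilon>\<in>{0<..\<eta>}.
           cmod (S \<epsilon> f) \<le> c * \<epsilon> powr (- real N) * ck_norm K j f))) \<and>
     (\<forall>u\<in>colombeau \<Omega>. \<forall>w\<in>u. T u = abs_gcomplex (\<lambda>\<epsilon>. S \<epsilon> (w \<epsilon>))))"

definition functional_restrict ::
    "(real^'n::finite) set \<Rightarrow> (real^'n) set \<Rightarrow> 'n functional \<Rightarrow> 'n functional" where
  "functional_restrict U V T = (\<lambda>u. T (gextend U V u))"

definition functional_deriv ::
    "(real^'n::finite) set \<Rightarrow> 'n mindex \<Rightarrow> 'n functional \<Rightarrow> 'n functional" where
  "functional_deriv \<Omega> \<alpha> T = (\<lambda>u. (- 1) ^ morder \<alpha> * T (gderiv \<Omega> \<alpha> u))"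

definition moderate_continuous_nets :: "(real^'n::finite) set \<Rightarrow> 'n net set" where
  "moderate_continuous_nets \<Omega> = {g. (\<forall>\<epsilon>\<in>{0<..1}. continuous_on \<Omega> (g \<epsilon>)) \<and>
     (\<forall>K. compact K \<and> K \<subseteq> \<Omega> \<longrightarrow> moderate (\<lambda>\<epsilon>. sup_on K (g \<epsilon>)))}"

definition defined_by_net :: "(real^'n::finite) set \<Rightarrow> 'n functional \<Rightarrow> 'n net \<Rightarrow> bool" where
  "defined_by_net \<Omega> T g \<longleftrightarrow>
     (\<forall>u\<in>colombeau_c \<Omega>. \<forall>w\<in>compact_reps \<Omega> u.
        T u = abs_gcomplex (\<lambda>\<epsilon>. set_lebesgue_integral lborel \<Omega> (\<lambda>x. g \<epsilon> x * w \<epsilon> x)))"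

end

theory Submission
  imports Defs
begin

text \<open>A basic functional is given by a net of distributions \<open>S\<^sub>\<epsilon>\<close> which, on functions supported
  in a fixed compact set \<open>K\<close>, satisfy \<open>|S\<^sub>\<epsilon> f| \<le> c \<epsilon>\<^bsup>-N\<^esup> \<parallel>f\<parallel>\<close> with a \<open>C\<^sup>j\<close> norm on \<open>K\<close> whose
  order \<open>j\<close> does not depend on \<open>\<epsilon>\<close>. Hence both parts follow from a structure theorem for a
  single distribution in which the constants are controlled: if \<open>|S f| \<le> C \<parallel>f\<parallel>\<close> for all test
  functions \<open>f\<close> supported in \<open>K\<close>, and \<open>\<theta>\<close> is a smooth function supported in \<open>K\<close>, then
  \<open>S (\<theta> f) = \<integral> g \<partial>\<^sup>\<alpha> f\<close> with a multi-index \<open>\<alpha>\<close> that depends on \<open>j\<close> only and a continuous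
  function \<open>g\<close> with \<open>|g| \<le> D C\<close>, where \<open>D\<close> depends neither on \<open>S\<close> nor on \<open>C\<close>. This is
  \<open>cut_off_distribution_is_derivative\<close>. Applied at every \<open>\<epsilon>\<close>, it yields a moderate net of
  continuous functions.

  The structure theorem is proved by Fourier series on a cube \<open>[-R,R]\<^sup>n\<close> whose interior contains
  all supports. The waves \<open>e\<^sub>k(x) = exp(i \<xi>\<^sub>k \<bullet> x)\<close> with half-integer frequencies
  \<open>\<xi>\<^sub>k = (\<pi>/R)(k + (1/2,\<dots>,1/2))\<close>, \<open>k \<in> \<int>\<^sup>n\<close>, are orthogonal on the cube, and no coordinate of
  any \<open>\<xi>\<^sub>k\<close> vanishes, so that one can divide by \<open>(i \<xi>\<^sub>k)\<^sup>\<alpha>\<close> for every \<open>k\<close>. Let \<open>f\<close> be smooth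
  with compact support in the open cube. Integration by parts shows that its coefficients \<open>c\<^sub>k\<close>
  decay faster than every power of \<open>\<xi>\<^sub>k\<close>; hence \<open>\<Sum> c\<^sub>k e\<^sub>k\<close> converges to \<open>f\<close> in all \<open>C\<^sup>j\<close> norms
  (\<open>fourier_partial_sums_ck_norm\<close>) and \<open>S (\<theta> f) = \<Sum> c\<^sub>k S (\<theta> e\<^sub>k)\<close>. On the other hand
  \<open>c\<^sub>k = (2R)\<^bsup>-n\<^esup> (i \<xi>\<^sub>k)\<^bsup>-\<alpha>\<^esup> \<integral> e\<^bsub>-k\<^esub> \<partial>\<^sup>\<alpha> f\<close>, writing \<open>e\<^bsub>-k\<^esub>\<close> for the conjugate of \<open>e\<^sub>k\<close>. Since
  \<open>|S (\<theta> e\<^sub>k)|\<close> grows at most like \<open>C \<Prod>\<^sub>i (1 + |\<xi>\<^bsub>k,i\<^esub>|)\<^sup>j\<close>, for \<open>\<alpha> = (j+2,\<dots>,j+2)\<close> the series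
  \<open>g = \<Sum> S (\<theta> e\<^sub>k) (2R)\<^bsup>-n\<^esup> (i \<xi>\<^sub>k)\<^bsup>-\<alpha>\<^esup> e\<^bsub>-k\<^esub>\<close> is dominated by \<open>C \<Sum>\<^sub>k \<Prod>\<^sub>i |\<xi>\<^bsub>k,i\<^esub>|\<^bsup>-2\<^esup>\<close> up to a
  constant, and it satisfies \<open>\<integral> g \<partial>\<^sup>\<alpha> f = S (\<theta> f)\<close>.

  For the restriction to a bounded open set \<open>\<Omega>\<close>, take \<open>\<theta> = 1\<close> near the closure of \<open>\<Omega>\<close>. For a
  basic functional on all smooth functions, the estimate forces \<open>S\<^sub>\<epsilon> f = S\<^sub>\<epsilon> (\<theta>\<^sub>1 f)\<close> for a
  cutoff \<open>\<theta>\<^sub>1\<close> that is \<open>1\<close> near the compact set of the estimate; take \<open>\<theta> = 1\<close> near the support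
  of \<open>\<theta>\<^sub>1\<close>. The Leibniz rule for \<open>\<partial>\<^sup>\<alpha>(\<theta>\<^sub>1 f)\<close> then gives finitely many terms in which
  derivatives of \<open>\<theta>\<^sub>1\<close> multiply \<open>g\<close>.

  It remains to see that a net \<open>g\<close> in \<open>\<M>\<^bsub>\<C>(\<Omega>)\<^esub>\<close> defines a functional continuous for the topology
  of \<open>\<G>\<^sup>0\<^sub>c(\<Omega>)\<close> (\<open>net_functional_dual\<close>). The ultra-norm on the ring of generalized numbers
  satisfies the strong triangle inequality, so for a linear \<open>T\<close> the sets \<open>{u. |T u| < \<delta>}\<close> are
  absolutely convex. Their trace on \<open>\<G>\<^sup>0\<^sub>K(\<Omega>)\<close> is a neighbourhood of zero, because the integral
  of \<open>g\<^sub>\<epsilon> w\<^sub>\<epsilon>\<close> over a fixed compact set is bounded by a fixed negative power of \<open>\<epsilon>\<close> times the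
  supremum of \<open>|w\<^sub>\<epsilon>|\<close>.\<close>

section \<open>Iterated partial derivatives of smooth functions\<close>

text \<open>Multi-indices do not record an order of differentiation. Lists do, and they allow proofs
  by induction on the number of derivatives; \<open>pderivs_eq_mderivative\<close> translates back.\<close>

abbreviation pderivs :: "'n::finite list \<Rightarrow> (real^'n \<Rightarrow> complex) \<Rightarrow> real^'n \<Rightarrow> complex" where
  "pderivs is f \<equiv> foldr pderivative is f"

lemma pderivative_eq_derivative:
  assumes "(f has_derivative f') (at x)"
  shows "pderivative i f x = f' (axis i 1)"
proof -
  have 1: "((\<lambda>t. x + t *\<^sub>R axis i (1::real)) has_derivative (\<lambda>t. t *\<^sub>R axis i 1)) (at 0)"
    by (auto intro!: derivative_eq_intros)
  have 2: "(f has_derivative f') (at (x + 0 *\<^sub>R axis i 1))"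
    using assms by simp
  have "((\<lambda>t. f (x + t *\<^sub>R axis i 1)) has_derivative (\<lambda>t. f' (t *\<^sub>R axis i 1))) (at 0)"
    using has_derivative_compose[OF 1 2] by simp
  then have "((\<lambda>t. f (x + t *\<^sub>R axis i 1)) has_vector_derivative f' (axis i 1)) (at 0)"
    unfolding has_vector_derivative_def
    using linear_cmul[OF has_derivative_linear[OF assms]] by simp
  then show ?thesis
    unfolding pderivative_def by (rule vector_derivative_at)
qed

lemma has_vector_derivative_along_axis:
  assumes "f differentiable (at (x + s *\<^sub>R axis i 1))"
  shows "((\<lambda>t. f (x + t *\<^sub>R axis i 1)) has_vector_derivative
    pderivative i f (x + s *\<^sub>R axis i 1)) (at s)"
proof -
  obtain f' where f': "(f has_derivative f') (at (x + s *\<^sub>R axis i 1))"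
    using assms unfolding differentiable_def by blast
  have 1: "((\<lambda>t. x + t *\<^sub>R axis i (1::real)) has_derivative (\<lambda>t. t *\<^sub>R axis i 1)) (at s)"
    by (auto intro!: derivative_eq_intros)
  have "((\<lambda>t. f (x + t *\<^sub>R axis i 1)) has_derivative (\<lambda>t. f' (t *\<^sub>R axis i 1))) (at s)"
    using has_derivative_compose[OF 1 f'] by simp
  then show ?thesis
    unfolding has_vector_derivative_def pderivative_eq_derivative[OF f']
    using linear_cmul[OF has_derivative_linear[OF f']] by simp
qed

lemma pderivative_cong:
  assumes "open \<Omega>" "x \<in> \<Omega>" "\<And>y. y \<in> \<Omega> \<Longrightarrow> f y = g y"
  shows "pderivative i f x = pderivative i g x"
proof -
  have "((\<lambda>t. x + t *\<^sub>R axis i (1::real)) \<longlongrightarrow> x + 0 *\<^sub>R axis i 1) (at 0)"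
    by (intro tendsto_intros)
  then have "\<forall>\<^sub>F t in at 0. x + t *\<^sub>R axis i (1::real) \<in> \<Omega>"
    using assms(1,2) by (auto dest: topological_tendstoD)
  then have "\<forall>\<^sub>F t in nhds 0. x + t *\<^sub>R axis i (1::real) \<in> \<Omega>"
    using assms(2) unfolding eventually_nhds_conv_at by simp
  then have "\<forall>\<^sub>F t in nhds 0. f (x + t *\<^sub>R axis i 1) = g (x + t *\<^sub>R axis i 1)"
    by eventually_elim (rule assms(3))
  then show ?thesis
    unfolding pderivative_def by (intro vector_derivative_cong_eq) auto
qed

lemma pderivative_cong_ball:
  assumes "open \<Omega>" "\<forall>y\<in>\<Omega>. f y = g y" "x \<in> \<Omega>"
  shows "pderivative i f x = pderivative i g x"
  using assms by (intro pderivative_cong[of \<Omega>]) auto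

text \<open>Partial derivatives at a point of an open set depend on the values in that set only. This
  is used throughout, as functions on \<open>\<Omega>\<close> are total functions with arbitrary values elsewhere.\<close>

lemma pderivs_cong:
  assumes "open \<Omega>" "x \<in> \<Omega>" "\<And>y. y \<in> \<Omega> \<Longrightarrow> f y = g y"
  shows "pderivs is f x = pderivs is g x"
proof -
  have "\<forall>x\<in>\<Omega>. pderivs is f x = pderivs is g x"
  proof (induction "is")
    case (Cons i "is")
    then show ?case using pderivative_cong_ball[OF assms(1) Cons.IH] by simp
  qed (simp add: assms(3))
  then show ?thesis using assms(2) by blast
qed

lemma differentiable_on_open_cong:
  assumes "open \<Omega>" "\<And>y. y \<in> \<Omega> \<Longrightarrow> f y = g y" "g differentiable_on \<Omega>"
  shows "f differentiable_on \<Omega>"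
  unfolding differentiable_on_def
proof
  fix x assume x: "x \<in> \<Omega>"
  then obtain D where "(g has_derivative D) (at x within \<Omega>)"
    using assms(3) unfolding differentiable_on_def differentiable_def by blast
  from has_derivative_transform[OF x assms(2) this]
  show "f differentiable (at x within \<Omega>)" unfolding differentiable_def by blast
qed

lemma smooth_on_cong:
  assumes "open \<Omega>" "\<And>y. y \<in> \<Omega> \<Longrightarrow> f y = g y" "smooth_on \<Omega> g"
  shows "smooth_on \<Omega> f"
  unfolding smooth_on_def
proof
  fix "is"
  show "pderivs is f differentiable_on \<Omega>"
  proof (rule differentiable_on_open_cong[OF assms(1)])
    show "pderivs is f y = pderivs is g y" if "y \<in> \<Omega>" for y
      using pderivs_cong[OF assms(1) that assms(2)] .
    show "pderivs is g differentiable_on \<Omega>"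
      using assms(3) unfolding smooth_on_def by blast
  qed
qed

lemma smooth_on_subset: "smooth_on \<Omega> f \<Longrightarrow> V \<subseteq> \<Omega> \<Longrightarrow> smooth_on V f"
  unfolding smooth_on_def using differentiable_on_subset by blast

lemma smooth_on_pderivs:
  assumes "smooth_on \<Omega> f"
  shows "smooth_on \<Omega> (pderivs is f)"
  unfolding smooth_on_def
proof
  fix js
  have "pderivs (js @ is) f differentiable_on \<Omega>" using assms unfolding smooth_on_def by blast
  then show "pderivs js (pderivs is f) differentiable_on \<Omega>" by simp
qed

lemma smooth_on_pderivative: "smooth_on \<Omega> f \<Longrightarrow> smooth_on \<Omega> (pderivative i f)"
  using smooth_on_pderivs[of \<Omega> f "[i]"] by simp

lemma smooth_on_differentiable:
  assumes "smooth_on \<Omega> f" "open \<Omega>" "x \<in> \<Omega>"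
  shows "f differentiable (at x)"
proof -
  have "pderivs [] f differentiable_on \<Omega>" using assms(1) unfolding smooth_on_def by blast
  then show ?thesis
    using assms(2,3) by (simp add: differentiable_on_eq_differentiable_at)
qed

lemma smooth_on_continuous:
  assumes "smooth_on \<Omega> f" shows "continuous_on \<Omega> f"
proof -
  have "pderivs [] f differentiable_on \<Omega>" using assms unfolding smooth_on_def by blast
  then show ?thesis by (simp add: differentiable_imp_continuous_on)
qed

lemma smooth_on_Un:
  assumes "smooth_on U f" "smooth_on V f" "open U" "open V"
  shows "smooth_on (U \<union> V) f"
  using assms unfolding smooth_on_def
  by (simp add: differentiable_on_eq_differentiable_at open_Un Ball_def)

lemma pderivative_add:
  assumes "f differentiable (at x)" "g differentiable (at x)"
  shows "pderivative i (\<lambda>x. f x + g x) x = pderivative i f x + pderivative i g x"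
proof -
  obtain f' g' where f: "(f has_derivative f') (at x)" and g: "(g has_derivative g') (at x)"
    using assms unfolding differentiable_def by blast
  show ?thesis
    using pderivative_eq_derivative[OF has_derivative_add[OF f g]]
      pderivative_eq_derivative[OF f] pderivative_eq_derivative[OF g] by metis
qed

lemma pderivative_mult:
  assumes "f differentiable (at x)" "g differentiable (at x)"
  shows "pderivative i (\<lambda>x. f x * g x) x = pderivative i f x * g x + f x * pderivative i g x"
proof -
  obtain f' g' where f: "(f has_derivative f') (at x)" and g: "(g has_derivative g') (at x)"
    using assms unfolding differentiable_def by blast
  have fg: "((\<lambda>x. f x * g x) has_derivative (\<lambda>h. f x * g' h + f' h * g x)) (at x)"
    using f g by (rule has_derivative_mult)
  show ?thesis
    using pderivative_eq_derivative[OF fg]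
      pderivative_eq_derivative[OF f] pderivative_eq_derivative[OF g]
    by (metis add.commute)
qed

text \<open>The criterion for smoothness used below: a family of differentiable functions that is
  closed under partial differentiation consists of smooth functions. Induction on the list of
  derivatives then needs no formula for the iterated derivatives.\<close>

lemma smooth_onI_closed:
  assumes "open \<Omega>" and "\<And>f. f \<in> F \<Longrightarrow> f differentiable_on \<Omega>"
    and "\<And>f i. f \<in> F \<Longrightarrow> \<exists>g\<in>F. \<forall>x\<in>\<Omega>. pderivative i f x = g x" and "f \<in> F"
  shows "smooth_on \<Omega> f"
  unfolding smooth_on_def
proof
  fix "is"
  have "\<exists>g\<in>F. \<forall>x\<in>\<Omega>. pderivs is f x = g x"
  proof (induction "is")
    case Nil
    then show ?case using assms(4) by auto
  next
    case (Cons i "is")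
    then obtain g where g: "g \<in> F" "\<forall>x\<in>\<Omega>. pderivs is f x = g x" by blast
    obtain h where h: "h \<in> F" "\<forall>x\<in>\<Omega>. pderivative i g x = h x" using assms(3)[OF g(1)] by blast
    have "\<forall>x\<in>\<Omega>. pderivs (i # is) f x = h x"
      using h(2) pderivative_cong_ball[OF assms(1) g(2)] by simp
    then show ?case using h(1) by blast
  qed
  then show "pderivs is f differentiable_on \<Omega>"
    using differentiable_on_open_cong[OF assms(1)] assms(2) by metis
qed

text \<open>Sums of products of functions in \<open>G\<close>. By the sum and product rules this family is closed
  under partial derivatives as soon as it contains the partial derivatives of its generators.\<close>

inductive_set generated_algebra ::
    "(real^'n::finite \<Rightarrow> complex) set \<Rightarrow> (real^'n \<Rightarrow> complex) set" for G where
  gen: "f \<in> G \<Longrightarrow> f \<in> generated_algebra G"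
| add: "f \<in> generated_algebra G \<Longrightarrow> g \<in> generated_algebra G \<Longrightarrow>
    (\<lambda>x. f x + g x) \<in> generated_algebra G"
| mult: "f \<in> generated_algebra G \<Longrightarrow> g \<in> generated_algebra G \<Longrightarrow>
    (\<lambda>x. f x * g x) \<in> generated_algebra G"

lemma smooth_on_generated_algebra:
  assumes "open \<Omega>" and d: "\<And>f. f \<in> G \<Longrightarrow> f differentiable_on \<Omega>"
    and c: "\<And>f i. f \<in> G \<Longrightarrow> \<exists>g\<in>generated_algebra G. \<forall>x\<in>\<Omega>. pderivative i f x = g x"
    and "f \<in> generated_algebra G"
  shows "smooth_on \<Omega> f"
proof -
  have d': "f differentiable_on \<Omega>" if "f \<in> generated_algebra G" for f
    using that by induction (auto simp: d)
  then have at: "f differentiable (at x)" if "f \<in> generated_algebra G" "x \<in> \<Omega>" for f x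
    using that assms(1) by (simp add: differentiable_on_eq_differentiable_at)
  have "\<exists>g\<in>generated_algebra G. \<forall>x\<in>\<Omega>. pderivative i f x = g x"
    if "f \<in> generated_algebra G" for f i
    using that
  proof induction
    case (gen f)
    then show ?case by (rule c)
  next
    case (add f g)
    then obtain f' g' where "f' \<in> generated_algebra G" "g' \<in> generated_algebra G"
      "\<forall>x\<in>\<Omega>. pderivative i f x = f' x" "\<forall>x\<in>\<Omega>. pderivative i g x = g' x" by blast
    moreover from this have "(\<lambda>x. f' x + g' x) \<in> generated_algebra G"
      by (intro generated_algebra.add[of f' _ g']) simp_all
    moreover have "\<forall>x\<in>\<Omega>. pderivative i (\<lambda>x. f x + g x) x = pderivative i f x + pderivative i g x"
      by (simp add: pderivative_add at add.hyps)
    ultimately show ?case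
      by (intro bexI[of _ "\<lambda>x. f' x + g' x"]) simp_all
  next
    case (mult f g)
    then obtain f' g' where "f' \<in> generated_algebra G" "g' \<in> generated_algebra G"
      "\<forall>x\<in>\<Omega>. pderivative i f x = f' x" "\<forall>x\<in>\<Omega>. pderivative i g x = g' x" by blast
    moreover from this have "(\<lambda>x. f' x * g x + f x * g' x) \<in> generated_algebra G"
      using generated_algebra.add[OF generated_algebra.mult[of f' G g] generated_algebra.mult[of f G g']]
        mult.hyps by simp
    moreover have "\<forall>x\<in>\<Omega>. pderivative i (\<lambda>x. f x * g x) x
        = pderivative i f x * g x + f x * pderivative i g x"
      by (simp add: pderivative_mult at mult.hyps)
    ultimately show ?case
      by (intro bexI[of _ "\<lambda>x. f' x * g x + f x * g' x"]) simp_all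
  qed
  then show ?thesis
    using smooth_onI_closed[of \<Omega> "generated_algebra G"] assms(1,4) d' by blast
qed

lemma smooth_generated:
  fixes \<Omega> :: "(real^'n::finite) set"
  assumes "open \<Omega>" "f \<in> generated_algebra {f. smooth_on \<Omega> f}"
  shows "smooth_on \<Omega> f"
proof (rule smooth_on_generated_algebra[OF assms(1) _ _ assms(2)])
  fix f :: "real^'n \<Rightarrow> complex" and i :: 'n
  assume "f \<in> {f. smooth_on \<Omega> f}"
  then have f: "smooth_on \<Omega> f" by simp
  then show "f differentiable_on \<Omega>"
    using assms(1) smooth_on_differentiable[OF f]
    by (simp add: differentiable_on_eq_differentiable_at)
  have "pderivative i f \<in> generated_algebra {f. smooth_on \<Omega> f}"
    using smooth_on_pderivative[OF f] by (intro generated_algebra.gen) simp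
  then show "\<exists>g\<in>generated_algebra {f. smooth_on \<Omega> f}. \<forall>x\<in>\<Omega>. pderivative i f x = g x"
    by (rule bexI[rotated]) simp
qed

lemma smooth_on_add:
  assumes "open \<Omega>" "smooth_on \<Omega> f" "smooth_on \<Omega> g"
  shows "smooth_on \<Omega> (\<lambda>x. f x + g x)"
proof -
  have "f \<in> generated_algebra {f. smooth_on \<Omega> f}" "g \<in> generated_algebra {f. smooth_on \<Omega> f}"
    using assms(2,3) by (simp_all add: generated_algebra.gen)
  then show ?thesis
    by (intro smooth_generated[OF assms(1)] generated_algebra.add[of f _ g])
qed

lemma smooth_on_mult:
  assumes "open \<Omega>" "smooth_on \<Omega> f" "smooth_on \<Omega> g"
  shows "smooth_on \<Omega> (\<lambda>x. f x * g x)"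
proof -
  have "f \<in> generated_algebra {f. smooth_on \<Omega> f}" "g \<in> generated_algebra {f. smooth_on \<Omega> f}"
    using assms(2,3) by (simp_all add: generated_algebra.gen)
  then show ?thesis
    by (intro smooth_generated[OF assms(1)] generated_algebra.mult[of f _ g])
qed

lemma smooth_on_affine:
  fixes \<Omega> :: "(real^'n::finite) set"
  assumes "open \<Omega>" shows "smooth_on \<Omega> (\<lambda>x. of_real (a \<bullet> x) + c)"
proof -
  define F where "F = range (\<lambda>(a :: real^'n, c) x. complex_of_real (a \<bullet> x) + c)"
  have mem: "(\<lambda>x. of_real (a \<bullet> x) + c) \<in> F" for a c
    unfolding F_def by (rule range_eqI[of _ _ "(a, c)"]) simp
  have F: "\<exists>a c. f = (\<lambda>x. of_real (a \<bullet> x) + c)" if "f \<in> F" for f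
    using that unfolding F_def by (metis (no_types, lifting) case_prod_conv imageE surj_pair)
  have *: "((\<lambda>x. of_real (a \<bullet> x) + c) has_derivative (\<lambda>h. complex_of_real (a \<bullet> h))) (at x within A)"
    for a :: "real^'n" and c x A
    by (auto intro!: derivative_eq_intros)
  show ?thesis
  proof (rule smooth_onI_closed[OF assms _ _ mem])
    fix f i assume "f \<in> F"
    then obtain a c where f: "f = (\<lambda>x. of_real (a \<bullet> x) + c)" using F by metis
    show "f differentiable_on \<Omega>"
      unfolding differentiable_on_def differentiable_def f using * by metis
    have "pderivative i f x = of_real (0 \<bullet> x) + of_real (a \<bullet> axis i 1)" for x
      unfolding f using pderivative_eq_derivative[OF *[of a c x UNIV], of i] by simp
    with mem[of 0 "of_real (a \<bullet> axis i 1)"]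
    show "\<exists>g\<in>F. \<forall>x\<in>\<Omega>. pderivative i f x = g x" by metis
  qed
qed

lemma smooth_on_const: "open \<Omega> \<Longrightarrow> smooth_on \<Omega> (\<lambda>x. c)"
  using smooth_on_affine[of \<Omega> 0 c] by simp

lemma smooth_on_coordinate: "open \<Omega> \<Longrightarrow> smooth_on \<Omega> (\<lambda>x. of_real (x $ i))"
  using smooth_on_affine[of \<Omega> "axis i 1" 0] by (simp add: inner_axis')

lemma smooth_on_cmult: "open \<Omega> \<Longrightarrow> smooth_on \<Omega> f \<Longrightarrow> smooth_on \<Omega> (\<lambda>x. c * f x)"
  by (rule smooth_on_mult[OF _ smooth_on_const])

lemma smooth_on_diff:
  "open \<Omega> \<Longrightarrow> smooth_on \<Omega> f \<Longrightarrow> smooth_on \<Omega> g \<Longrightarrow> smooth_on \<Omega> (\<lambda>x. f x - g x)"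
  using smooth_on_add[OF _ _ smooth_on_cmult[of \<Omega> g "-1"]] by simp

lemma smooth_on_sum:
  "open \<Omega> \<Longrightarrow> (\<And>k. k \<in> A \<Longrightarrow> smooth_on \<Omega> (f k)) \<Longrightarrow> smooth_on \<Omega> (\<lambda>x. \<Sum>k\<in>A. f k x)"
  by (induction A rule: infinite_finite_induct) (auto intro!: smooth_on_add smooth_on_const)

lemma smooth_on_prod:
  "open \<Omega> \<Longrightarrow> (\<And>k. k \<in> A \<Longrightarrow> smooth_on \<Omega> (f k)) \<Longrightarrow> smooth_on \<Omega> (\<lambda>x. \<Prod>k\<in>A. f k x)"
  by (induction A rule: infinite_finite_induct) (auto intro!: smooth_on_mult smooth_on_const)

text \<open>The chain rule for an outer function of one real variable, given together with all its
  derivatives \<open>H n\<close>: the algebra generated by the smooth functions and the functions \<open>H n \<circ> q\<close>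
  is closed under partial derivatives.\<close>

lemma smooth_on_compose_real:
  fixes q :: "real^'n::finite \<Rightarrow> real" and H :: "nat \<Rightarrow> real \<Rightarrow> real"
  assumes "open \<Omega>" and q: "smooth_on \<Omega> (\<lambda>x. of_real (q x))"
    and H: "\<And>n x. x \<in> \<Omega> \<Longrightarrow> (H n has_real_derivative H (Suc n) (q x)) (at (q x))"
  shows "smooth_on \<Omega> (\<lambda>x. of_real (H 0 (q x)))"
proof -
  define G where "G = {f. smooth_on \<Omega> f} \<union> range (\<lambda>n x. complex_of_real (H n (q x)))"
  have *: "((\<lambda>x. complex_of_real (H n (q x))) has_derivative
       (\<lambda>h. complex_of_real (H (Suc n) (q x)) * Q' h)) (at x)"
    if Q': "((\<lambda>x. complex_of_real (q x)) has_derivative Q') (at x)" and x: "x \<in> \<Omega>" for n x Q'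
  proof -
    have "((\<lambda>x. Re (complex_of_real (q x))) has_derivative (\<lambda>h. Re (Q' h))) (at x)"
      by (rule has_derivative_Re[OF Q'])
    then have q': "(q has_derivative (\<lambda>h. Re (Q' h))) (at x)" by simp
    have "((\<lambda>x. complex_of_real (q x)) has_derivative (\<lambda>h. of_real (Re (Q' h)))) (at x)"
      by (rule has_derivative_of_real[OF q'])
    from has_derivative_unique[OF this Q'] have Re: "of_real (Re (Q' h)) = Q' h" for h by metis
    have "(H n has_derivative (\<lambda>s. H (Suc n) (q x) * s)) (at (q x))"
      using H[OF x, of n] by (simp add: has_field_derivative_def)
    from has_derivative_compose[OF q' this]
    have "((\<lambda>x. H n (q x)) has_derivative (\<lambda>h. H (Suc n) (q x) * Re (Q' h))) (at x)" by simp
    from has_derivative_of_real[OF this, where ?'a = complex] show ?thesis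
      by (simp add: Re)
  qed
  have q': "\<exists>Q'. ((\<lambda>x. complex_of_real (q x)) has_derivative Q') (at x)" if "x \<in> \<Omega>" for x
    using smooth_on_differentiable[OF q assms(1) that] by (simp add: differentiable_def)
  have "(\<lambda>x. of_real (H 0 (q x))) \<in> generated_algebra G"
    by (rule generated_algebra.gen) (auto simp: G_def)
  with assms(1) _ _ show ?thesis
  proof (rule smooth_on_generated_algebra)
    have "f differentiable (at x)" if f: "f \<in> G" and x: "x \<in> \<Omega>" for f x
    proof (cases "smooth_on \<Omega> f")
      case True
      then show ?thesis using assms(1) x by (rule smooth_on_differentiable)
    next
      case False
      then obtain n where "f = (\<lambda>x. complex_of_real (H n (q x)))" using f by (auto simp: G_def)
      moreover obtain Q' where Q': "((\<lambda>x. complex_of_real (q x)) has_derivative Q') (at x)"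
        using q'[OF x] by blast
      ultimately show ?thesis using *[OF Q' x, of n] unfolding differentiable_def by blast
    qed
    then show "f differentiable_on \<Omega>" if "f \<in> G" for f
      using that assms(1) by (simp add: differentiable_on_eq_differentiable_at)
    fix f i assume f: "f \<in> G"
    show "\<exists>g\<in>generated_algebra G. \<forall>x\<in>\<Omega>. pderivative i f x = g x"
    proof (cases "smooth_on \<Omega> f")
      case True
      then have "pderivative i f \<in> generated_algebra G"
        by (intro generated_algebra.gen) (simp add: G_def smooth_on_pderivative)
      then show ?thesis by (rule bexI[rotated]) simp
    next
      case False
      with f obtain n where n: "f = (\<lambda>x. complex_of_real (H n (q x)))" by (auto simp: G_def)
      have "pderivative i f x = complex_of_real (H (Suc n) (q x)) *
          pderivative i (\<lambda>x. complex_of_real (q x)) x" if x: "x \<in> \<Omega>" for x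
      proof -
        obtain Q' where Q': "((\<lambda>x. complex_of_real (q x)) has_derivative Q') (at x)"
          using q'[OF x] by blast
        show ?thesis
          unfolding n pderivative_eq_derivative[OF Q'] pderivative_eq_derivative[OF *[OF Q' x]] ..
      qed
      moreover have "(\<lambda>x. complex_of_real (H (Suc n) (q x)) *
          pderivative i (\<lambda>x. complex_of_real (q x)) x) \<in> generated_algebra G"
        by (rule generated_algebra.mult[OF generated_algebra.gen generated_algebra.gen])
         (auto simp: G_def smooth_on_pderivative[OF q])
      ultimately show ?thesis by (intro bexI) (rule ballI)
    qed
  qed
qed

section \<open>Symmetry of partial derivatives\<close>

text \<open>Two applications of the mean value theorem, one in each direction. As the second
  difference is symmetric in \<open>i\<close> and \<open>j\<close>, it is a value of either mixed derivative near \<open>x\<close>. The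
  mean value theorem needs real values, hence the functional \<open>L\<close>, which stands for the real or
  the imaginary part.\<close>

lemma second_difference_mean_value:
  fixes f :: "real^'n::finite \<Rightarrow> complex" and L :: "complex \<Rightarrow> real"
  assumes \<Omega>: "open \<Omega>" and f: "smooth_on \<Omega> f" and L: "bounded_linear L" and h: "0 < h"
    and sub: "\<And>s t. s \<in> {0..h} \<Longrightarrow> t \<in> {0..h} \<Longrightarrow> x + s *\<^sub>R axis i 1 + t *\<^sub>R axis j 1 \<in> \<Omega>"
  obtains s t where "s \<in> {0..h}" "t \<in> {0..h}"
    "L (f (x + h *\<^sub>R axis i 1 + h *\<^sub>R axis j 1) - f (x + h *\<^sub>R axis i 1)
        - f (x + h *\<^sub>R axis j 1) + f x)
      = h * h * L (pderivative j (pderivative i f) (x + s *\<^sub>R axis i 1 + t *\<^sub>R axis j 1))"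
proof -
  have der: "((\<lambda>s. L (g (y + s *\<^sub>R axis k 1))) has_real_derivative
      L (pderivative k g (y + s *\<^sub>R axis k 1))) (at s)"
    if "smooth_on \<Omega> g" "y + s *\<^sub>R axis k 1 \<in> \<Omega>" for g y s k
    unfolding has_real_derivative_iff_has_vector_derivative
    using bounded_linear.has_vector_derivative[OF L
        has_vector_derivative_along_axis[OF smooth_on_differentiable[OF that(1) \<Omega> that(2)]]] .
  define u where "u = (\<lambda>s. L (f (x + h *\<^sub>R axis j 1 + s *\<^sub>R axis i 1)) - L (f (x + s *\<^sub>R axis i 1)))"
  define u' where "u' = (\<lambda>s. L (pderivative i f (x + h *\<^sub>R axis j 1 + s *\<^sub>R axis i 1))
      - L (pderivative i f (x + s *\<^sub>R axis i 1)))"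
  have "\<exists>z. 0 < z \<and> z < h \<and> u h - u 0 = (h - 0) * u' z"
  proof (rule MVT2[OF h])
    fix s assume "0 \<le> s" "s \<le> h"
    then show "(u has_real_derivative u' s) (at s)"
      unfolding u_def u'_def using sub[of s h] sub[of s 0] h
      by (intro DERIV_diff der[OF f]) (auto simp: algebra_simps)
  qed
  then obtain s where s: "0 < s" "s < h" "u h - u 0 = h * u' s" by auto
  have "\<exists>z. 0 < z \<and> z < h \<and>
      L (pderivative i f (x + s *\<^sub>R axis i 1 + h *\<^sub>R axis j 1)) - L (pderivative i f (x + s *\<^sub>R axis i 1 + 0 *\<^sub>R axis j 1))
      = (h - 0) * L (pderivative j (pderivative i f) (x + s *\<^sub>R axis i 1 + z *\<^sub>R axis j 1))"
  proof (rule MVT2[OF h])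
    fix t assume "0 \<le> t" "t \<le> h"
    then show "((\<lambda>t. L (pderivative i f (x + s *\<^sub>R axis i 1 + t *\<^sub>R axis j 1))) has_real_derivative
        L (pderivative j (pderivative i f) (x + s *\<^sub>R axis i 1 + t *\<^sub>R axis j 1))) (at t)"
      using s by (intro der smooth_on_pderivative f sub) auto
  qed
  then obtain t where t: "0 < t" "t < h"
    "u' s = h * L (pderivative j (pderivative i f) (x + s *\<^sub>R axis i 1 + t *\<^sub>R axis j 1))"
    unfolding u'_def by (auto simp: algebra_simps)
  have "L (f (x + h *\<^sub>R axis i 1 + h *\<^sub>R axis j 1) - f (x + h *\<^sub>R axis i 1)
        - f (x + h *\<^sub>R axis j 1) + f x) = u h - u 0"
    using L by (simp add: u_def linear_simps algebra_simps)
  then show ?thesis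
    using that[of s t] s t by simp
qed

text \<open>If the two mixed derivatives differed at \<open>x\<close>, then by continuity their values near \<open>x\<close>
  would stay apart, whereas a small second difference is a value of each of them.\<close>

lemma pderivative_commute:
  fixes f :: "real^'n::finite \<Rightarrow> complex"
  assumes \<Omega>: "open \<Omega>" and f: "smooth_on \<Omega> f" and x: "x \<in> \<Omega>"
  shows "pderivative i (pderivative j f) x = pderivative j (pderivative i f) x"
proof -
  have part: "L (pderivative i (pderivative j f) x) = L (pderivative j (pderivative i f) x)"
    if L: "bounded_linear L" for L :: "complex \<Rightarrow> real"
  proof (rule ccontr)
    define a where "a = (\<lambda>y. L (pderivative i (pderivative j f) y))"
    define b where "b = (\<lambda>y. L (pderivative j (pderivative i f) y))"
    assume "\<not> ?thesis"
    then have ne: "\<bar>a x - b x\<bar> > 0" by (simp add: a_def b_def)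
    have "continuous_on \<Omega> a" "continuous_on \<Omega> b"
      unfolding a_def b_def
      by (intro bounded_linear.continuous_on[OF L] smooth_on_continuous smooth_on_pderivative f)+
    then have "isCont a x" "isCont b x" using \<Omega> x by (auto simp: continuous_on_eq_continuous_at)
    then obtain d1 d2 where d: "d1 > 0" "\<And>y. dist y x < d1 \<Longrightarrow> dist (a y) (a x) < \<bar>a x - b x\<bar> / 2"
       "d2 > 0" "\<And>y. dist y x < d2 \<Longrightarrow> dist (b y) (b x) < \<bar>a x - b x\<bar> / 2"
      using ne unfolding continuous_at_eps_delta by (metis half_gt_zero)
    obtain d3 where d3: "d3 > 0" "ball x d3 \<subseteq> \<Omega>" using \<Omega> x by (auto simp: open_contains_ball)
    define h where "h = Min {d1, d2, d3} / 3"
    have h: "h > 0" "3 * h \<le> d1" "3 * h \<le> d2" "3 * h \<le> d3"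
      using d d3 by (auto simp: h_def)
    have near: "dist (x + s *\<^sub>R axis k 1 + t *\<^sub>R axis l 1) x < 3 * h"
      if "s \<in> {0..h}" "t \<in> {0..h}" for s t k l
    proof -
      have "norm (s *\<^sub>R axis k (1::real) + t *\<^sub>R axis l 1 :: real^'n) \<le> \<bar>s\<bar> + \<bar>t\<bar>"
        by (rule norm_triangle_le) simp
      then show ?thesis using that h by (auto simp: dist_norm)
    qed
    have sub: "x + s *\<^sub>R axis k 1 + t *\<^sub>R axis l 1 \<in> \<Omega>" if "s \<in> {0..h}" "t \<in> {0..h}" for s t k l
      using near[OF that, of k l] d3 h by (auto simp: dist_commute)
    obtain s t where st: "s \<in> {0..h}" "t \<in> {0..h}"
      "L (f (x + h *\<^sub>R axis i 1 + h *\<^sub>R axis j 1) - f (x + h *\<^sub>R axis i 1)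
        - f (x + h *\<^sub>R axis j 1) + f x) = h * h * b (x + s *\<^sub>R axis i 1 + t *\<^sub>R axis j 1)"
      unfolding b_def using second_difference_mean_value[OF \<Omega> f L h(1) sub] by blast
    obtain s' t' where st': "s' \<in> {0..h}" "t' \<in> {0..h}"
      "L (f (x + h *\<^sub>R axis j 1 + h *\<^sub>R axis i 1) - f (x + h *\<^sub>R axis j 1)
        - f (x + h *\<^sub>R axis i 1) + f x) = h * h * a (x + s' *\<^sub>R axis j 1 + t' *\<^sub>R axis i 1)"
      unfolding a_def using second_difference_mean_value[OF \<Omega> f L h(1) sub] by blast
    have "h * h * b (x + s *\<^sub>R axis i 1 + t *\<^sub>R axis j 1) = h * h * a (x + s' *\<^sub>R axis j 1 + t' *\<^sub>R axis i 1)"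
      using st(3) st'(3) by (simp add: algebra_simps)
    then have "b (x + s *\<^sub>R axis i 1 + t *\<^sub>R axis j 1) = a (x + s' *\<^sub>R axis j 1 + t' *\<^sub>R axis i 1)"
      using h by simp
    moreover have "dist (b (x + s *\<^sub>R axis i 1 + t *\<^sub>R axis j 1)) (b x) < \<bar>a x - b x\<bar> / 2"
      using near[OF st(1,2)] h by (intro d) (auto intro: less_le_trans)
    moreover have "dist (a (x + s' *\<^sub>R axis j 1 + t' *\<^sub>R axis i 1)) (a x) < \<bar>a x - b x\<bar> / 2"
      using near[OF st'(1,2)] h by (intro d) (auto intro: less_le_trans)
    moreover have False if "A = B" "\<bar>A - q\<bar> < \<bar>p - q\<bar> / 2" "\<bar>B - p\<bar> < \<bar>p - q\<bar> / 2" for A B p q :: real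
      using that by (auto simp: abs_if field_simps split: if_splits)
    ultimately show False unfolding dist_real_def by blast
  qed
  show ?thesis
    using part[OF bounded_linear_Re] part[OF bounded_linear_Im] by (rule complex_eqI)
qed

lemma pderivs_snoc_commute:
  assumes \<Omega>: "open \<Omega>" and "smooth_on \<Omega> f" "x \<in> \<Omega>"
  shows "pderivs (is @ [i]) f x = pderivs (i # is) f x"
proof -
  have "\<forall>x\<in>\<Omega>. pderivs (is @ [i]) f x = pderivs (i # is) f x"
  proof (induction "is")
    case (Cons j "is")
    have "pderivs ((j # is) @ [i]) f x = pderivative j (pderivs (i # is) f) x" if "x \<in> \<Omega>" for x
      using pderivative_cong_ball[OF \<Omega> Cons.IH that] by simp
    then show ?case
      using pderivative_commute[OF \<Omega> smooth_on_pderivs[OF assms(2)]] by auto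
  qed auto
  then show ?thesis using assms(3) by blast
qed

lemma pderivs_mset_cong:
  assumes \<Omega>: "open \<Omega>" and f: "smooth_on \<Omega> f" and "mset is = mset js" and x: "x \<in> \<Omega>"
  shows "pderivs is f x = pderivs js f x"
  using assms(3) x
proof (induction "is" arbitrary: js x)
  case (Cons i "is")
  then have "i \<in> set js" by (metis list.set_intros(1) mset_eq_setD)
  then obtain as bs where js: "js = as @ i # bs" by (meson split_list)
  have "pderivs js f x = pderivs (as @ [i]) (pderivs bs f) x" by (simp add: js)
  also have "\<dots> = pderivative i (pderivs (as @ bs) f) x"
    using pderivs_snoc_commute[OF \<Omega> smooth_on_pderivs[OF f] Cons.prems(2)] by simp
  also have "\<dots> = pderivative i (pderivs is f) x"
    using Cons.prems by (intro pderivative_cong[OF \<Omega>] Cons.IH[symmetric]) (auto simp: js)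
  finally show ?case by simp
qed simp

lemma coordinates_distinct: "distinct (coordinates :: 'n::finite list)" "set (coordinates :: 'n list) = UNIV"
proof -
  have "\<exists>is. distinct is \<and> set is = (UNIV :: 'n set)"
    using finite_distinct_list[of "UNIV :: 'n set"] by auto
  from someI_ex[OF this] show "distinct (coordinates :: 'n list)" "set (coordinates :: 'n list) = UNIV"
    unfolding coordinates_def by auto
qed

text \<open>The list of differentiations behind \<^const>\<open>mderivative\<close>, in the order in which it performs
  them.\<close>

definition mindex_list :: "'n::finite mindex \<Rightarrow> 'n list" where
  "mindex_list \<alpha> = concat (map (\<lambda>i. replicate (\<alpha> i) i) coordinates)"

lemma mderivative_eq_pderivs: "mderivative \<alpha> f = pderivs (mindex_list \<alpha>) f"
proof -
  have "foldr (\<lambda>i. pderivative i ^^ \<alpha> i) is f = pderivs (concat (map (\<lambda>i. replicate (\<alpha> i) i) is)) f" for "is"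
    by (induction "is") simp_all
  then show ?thesis by (simp add: mderivative_def mindex_list_def)
qed

lemma count_list_mindex_list:
  fixes \<alpha> :: "'n::finite mindex"
  shows "count_list (mindex_list \<alpha>) i = \<alpha> i"
proof -
  have rep: "count_list (replicate n a) i = (if a = i then n else 0)" for n a
    by (induction n) auto
  have "count_list (concat (map (\<lambda>i. replicate (\<alpha> i) i) is)) i = (if i \<in> set is then \<alpha> i else 0)"
    if "distinct is" for "is"
    using that by (induction "is") (auto simp: rep)
  then show ?thesis
    unfolding mindex_list_def using coordinates_distinct[where 'n='n] by auto
qed

lemma morder_count_list: "morder (count_list is) = length is"
  unfolding morder_def by (rule sum_count_set) auto

lemma length_mindex_list: "length (mindex_list \<alpha>) = morder \<alpha>"
proof -
  have "count_list (mindex_list \<alpha>) = \<alpha>" using count_list_mindex_list by blast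
  then show ?thesis using morder_count_list[of "mindex_list \<alpha>"] by simp
qed

text \<open>Lists with the same number of occurrences of every coordinate are permutations of each
  other, and permuting derivatives of a smooth function changes nothing.\<close>

lemma pderivs_eq_mderivative:
  assumes "open \<Omega>" "smooth_on \<Omega> f" "x \<in> \<Omega>"
  shows "pderivs is f x = mderivative (count_list is) f x"
  unfolding mderivative_eq_pderivs
proof (rule pderivs_mset_cong[OF assms(1,2) _ assms(3)])
  show "mset is = mset (mindex_list (count_list is))"
    by (rule multiset_eqI) (simp add: count_mset count_list_mindex_list)
qed

lemma smooth_on_mderivative: "smooth_on \<Omega> f \<Longrightarrow> smooth_on \<Omega> (mderivative \<alpha> f)"
  unfolding mderivative_eq_pderivs by (rule smooth_on_pderivs)

section \<open>Linearity and the Leibniz rule\<close>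

lemma pderivs_add:
  assumes "open \<Omega>" "smooth_on \<Omega> f" "smooth_on \<Omega> g" "x \<in> \<Omega>"
  shows "pderivs is (\<lambda>x. f x + g x) x = pderivs is f x + pderivs is g x"
proof -
  have "\<forall>x\<in>\<Omega>. pderivs is (\<lambda>x. f x + g x) x = pderivs is f x + pderivs is g x"
  proof (induction "is")
    case (Cons i "is")
    show ?case
    proof
      fix x assume x: "x \<in> \<Omega>"
      have "pderivs (i # is) (\<lambda>x. f x + g x) x = pderivative i (\<lambda>x. pderivs is f x + pderivs is g x) x"
        using pderivative_cong_ball[OF assms(1) Cons.IH x] by simp
      also have "\<dots> = pderivs (i # is) f x + pderivs (i # is) g x"
        using smooth_on_differentiable[OF smooth_on_pderivs[OF assms(2)] assms(1) x]
            smooth_on_differentiable[OF smooth_on_pderivs[OF assms(3)] assms(1) x]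
          by (simp add: pderivative_add)
      finally show "pderivs (i # is) (\<lambda>x. f x + g x) x = pderivs (i # is) f x + pderivs (i # is) g x" .
    qed
  qed simp
  then show ?thesis using assms(4) by blast
qed

lemma pderivs_cmult:
  assumes "open \<Omega>" "smooth_on \<Omega> f" "x \<in> \<Omega>"
  shows "pderivs is (\<lambda>x. c * f x) x = c * pderivs is f x"
proof -
  have c0: "pderivative i (\<lambda>x. c) x = 0" for i x
    unfolding pderivative_def by simp
  have "\<forall>x\<in>\<Omega>. pderivs is (\<lambda>x. c * f x) x = c * pderivs is f x"
  proof (induction "is")
    case (Cons i "is")
    show ?case
    proof
      fix x assume x: "x \<in> \<Omega>"
      have "pderivs (i # is) (\<lambda>x. c * f x) x = pderivative i (\<lambda>x. c * pderivs is f x) x"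
        using pderivative_cong_ball[OF assms(1) Cons.IH x] by simp
      also have "\<dots> = c * pderivs (i # is) f x"
        using smooth_on_differentiable[OF smooth_on_pderivs[OF assms(2)] assms(1) x] c0
          by (subst pderivative_mult) auto
      finally show "pderivs (i # is) (\<lambda>x. c * f x) x = c * pderivs (i # is) f x" .
    qed
  qed simp
  then show ?thesis using assms(3) by blast
qed

lemma pderivs_diff:
  assumes "open \<Omega>" "smooth_on \<Omega> f" "smooth_on \<Omega> g" "x \<in> \<Omega>"
  shows "pderivs is (\<lambda>x. f x - g x) x = pderivs is f x - pderivs is g x"
  using pderivs_add[OF assms(1,2) smooth_on_cmult[OF assms(1,3), of "-1"] assms(4), of "is"]
    pderivs_cmult[OF assms(1,3,4), of "is" "-1"] by simp

lemma pderivs_zero: "pderivs is (\<lambda>x. 0) x = 0"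
  using pderivs_cmult[of UNIV "\<lambda>x. 0" x "is" 0] smooth_on_const[of UNIV 0] by simp

lemma pderivs_sum:
  assumes "open \<Omega>" "\<And>k. k \<in> A \<Longrightarrow> smooth_on \<Omega> (f k)" "x \<in> \<Omega>"
  shows "pderivs is (\<lambda>x. \<Sum>k\<in>A. f k x) x = (\<Sum>k\<in>A. pderivs is (f k) x)"
  using assms(2)
  by (induction A rule: infinite_finite_induct)
     (auto simp: pderivs_zero pderivs_add[OF assms(1) _ _ assms(3)] smooth_on_sum[OF assms(1)])

lemma pderivs_zero_off:
  assumes "closed K" "\<And>x. x \<notin> K \<Longrightarrow> f x = 0" "x \<notin> K"
  shows "pderivs is f x = 0"
  using pderivs_cong[of "- K" x f "\<lambda>x. 0" "is"] assms by (auto simp: pderivs_zero)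

text \<open>The terms of the iterated product rule: every derivative in the list falls on the first or
  on the second factor, and the order is kept in both. Listing the \<open>2\<^sup>l\<close> terms with repetition
  avoids binomial coefficients.\<close>

fun splits :: "'a list \<Rightarrow> ('a list \<times> 'a list) list" where
  "splits [] = [([], [])]"
| "splits (i # is) = concat (map (\<lambda>(a, b). [(i # a, b), (a, i # b)]) (splits is))"

lemma length_splits: "length (splits is) = 2 ^ length is"
  by (induction "is") (auto simp: length_concat case_prod_unfold comp_def sum_list_triv)

lemma length_splits_parts: "(a, b) \<in> set (splits is) \<Longrightarrow> length a + length b = length is"
  by (induction "is" arbitrary: a b) auto

lemma pderivs_mult:
  assumes "open \<Omega>" "smooth_on \<Omega> f" "smooth_on \<Omega> g" "x \<in> \<Omega>"
  shows "pderivs is (\<lambda>x. f x * g x) x = (\<Sum>(a, b)\<leftarrow>splits is. pderivs a f x * pderivs b g x)"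
proof -
  have "\<forall>x\<in>\<Omega>. pderivs is (\<lambda>x. f x * g x) x = (\<Sum>(a, b)\<leftarrow>splits is. pderivs a f x * pderivs b g x)"
  proof (induction "is")
    case (Cons i "is")
    show ?case
    proof
      fix x assume x: "x \<in> \<Omega>"
      have sm: "pderivs a f differentiable (at x)" "pderivs a g differentiable (at x)" for a
        using assms(1-3) x by (auto intro: smooth_on_differentiable smooth_on_pderivs)
      have d: "(\<lambda>x. \<Sum>(a, b)\<leftarrow>ps. pderivs a f x * pderivs b g x) differentiable (at x)" for ps
        by (induction ps) (auto simp: case_prod_unfold intro!: differentiable_add differentiable_mult sm)
      have "pderivs (i # is) (\<lambda>x. f x * g x) x
          = pderivative i (\<lambda>x. \<Sum>(a, b)\<leftarrow>splits is. pderivs a f x * pderivs b g x) x"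
        using pderivative_cong_ball[OF assms(1) Cons.IH x] by simp
      also have "\<dots> = (\<Sum>(a, b)\<leftarrow>concat (map (\<lambda>(a, b). [(i # a, b), (a, i # b)]) ps).
            pderivs a f x * pderivs b g x)" if "ps = splits is" for ps
        unfolding that[symmetric]
      proof (induction ps)
        case Nil
        then show ?case using pderivs_zero[of "[i]" x] by simp
      next
        case (Cons p ps)
        obtain a b where p: "p = (a, b)" by (cases p)
        have "pderivative i (\<lambda>x. \<Sum>(a, b)\<leftarrow>p # ps. pderivs a f x * pderivs b g x) x
          = pderivative i (\<lambda>x. pderivs a f x * pderivs b g x + (\<Sum>(a, b)\<leftarrow>ps. pderivs a f x * pderivs b g x)) x"
          by (simp add: p)
        also have "\<dots> = pderivative i (\<lambda>x. pderivs a f x * pderivs b g x) x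
            + pderivative i (\<lambda>x. \<Sum>(a, b)\<leftarrow>ps. pderivs a f x * pderivs b g x) x"
          by (rule pderivative_add) (auto intro!: differentiable_mult sm d)
        finally show ?case
          using Cons by (simp add: p pderivative_mult sm)
      qed
      finally show "pderivs (i # is) (\<lambda>x. f x * g x) x
        = (\<Sum>(a, b)\<leftarrow>splits (i # is). pderivs a f x * pderivs b g x)" by simp
    qed
  qed simp
  then show ?thesis using assms(4) by blast
qed

lemma pderivs_mult_bound:
  assumes "open \<Omega>" "smooth_on \<Omega> f" "smooth_on \<Omega> g" "x \<in> \<Omega>"
    and A: "\<And>a. length a \<le> length is \<Longrightarrow> cmod (pderivs a f x) \<le> A"
    and B: "\<And>b. length b \<le> length is \<Longrightarrow> cmod (pderivs b g x) \<le> B"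
  shows "cmod (pderivs is (\<lambda>x. f x * g x) x) \<le> 2 ^ length is * (A * B)"
proof -
  have A0: "0 \<le> A" using A[of "[]"] norm_ge_zero order_trans by (metis le0 list.size(3))
  have "cmod (\<Sum>(a, b)\<leftarrow>ps. pderivs a f x * pderivs b g x) \<le> length ps * (A * B)"
    if "set ps \<subseteq> set (splits is)" for ps
    using that
  proof (induction ps)
    case (Cons p ps)
    obtain a b where p: "p = (a, b)" by (cases p)
    have "length a + length b = length is" using Cons.prems length_splits_parts by (auto simp: p)
    then have "cmod (pderivs a f x * pderivs b g x) \<le> A * B"
      unfolding norm_mult by (intro mult_mono A B A0) auto
    then have "cmod (pderivs a f x * pderivs b g x + (\<Sum>(a, b)\<leftarrow>ps. pderivs a f x * pderivs b g x))
        \<le> A * B + length ps * (A * B)"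
      using Cons by (intro norm_triangle_le add_mono) auto
    then show ?case by (simp add: p algebra_simps)
  qed simp
  from this[of "splits is"] show ?thesis
    by (simp add: pderivs_mult[OF assms(1-4)] length_splits)
qed

section \<open>The seminorms of uniform convergence of derivatives\<close>

lemma sup_on_le: "0 \<le> c \<Longrightarrow> (\<And>x. x \<in> K \<Longrightarrow> cmod (h x) \<le> c) \<Longrightarrow> sup_on K h \<le> c"
  unfolding sup_on_def by (rule cSup_least) auto

lemma sup_on_bdd:
  assumes "compact K" "continuous_on K h"
  shows "bdd_above (insert 0 ((\<lambda>x. cmod (h x)) ` K))"
proof -
  have "compact ((\<lambda>x. cmod (h x)) ` K)"
    by (intro compact_continuous_image continuous_on_norm assms)
  then show ?thesis by (simp add: bounded_imp_bdd_above compact_imp_bounded)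
qed

lemma le_sup_on: "compact K \<Longrightarrow> continuous_on K h \<Longrightarrow> x \<in> K \<Longrightarrow> cmod (h x) \<le> sup_on K h"
  unfolding sup_on_def by (intro cSup_upper sup_on_bdd) auto

lemma sup_on_nonneg: "compact K \<Longrightarrow> continuous_on K h \<Longrightarrow> 0 \<le> sup_on K h"
  unfolding sup_on_def by (intro cSup_upper sup_on_bdd) auto

lemma ck_norm_le:
  fixes f :: "real^'n::finite \<Rightarrow> complex"
  assumes "0 \<le> c" "\<And>is x. length is \<le> j \<Longrightarrow> x \<in> K \<Longrightarrow> cmod (pderivs is f x) \<le> c"
  shows "ck_norm K j f \<le> c"
  unfolding ck_norm_def
proof (rule cSUP_least)
  have "morder (\<lambda>_. 0) \<le> j" by (simp add: morder_def)
  then show "{\<alpha> :: 'n mindex. morder \<alpha> \<le> j} \<noteq> {}" by blast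
  show "sup_on K (mderivative \<alpha> f) \<le> c" if "\<alpha> \<in> {\<alpha>. morder \<alpha> \<le> j}" for \<alpha>
    using that assms by (intro sup_on_le) (auto simp: mderivative_eq_pderivs length_mindex_list)
qed

lemma sup_on_le_ck_norm: "morder \<alpha> \<le> j \<Longrightarrow> sup_on K (mderivative \<alpha> f) \<le> ck_norm K j f"
  unfolding ck_norm_def
  by (rule cSUP_upper) (auto intro!: bdd_above_finite finite_imageI finite_morder_le)

lemma le_ck_norm:
  assumes "open \<Omega>" "smooth_on \<Omega> f" "compact K" "K \<subseteq> \<Omega>" "x \<in> K" "length is \<le> j"
  shows "cmod (pderivs is f x) \<le> ck_norm K j f"
proof -
  have "cmod (pderivs is f x) = cmod (mderivative (count_list is) f x)"
    using pderivs_eq_mderivative[OF assms(1,2)] assms(4,5) by auto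
  also have "\<dots> \<le> sup_on K (mderivative (count_list is) f)"
    by (rule le_sup_on[OF assms(3) _ assms(5)])
      (use smooth_on_continuous[OF smooth_on_mderivative[OF assms(2)]] assms(4) continuous_on_subset in blast)
  also have "\<dots> \<le> ck_norm K j f"
    using assms(6) by (intro sup_on_le_ck_norm) (simp add: morder_count_list)
  finally show ?thesis .
qed

lemma ck_norm_nonneg:
  assumes "open \<Omega>" "smooth_on \<Omega> f" "compact K" "K \<subseteq> \<Omega>"
  shows "0 \<le> ck_norm K j f"
proof -
  have "morder (\<lambda>_. 0) \<le> j" by (simp add: morder_def)
  have "continuous_on K (mderivative (\<lambda>_. 0) f)"
    using smooth_on_continuous[OF smooth_on_mderivative[OF assms(2)]] assms(4) continuous_on_subset by blast
  then show ?thesis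
    using sup_on_nonneg[OF assms(3)] sup_on_le_ck_norm[OF \<open>morder (\<lambda>_. 0) \<le> j\<close>] order_trans by blast
qed

lemma ck_norm_mult_le:
  fixes f :: "real^'n::finite \<Rightarrow> complex"
  assumes \<Omega>: "open \<Omega>" and f: "smooth_on \<Omega> f" and g: "smooth_on \<Omega> g" and K: "compact K" "K \<subseteq> \<Omega>"
  shows "ck_norm K j (\<lambda>x. f x * g x) \<le> 2 ^ j * (ck_norm K j f * ck_norm K j g)"
proof (rule ck_norm_le)
  note nn = ck_norm_nonneg[OF \<Omega> f K] ck_norm_nonneg[OF \<Omega> g K]
  show "0 \<le> 2 ^ j * (ck_norm K j f * ck_norm K j g)" using nn by simp
  fix "is" :: "'n list" and x assume "length is \<le> j" "x \<in> K"
  then have "cmod (pderivs is (\<lambda>x. f x * g x) x) \<le> 2 ^ length is * (ck_norm K j f * ck_norm K j g)"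
    using K by (intro pderivs_mult_bound[OF \<Omega> f g] le_ck_norm[OF \<Omega> f K] le_ck_norm[OF \<Omega> g K]) auto
  also have "\<dots> \<le> 2 ^ j * (ck_norm K j f * ck_norm K j g)"
    using \<open>length is \<le> j\<close> nn by (intro mult_right_mono power_increasing) auto
  finally show "cmod (pderivs is (\<lambda>x. f x * g x) x) \<le> 2 ^ j * (ck_norm K j f * ck_norm K j g)" .
qed

section \<open>Smooth cutoff functions\<close>

text \<open>The functions \<open>p (1/t) exp (- 1/t)\<close>, extended by \<open>0\<close> to \<open>t \<le> 0\<close>. With the polynomial
  factor the family is closed under derivatives: the derivative replaces \<open>p\<close> by \<open>X\<^sup>2 (p - p')\<close>.\<close>

definition flat_exp :: "real poly \<Rightarrow> real \<Rightarrow> real" where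
  "flat_exp p t = (if t > 0 then poly p (1 / t) * exp (- (1 / t)) else 0)"

lemma poly_div_exp_tendsto_0: "((\<lambda>s. poly p s * exp (- s)) \<longlongrightarrow> (0::real)) at_top"
proof -
  have "((\<lambda>s. \<Sum>i\<le>degree p. coeff p i * (s ^ i / exp s)) \<longlongrightarrow> (\<Sum>i\<le>degree p. coeff p i * 0)) at_top"
    by (intro tendsto_intros tendsto_power_div_exp_0)
  moreover have "(\<Sum>i\<le>degree p. coeff p i * (s ^ i / exp s)) = poly p s * exp (- s)" for s
    by (simp add: poly_altdef sum_distrib_left exp_minus divide_inverse mult_ac)
  ultimately show ?thesis by simp
qed

lemma flat_exp_derivative:
  "(flat_exp p has_real_derivative flat_exp ([:0, 0, 1:] * (p - pderiv p)) t) (at t)"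
proof -
  consider "t > 0" | "t < 0" | "t = 0" by linarith
  then show ?thesis
  proof cases
    case 1
    have "((\<lambda>t. poly p (1 / t) * exp (- (1 / t))) has_real_derivative
       flat_exp ([:0, 0, 1:] * (p - pderiv p)) t) (at t)"
      using 1 by (auto intro!: derivative_eq_intros simp: flat_exp_def field_simps power2_eq_square)
    moreover have "\<forall>\<^sub>F x in nhds t. poly p (1 / x) * exp (- (1 / x)) = flat_exp p x"
      using eventually_nhds_in_open[of "{0<..}" t] 1
      by (auto simp: flat_exp_def elim: eventually_mono)
    ultimately show ?thesis by (rule DERIV_cong_ev[OF refl _ refl, THEN iffD1, rotated])
  next
    case 2
    have "((\<lambda>t. 0) has_real_derivative flat_exp ([:0, 0, 1:] * (p - pderiv p)) t) (at t)"
      using 2 by (simp add: flat_exp_def)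
    moreover have "\<forall>\<^sub>F x in nhds t. 0 = flat_exp p x"
      using eventually_nhds_in_open[of "{..<0}" t] 2
      by (auto simp: flat_exp_def elim: eventually_mono)
    ultimately show ?thesis by (rule DERIV_cong_ev[OF refl _ refl, THEN iffD1, rotated])
  next
    case 3
    have "((\<lambda>h. poly ([:0, 1:] * p) (inverse h) * exp (- inverse h)) \<longlongrightarrow> 0) (at_right (0::real))"
      by (rule filterlim_compose[OF poly_div_exp_tendsto_0 filterlim_inverse_at_top_right])
    moreover have "\<forall>\<^sub>F h in at_right (0::real). poly ([:0, 1:] * p) (inverse h) * exp (- inverse h) = flat_exp p h / h"
      using eventually_at_right_less by eventually_elim (simp add: flat_exp_def field_simps)
    ultimately have r: "((\<lambda>h. flat_exp p h / h) \<longlongrightarrow> 0) (at_right 0)"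
      by (blast intro: Lim_transform_eventually)
    have "\<forall>\<^sub>F h in at_left (0::real). 0 = flat_exp p h / h"
      unfolding eventually_at_left_field by (intro exI[of _ "-1"]) (auto simp: flat_exp_def)
    then have l: "((\<lambda>h. flat_exp p h / h) \<longlongrightarrow> 0) (at_left 0)"
      by (rule Lim_transform_eventually[OF tendsto_const])
    have "((\<lambda>h. flat_exp p h / h) \<longlongrightarrow> 0) (at 0)"
      using l r by (rule filterlim_split_at)
    then show ?thesis
      unfolding 3 DERIV_def by (simp add: flat_exp_def)
  qed
qed

lemma smooth_on_flat_exp:
  assumes "open \<Omega>" "smooth_on \<Omega> (\<lambda>x. of_real (q x))"
  shows "smooth_on \<Omega> (\<lambda>x. of_real (flat_exp 1 (q x)))"
proof -
  define P where "P = (\<lambda>n. ((\<lambda>p :: real poly. [:0, 0, 1:] * (p - pderiv p)) ^^ n) 1)"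
  have "smooth_on \<Omega> (\<lambda>x. of_real ((\<lambda>n. flat_exp (P n)) 0 (q x)))"
    by (rule smooth_on_compose_real[OF assms]) (use flat_exp_derivative in \<open>simp add: P_def\<close>)
  then show ?thesis by (simp add: P_def)
qed

lemma smooth_on_inverse:
  assumes "open \<Omega>" "smooth_on \<Omega> (\<lambda>x. of_real (q x))" "\<And>x. x \<in> \<Omega> \<Longrightarrow> q x \<noteq> 0"
  shows "smooth_on \<Omega> (\<lambda>x. of_real (inverse (q x)))"
proof -
  define H where "H = (\<lambda>n t :: real. (-1) ^ n * fact n * inverse t ^ Suc n)"
  have "smooth_on \<Omega> (\<lambda>x. of_real (H 0 (q x)))"
  proof (rule smooth_on_compose_real[OF assms(1,2)])
    fix n x assume x: "x \<in> \<Omega>"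
    have "((\<lambda>t. (-1) ^ n * fact n * inverse t ^ Suc n) has_real_derivative
      (-1) ^ n * fact n * (real (Suc n) * inverse (q x) ^ n * - (inverse (q x) * inverse (q x)))) (at (q x))"
      using assms(3)[OF x]
      by (intro derivative_eq_intros refl) (auto simp: power2_eq_square)
    moreover have "(-1) ^ n * fact n * (real (Suc n) * inverse (q x) ^ n * - (inverse (q x) * inverse (q x)))
        = H (Suc n) (q x)"
      by (simp add: H_def algebra_simps)
    ultimately show "(H n has_real_derivative H (Suc n) (q x)) (at (q x))"
      unfolding H_def by (rule DERIV_cong)
  qed
  then show ?thesis by (simp add: H_def)
qed

text \<open>The quotient \<open>A / (A + B)\<close>, where \<open>A\<close> and \<open>B\<close> are flat exponentials of
  \<open>(2r)\<^sup>2 - |x - a|\<^sup>2\<close> and \<open>|x - a|\<^sup>2 - r\<^sup>2\<close>; at every point at least one of the two arguments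
  is positive, so the denominator does not vanish.\<close>

lemma smooth_cutoff_ball:
  fixes a :: "real^'n::finite"
  assumes "r > 0"
  obtains \<psi> :: "real^'n \<Rightarrow> complex" where "smooth_on UNIV \<psi>" "\<And>x. dist a x \<le> r \<Longrightarrow> \<psi> x = 1"
    "\<And>x. 2 * r \<le> dist a x \<Longrightarrow> \<psi> x = 0"
proof -
  define q where "q = (\<lambda>x. (dist a x)\<^sup>2)"
  define A where "A = (\<lambda>x. flat_exp 1 ((2 * r)\<^sup>2 - q x))"
  define B where "B = (\<lambda>x. flat_exp 1 (q x - r\<^sup>2))"
  have q_eq: "complex_of_real (q x) = (\<Sum>i\<in>UNIV. (of_real (x $ i) - of_real (a $ i)) * (of_real (x $ i) - of_real (a $ i)))" for x
  proof -
    have "q x = (\<Sum>i\<in>UNIV. (x $ i - a $ i) * (x $ i - a $ i))"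
      unfolding q_def dist_commute[of a] by (simp add: dist_norm power2_norm_eq_inner inner_vec_def)
    then show ?thesis by simp
  qed
  have q: "smooth_on UNIV (\<lambda>x. complex_of_real (q x))"
    unfolding q_eq
    by (intro smooth_on_sum smooth_on_mult smooth_on_diff smooth_on_coordinate smooth_on_const open_UNIV)
  have A: "smooth_on UNIV (\<lambda>x. complex_of_real (A x))"
    unfolding A_def by (rule smooth_on_flat_exp)
      (use smooth_on_diff[OF open_UNIV smooth_on_const[OF open_UNIV, of "of_real ((2 * r)\<^sup>2)"] q] in simp_all)
  have B: "smooth_on UNIV (\<lambda>x. complex_of_real (B x))"
    unfolding B_def by (rule smooth_on_flat_exp)
      (use smooth_on_diff[OF open_UNIV q smooth_on_const[OF open_UNIV, of "of_real (r\<^sup>2)"]] in simp_all)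
  have nn: "0 \<le> A x" "0 \<le> B x" for x by (simp_all add: A_def B_def flat_exp_def)
  have A0: "A x = 0" if "2 * r \<le> dist a x" for x
  proof -
    have "(2 * r)\<^sup>2 \<le> q x" unfolding q_def by (rule power_mono) (use that assms in auto)
    then show ?thesis by (simp add: A_def flat_exp_def)
  qed
  have B0: "B x = 0" if "dist a x \<le> r" for x
  proof -
    have "q x \<le> r\<^sup>2" unfolding q_def by (rule power_mono) (use that assms in auto)
    then show ?thesis by (simp add: B_def flat_exp_def)
  qed
  have pos: "A x + B x > 0" for x
  proof (cases "dist a x < 2 * r")
    case True
    then have "q x < (2 * r)\<^sup>2" unfolding q_def by (intro power_strict_mono) auto
    then have "A x > 0" by (simp add: A_def flat_exp_def)
    then show ?thesis using nn(2)[of x] by linarith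
  next
    case False
    then have "r\<^sup>2 < q x" unfolding q_def using assms by (intro power_strict_mono) auto
    then have "B x > 0" by (simp add: B_def flat_exp_def)
    then show ?thesis using nn(1)[of x] by linarith
  qed
  have "smooth_on UNIV (\<lambda>x. complex_of_real (inverse (A x + B x)))"
    by (rule smooth_on_inverse) (use smooth_on_add[OF open_UNIV A B] pos in \<open>simp_all add: less_imp_neq[symmetric]\<close>)
  then have "smooth_on UNIV (\<lambda>x. complex_of_real (A x) * complex_of_real (inverse (A x + B x)))"
    by (rule smooth_on_mult[OF open_UNIV A])
  moreover have "complex_of_real (A x) * complex_of_real (inverse (A x + B x)) = 1" if "dist a x \<le> r" for x
    using B0[OF that] pos[of x] by simp
  moreover have "complex_of_real (A x) * complex_of_real (inverse (A x + B x)) = 0" if "2 * r \<le> dist a x" for x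
    using A0[OF that] by simp
  ultimately show ?thesis by (rule that)
qed

text \<open>Cover \<open>K\<close> by finitely many balls and combine their cutoffs \<open>\<psi>\<^sub>a\<close> to \<open>1 - \<Prod> (1 - \<psi>\<^sub>a)\<close>,
  which is \<open>1\<close> where some \<open>\<psi>\<^sub>a\<close> is \<open>1\<close> and \<open>0\<close> where all of them vanish.\<close>

lemma smooth_cutoff:
  fixes K :: "(real^'n::finite) set"
  assumes "compact K" "open \<Omega>" "K \<subseteq> \<Omega>"
  obtains \<theta> V L where "smooth_on UNIV \<theta>" "open V" "K \<subseteq> V" "\<And>x. x \<in> V \<Longrightarrow> \<theta> x = 1"
    "compact L" "V \<subseteq> L" "L \<subseteq> \<Omega>" "\<And>x. x \<notin> L \<Longrightarrow> \<theta> x = 0"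
proof -
  have "\<exists>r. 0 < r \<and> cball a (2 * r) \<subseteq> \<Omega>" if a: "a \<in> K" for a
  proof -
    obtain e where "e > 0" "cball a e \<subseteq> \<Omega>"
      using open_contains_cball_eq[OF assms(2), rule_format, of a] assms(3) a by auto
    then show ?thesis by (intro exI[of _ "e / 2"]) auto
  qed
  then obtain \<rho> where \<rho>: "\<And>a. a \<in> K \<Longrightarrow> 0 < \<rho> a" "\<And>a. a \<in> K \<Longrightarrow> cball a (2 * \<rho> a) \<subseteq> \<Omega>" by metis
  have cover: "K \<subseteq> (\<Union>a\<in>K. ball a (\<rho> a))" using \<rho>(1) by fastforce
  obtain F where F: "F \<subseteq> K" "finite F" "K \<subseteq> (\<Union>a\<in>F. ball a (\<rho> a))"
    by (rule compactE_image[OF assms(1) _ cover]) auto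
  have "\<exists>\<psi> :: real^'n \<Rightarrow> complex. smooth_on UNIV \<psi> \<and> (\<forall>x. dist a x \<le> \<rho> a \<longrightarrow> \<psi> x = 1) \<and>
      (\<forall>x. 2 * \<rho> a \<le> dist a x \<longrightarrow> \<psi> x = 0)" if "a \<in> K" for a
    using smooth_cutoff_ball[OF \<rho>(1)[OF that], of a] by metis
  then obtain \<psi> :: "real^'n \<Rightarrow> real^'n \<Rightarrow> complex" where
    \<psi>: "\<And>a. a \<in> K \<Longrightarrow> smooth_on UNIV (\<psi> a)" "\<And>a x. a \<in> K \<Longrightarrow> dist a x \<le> \<rho> a \<Longrightarrow> \<psi> a x = 1"
       "\<And>a x. a \<in> K \<Longrightarrow> 2 * \<rho> a \<le> dist a x \<Longrightarrow> \<psi> a x = 0" by metis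
  show ?thesis
  proof (rule that)
    show "smooth_on UNIV (\<lambda>x. 1 - (\<Prod>a\<in>F. 1 - \<psi> a x))"
      using F(1) \<psi>(1)
      by (intro smooth_on_diff smooth_on_prod smooth_on_const open_UNIV) auto
    show "open (\<Union>a\<in>F. ball a (\<rho> a))" by auto
    show "K \<subseteq> (\<Union>a\<in>F. ball a (\<rho> a))" by (rule F)
    show "compact (\<Union>a\<in>F. cball a (2 * \<rho> a))" using F(2) by (intro compact_UN) auto
    show "(\<Union>a\<in>F. ball a (\<rho> a)) \<subseteq> (\<Union>a\<in>F. cball a (2 * \<rho> a))"
    proof (rule UN_mono[OF subset_refl])
      fix a assume "a \<in> F"
      then have "0 < \<rho> a" using F(1) \<rho>(1) by blast
      then show "ball a (\<rho> a) \<subseteq> cball a (2 * \<rho> a)" by auto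
    qed
    show "(\<Union>a\<in>F. cball a (2 * \<rho> a)) \<subseteq> \<Omega>" using F(1) \<rho>(2) by blast
    show "1 - (\<Prod>a\<in>F. 1 - \<psi> a x) = 1" if x: "x \<in> (\<Union>a\<in>F. ball a (\<rho> a))" for x
    proof -
      obtain a where "a \<in> F" "dist a x < \<rho> a" using x by auto
      then have "1 - \<psi> a x = 0" using \<psi>(2)[of a x] F(1) by auto
      then show ?thesis using F(2) \<open>a \<in> F\<close> by (metis diff_zero prod_zero)
    qed
    show "1 - (\<Prod>a\<in>F. 1 - \<psi> a x) = 0" if x: "x \<notin> (\<Union>a\<in>F. cball a (2 * \<rho> a))" for x
    proof -
      have "\<psi> a x = 0" if "a \<in> F" for a
        using \<psi>(3)[of a x] F(1) x that by (auto simp: not_le less_imp_le)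
      then show ?thesis by simp
    qed
  qed
qed

section \<open>Moderate and negligible nets\<close>

lemma eventually_eps_le: "0 < \<eta> \<Longrightarrow> \<forall>\<^sub>F \<epsilon> in at_right (0::real). \<epsilon> \<in> {0<..\<eta>}"
  using eventually_at_right_real[of 0 \<eta>] by (auto elim: eventually_mono)

lemmas eventually_eps = eventually_eps_le[of 1, OF zero_less_one]

text \<open>An arbitrarily small loss in the exponent absorbs every constant factor. Therefore
  estimates of nets can be stated below with constant \<open>1\<close>, and constants are paid for by
  lowering the exponent by \<open>1\<close>.\<close>

lemma eventually_mult_powr_le:
  assumes "b < (a::real)"
  shows "\<forall>\<^sub>F \<epsilon> in at_right 0. c * \<epsilon> powr a \<le> \<epsilon> powr b"
proof -
  have "((\<lambda>\<epsilon>::real. c * \<epsilon> powr (a - b)) \<longlongrightarrow> c * 0 powr (a - b)) (at_right 0)"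
    using assms by (intro tendsto_intros tendsto_powr2) (auto simp: eventually_at_filter)
  then have "((\<lambda>\<epsilon>::real. c * \<epsilon> powr (a - b)) \<longlongrightarrow> 0) (at_right 0)" by simp
  then have "\<forall>\<^sub>F \<epsilon> in at_right 0. c * \<epsilon> powr (a - b) < 1"
    by (rule order_tendstoD) simp
  with eventually_eps show ?thesis
  proof eventually_elim
    case (elim \<epsilon>)
    have "c * \<epsilon> powr a = c * \<epsilon> powr (a - b) * \<epsilon> powr b"
      using elim by (simp flip: powr_add)
    also have "\<dots> \<le> 1 * \<epsilon> powr b" using elim by (intro mult_right_mono) auto
    finally show ?case by simp
  qed
qed

lemma powr_le_powr_eps: "\<epsilon> \<in> {0<..1} \<Longrightarrow> a \<le> b \<Longrightarrow> \<epsilon> powr b \<le> \<epsilon> powr (a::real)"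
  by (intro powr_mono') auto

lemma big_O_epsI: "\<forall>\<^sub>F \<epsilon> in at_right 0. \<bar>r \<epsilon>\<bar> \<le> c * \<epsilon> powr b \<Longrightarrow> big_O_eps r b"
  by (rule bigoI[where c = c]) auto

lemma big_O_epsD:
  assumes "big_O_eps r b" "b' < b"
  shows "\<forall>\<^sub>F \<epsilon> in at_right 0. \<bar>r \<epsilon>\<bar> \<le> \<epsilon> powr b'"
proof -
  obtain c where "\<forall>\<^sub>F \<epsilon> in at_right 0. norm (r \<epsilon>) \<le> c * norm (\<epsilon> powr b)"
    using assms(1) by (auto elim: landau_o.bigE)
  with eventually_mult_powr_le[OF assms(2), of c] show ?thesis
    by eventually_elim auto
qed

lemma moderate_iff: "moderate r \<longleftrightarrow> (\<exists>N::nat. \<forall>\<^sub>F \<epsilon> in at_right 0. \<bar>r \<epsilon>\<bar> \<le> \<epsilon> powr - real N)"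
proof
  assume "moderate r"
  then obtain N :: nat where "big_O_eps r (- real N)" unfolding moderate_def by blast
  then have "\<forall>\<^sub>F \<epsilon> in at_right 0. \<bar>r \<epsilon>\<bar> \<le> \<epsilon> powr - real (Suc N)" by (rule big_O_epsD) simp
  then show "\<exists>N::nat. \<forall>\<^sub>F \<epsilon> in at_right 0. \<bar>r \<epsilon>\<bar> \<le> \<epsilon> powr - real N" by blast
next
  assume "\<exists>N::nat. \<forall>\<^sub>F \<epsilon> in at_right 0. \<bar>r \<epsilon>\<bar> \<le> \<epsilon> powr - real N"
  then show "moderate r" unfolding moderate_def using big_O_epsI[of r 1] by auto
qed

lemma negligible_iff: "negligible_net r \<longleftrightarrow> (\<forall>q::nat. \<forall>\<^sub>F \<epsilon> in at_right 0. \<bar>r \<epsilon>\<bar> \<le> \<epsilon> powr real q)"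
proof
  assume r: "negligible_net r"
  show "\<forall>q::nat. \<forall>\<^sub>F \<epsilon> in at_right 0. \<bar>r \<epsilon>\<bar> \<le> \<epsilon> powr real q"
  proof
    fix q :: nat
    have "big_O_eps r (real (Suc q))" using r unfolding negligible_net_def by blast
    then show "\<forall>\<^sub>F \<epsilon> in at_right 0. \<bar>r \<epsilon>\<bar> \<le> \<epsilon> powr real q" by (rule big_O_epsD) simp
  qed
next
  assume "\<forall>q::nat. \<forall>\<^sub>F \<epsilon> in at_right 0. \<bar>r \<epsilon>\<bar> \<le> \<epsilon> powr real q"
  then show "negligible_net r" unfolding negligible_net_def using big_O_epsI[of r 1] by auto
qed

lemma moderate_eventually_le:
  assumes "moderate s" "\<forall>\<^sub>F \<epsilon> in at_right 0. \<bar>r \<epsilon>\<bar> \<le> \<bar>s \<epsilon>\<bar>"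
  shows "moderate r"
proof -
  obtain N :: nat where "\<forall>\<^sub>F \<epsilon> in at_right 0. \<bar>s \<epsilon>\<bar> \<le> \<epsilon> powr - real N"
    using assms(1) unfolding moderate_iff by blast
  with assms(2) have "\<forall>\<^sub>F \<epsilon> in at_right 0. \<bar>r \<epsilon>\<bar> \<le> \<epsilon> powr - real N" by eventually_elim simp
  then show ?thesis unfolding moderate_iff by blast
qed

lemma negligible_eventually_le:
  assumes "negligible_net s" "\<forall>\<^sub>F \<epsilon> in at_right 0. \<bar>r \<epsilon>\<bar> \<le> \<bar>s \<epsilon>\<bar>"
  shows "negligible_net r"
  unfolding negligible_iff
proof
  fix q :: nat
  have "\<forall>\<^sub>F \<epsilon> in at_right 0. \<bar>s \<epsilon>\<bar> \<le> \<epsilon> powr real q"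
    using assms(1) unfolding negligible_iff by blast
  with assms(2) show "\<forall>\<^sub>F \<epsilon> in at_right 0. \<bar>r \<epsilon>\<bar> \<le> \<epsilon> powr real q" by eventually_elim simp
qed

lemma negligible_eventually_zero: "\<forall>\<^sub>F \<epsilon> in at_right 0. r \<epsilon> = 0 \<Longrightarrow> negligible_net r"
  by (rule negligible_eventually_le[OF negligible_zero]) (auto elim: eventually_mono)

text \<open>A bound with one exponent for one iterated derivative on one compact set. Moderate and
  negligible nets differ only in the quantification over the exponent.\<close>

definition net_bound :: "'n::finite net \<Rightarrow> (real^'n) set \<Rightarrow> 'n list \<Rightarrow> real \<Rightarrow> bool" where
  "net_bound u K is b \<longleftrightarrow> (\<forall>\<^sub>F \<epsilon> in at_right 0. \<forall>x\<in>K. cmod (pderivs is (u \<epsilon>) x) \<le> \<epsilon> powr b)"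

definition smooth_net :: "(real^'n::finite) set \<Rightarrow> 'n net \<Rightarrow> bool" where
  "smooth_net \<Omega> u \<longleftrightarrow> (\<forall>\<epsilon>\<in>{0<..1}. smooth_on \<Omega> (u \<epsilon>))"

lemma net_bound_mono:
  assumes "net_bound u K is b" "b' \<le> b"
  shows "net_bound u K is b'"
  using assms(1) eventually_eps unfolding net_bound_def
proof eventually_elim
  case (elim \<epsilon>)
  then show ?case using powr_le_powr_eps[OF elim(2) assms(2)] by (auto intro: order_trans)
qed

lemma net_bound_mindex:
  assumes \<Omega>: "open \<Omega>" and u: "smooth_net \<Omega> u" and K: "K \<subseteq> \<Omega>"
  shows "net_bound u K is b \<longleftrightarrow> net_bound u K (mindex_list (count_list is)) b"
proof -
  have "\<forall>\<^sub>F \<epsilon> in at_right 0. (\<forall>x\<in>K. cmod (pderivs is (u \<epsilon>) x) \<le> \<epsilon> powr b) \<longleftrightarrow>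
     (\<forall>x\<in>K. cmod (pderivs (mindex_list (count_list is)) (u \<epsilon>) x) \<le> \<epsilon> powr b)"
    using eventually_eps
  proof eventually_elim
    case (elim \<epsilon>)
    then have s: "smooth_on \<Omega> (u \<epsilon>)" using u unfolding smooth_net_def by blast
    have "pderivs is (u \<epsilon>) x = pderivs (mindex_list (count_list is)) (u \<epsilon>) x" if "x \<in> K" for x
      using pderivs_eq_mderivative[OF \<Omega> s] K that by (auto simp: mderivative_eq_pderivs)
    then show ?case by auto
  qed
  then show ?thesis unfolding net_bound_def by (rule eventually_subst)
qed

lemma sup_on_net_bound:
  assumes \<Omega>: "open \<Omega>" and u: "smooth_net \<Omega> u" and K: "compact K" "K \<subseteq> \<Omega>"
  shows "(\<forall>\<^sub>F \<epsilon> in at_right 0. \<bar>sup_on K (mderivative \<alpha> (u \<epsilon>))\<bar> \<le> \<epsilon> powr b)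
    \<longleftrightarrow> net_bound u K (mindex_list \<alpha>) b"
proof -
  have "\<forall>\<^sub>F \<epsilon> in at_right 0. (\<bar>sup_on K (mderivative \<alpha> (u \<epsilon>))\<bar> \<le> \<epsilon> powr b) \<longleftrightarrow>
     (\<forall>x\<in>K. cmod (mderivative \<alpha> (u \<epsilon>) x) \<le> \<epsilon> powr b)"
    using eventually_eps
  proof eventually_elim
    case (elim \<epsilon>)
    then have s: "smooth_on \<Omega> (u \<epsilon>)" using u unfolding smooth_net_def by blast
    have c: "continuous_on K (mderivative \<alpha> (u \<epsilon>))"
      using continuous_on_subset[OF smooth_on_continuous[OF smooth_on_mderivative[OF s]] K(2)] .
    show ?case
      using sup_on_nonneg[OF K(1) c] le_sup_on[OF K(1) c] sup_on_le[of "\<epsilon> powr b" K "mderivative \<alpha> (u \<epsilon>)"]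
      by (auto intro: order_trans)
  qed
  then show ?thesis
    unfolding net_bound_def mderivative_eq_pderivs by (rule eventually_subst)
qed

lemma moderate_nets_iff:
  assumes \<Omega>: "open \<Omega>"
  shows "u \<in> moderate_nets \<Omega> \<longleftrightarrow> smooth_net \<Omega> u \<and>
    (\<forall>K. compact K \<longrightarrow> K \<subseteq> \<Omega> \<longrightarrow> (\<forall>is. \<exists>N::nat. net_bound u K is (- real N)))"
proof (cases "smooth_net \<Omega> u")
  case True
  have "(\<forall>\<alpha>. moderate (\<lambda>\<epsilon>. sup_on K (mderivative \<alpha> (u \<epsilon>)))) \<longleftrightarrow>
      (\<forall>is. \<exists>N::nat. net_bound u K is (- real N))" if K: "compact K" "K \<subseteq> \<Omega>" for K
    unfolding moderate_iff sup_on_net_bound[OF \<Omega> True K]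
    using net_bound_mindex[OF \<Omega> True K(2)] by metis
  then show ?thesis using True unfolding moderate_nets_def smooth_net_def by auto
next
  case False
  then show ?thesis unfolding moderate_nets_def smooth_net_def by auto
qed

lemma negligible_nets_iff:
  assumes \<Omega>: "open \<Omega>"
  shows "u \<in> negligible_nets \<Omega> \<longleftrightarrow> smooth_net \<Omega> u \<and>
    (\<forall>K. compact K \<longrightarrow> K \<subseteq> \<Omega> \<longrightarrow> (\<forall>is. \<forall>q::nat. net_bound u K is (real q)))"
proof (cases "smooth_net \<Omega> u")
  case True
  have "(\<forall>\<alpha>. negligible_net (\<lambda>\<epsilon>. sup_on K (mderivative \<alpha> (u \<epsilon>)))) \<longleftrightarrow>
      (\<forall>is. \<forall>q::nat. net_bound u K is (real q))" if K: "compact K" "K \<subseteq> \<Omega>" for K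
    unfolding negligible_iff sup_on_net_bound[OF \<Omega> True K]
    using net_bound_mindex[OF \<Omega> True K(2)] by metis
  then show ?thesis using True unfolding negligible_nets_def smooth_net_def by auto
next
  case False
  then show ?thesis unfolding negligible_nets_def smooth_net_def by auto
qed

lemma net_bound_add:
  assumes "open \<Omega>" "smooth_net \<Omega> u" "smooth_net \<Omega> v" "K \<subseteq> \<Omega>"
    and "net_bound u K is b" "net_bound v K is b"
  shows "net_bound (\<lambda>\<epsilon> x. u \<epsilon> x + v \<epsilon> x) K is (b - 1)"
proof -
  have "\<forall>\<^sub>F \<epsilon> in at_right 0. 2 * \<epsilon> powr b \<le> \<epsilon> powr (b - 1)" by (rule eventually_mult_powr_le) simp
  then show ?thesis
    using assms(5,6) eventually_eps unfolding net_bound_def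
  proof eventually_elim
    case (elim \<epsilon>)
    then have s: "smooth_on \<Omega> (u \<epsilon>)" "smooth_on \<Omega> (v \<epsilon>)"
      using assms(2,3) unfolding smooth_net_def by blast+
    show ?case
    proof
      fix x assume x: "x \<in> K"
      then have "pderivs is (\<lambda>x. u \<epsilon> x + v \<epsilon> x) x = pderivs is (u \<epsilon>) x + pderivs is (v \<epsilon>) x"
        using assms(4) by (intro pderivs_add[OF assms(1) s]) auto
      moreover have "cmod (pderivs is (u \<epsilon>) x) \<le> \<epsilon> powr b" "cmod (pderivs is (v \<epsilon>) x) \<le> \<epsilon> powr b"
        using elim x by auto
      ultimately have "cmod (pderivs is (\<lambda>x. u \<epsilon> x + v \<epsilon> x) x) \<le> \<epsilon> powr b + \<epsilon> powr b"
        by (simp add: norm_triangle_le)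
      then show "cmod (pderivs is (\<lambda>x. u \<epsilon> x + v \<epsilon> x) x) \<le> \<epsilon> powr (b - 1)" using elim by linarith
    qed
  qed
qed

lemma net_bound_scale:
  assumes "open \<Omega>" "smooth_net \<Omega> u" "K \<subseteq> \<Omega>" "net_bound u K is b"
    and "\<forall>\<^sub>F \<epsilon> in at_right 0. cmod (c \<epsilon>) \<le> \<epsilon> powr a"
  shows "net_bound (\<lambda>\<epsilon> x. c \<epsilon> * u \<epsilon> x) K is (a + b)"
  using assms(4,5) eventually_eps unfolding net_bound_def
proof eventually_elim
  case (elim \<epsilon>)
  then have s: "smooth_on \<Omega> (u \<epsilon>)" using assms(2) unfolding smooth_net_def by blast
  show ?case
  proof
    fix x assume x: "x \<in> K"
    then have "pderivs is (\<lambda>x. c \<epsilon> * u \<epsilon> x) x = c \<epsilon> * pderivs is (u \<epsilon>) x"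
      using assms(3) by (intro pderivs_cmult[OF assms(1) s]) auto
    then show "cmod (pderivs is (\<lambda>x. c \<epsilon> * u \<epsilon> x) x) \<le> \<epsilon> powr (a + b)"
      using elim x by (simp add: norm_mult powr_add mult_mono)
  qed
qed

text \<open>The Leibniz rule; the binomial factor and the derivatives of the fixed function \<open>f\<close> are
  absorbed by the loss of \<open>1\<close> in the exponent.\<close>

lemma net_bound_mult_smooth:
  assumes \<Omega>: "open \<Omega>" and u: "smooth_net \<Omega> u" and K: "compact K" "K \<subseteq> \<Omega>" and f: "smooth_on \<Omega> f"
    and b: "\<And>js. length js \<le> length is \<Longrightarrow> net_bound u K js b"
  shows "net_bound (\<lambda>\<epsilon> x. f x * u \<epsilon> x) K is (b - 1)"
proof -
  let ?J = "{js :: 'a list. set js \<subseteq> UNIV \<and> length js \<le> length is}"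
  have "\<forall>\<^sub>F \<epsilon> in at_right 0. \<forall>js\<in>?J. \<forall>x\<in>K. cmod (pderivs js (u \<epsilon>) x) \<le> \<epsilon> powr b"
    using b unfolding net_bound_def by (intro eventually_ball_finite finite_lists_length_le) auto
  moreover have "\<forall>\<^sub>F \<epsilon> in at_right 0.
     (2 ^ length is * ck_norm K (length is) f) * \<epsilon> powr b \<le> \<epsilon> powr (b - 1)"
    by (rule eventually_mult_powr_le) simp
  ultimately show ?thesis
    using eventually_eps unfolding net_bound_def
  proof eventually_elim
    case (elim \<epsilon>)
    then have s: "smooth_on \<Omega> (u \<epsilon>)" using u unfolding smooth_net_def by blast
    show ?case
    proof
      fix x assume x: "x \<in> K"
      then have "cmod (pderivs is (\<lambda>x. f x * u \<epsilon> x) x) \<le> 2 ^ length is * (ck_norm K (length is) f * \<epsilon> powr b)"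
        using elim K by (intro pderivs_mult_bound[OF \<Omega> f s] le_ck_norm[OF \<Omega> f K]) auto
      then show "cmod (pderivs is (\<lambda>x. f x * u \<epsilon> x) x) \<le> \<epsilon> powr (b - 1)"
        using elim by (simp add: mult.assoc)
    qed
  qed
qed

lemma moderate_nets_uniform:
  assumes "open \<Omega>" "u \<in> moderate_nets \<Omega>" "compact K" "K \<subseteq> \<Omega>"
  shows "\<exists>N::nat. \<forall>is. length is \<le> l \<longrightarrow> net_bound u K is (- real N)"
proof -
  let ?J = "{js :: 'a list. set js \<subseteq> UNIV \<and> length js \<le> l}"
  have "\<forall>is. \<exists>N::nat. net_bound u K is (- real N)"
    using assms by (simp add: moderate_nets_iff)
  then obtain N :: "'a list \<Rightarrow> nat" where N: "\<And>is. net_bound u K is (- real (N is))" by metis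
  have fin: "finite (N ` ?J)" by (intro finite_imageI finite_lists_length_le) auto
  have "net_bound u K is (- real (Max (N ` ?J)))" if "length is \<le> l" for "is"
  proof (rule net_bound_mono[OF N[of "is"]])
    have "N is \<le> Max (N ` ?J)" using that by (intro Max_ge[OF fin] imageI) simp
    then show "- real (Max (N ` ?J)) \<le> - real (N is)" by simp
  qed
  then show ?thesis by blast
qed

lemma smooth_net_add: "open \<Omega> \<Longrightarrow> smooth_net \<Omega> u \<Longrightarrow> smooth_net \<Omega> v \<Longrightarrow> smooth_net \<Omega> (\<lambda>\<epsilon> x. u \<epsilon> x + v \<epsilon> x)"
  unfolding smooth_net_def by (simp add: smooth_on_add)

lemma smooth_net_scale: "open \<Omega> \<Longrightarrow> smooth_net \<Omega> u \<Longrightarrow> smooth_net \<Omega> (\<lambda>\<epsilon> x. c \<epsilon> * u \<epsilon> x)"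
  unfolding smooth_net_def by (simp add: smooth_on_cmult)

lemma smooth_net_mult: "open \<Omega> \<Longrightarrow> smooth_on \<Omega> f \<Longrightarrow> smooth_net \<Omega> u \<Longrightarrow> smooth_net \<Omega> (\<lambda>\<epsilon> x. f x * u \<epsilon> x)"
  unfolding smooth_net_def by (simp add: smooth_on_mult)

lemma smooth_net_pderivs: "smooth_net \<Omega> u \<Longrightarrow> smooth_net \<Omega> (\<lambda>\<epsilon>. pderivs is (u \<epsilon>))"
  unfolding smooth_net_def by (simp add: smooth_on_pderivs)

lemma moderate_nets_smooth: "u \<in> moderate_nets \<Omega> \<Longrightarrow> smooth_net \<Omega> u"
  by (simp add: moderate_nets_def smooth_net_def)

lemma negligible_nets_smooth: "u \<in> negligible_nets \<Omega> \<Longrightarrow> smooth_net \<Omega> u"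
  by (simp add: negligible_nets_def smooth_net_def)

lemma moderate_nets_add:
  assumes \<Omega>: "open \<Omega>" and u: "u \<in> moderate_nets \<Omega>" and v: "v \<in> moderate_nets \<Omega>"
  shows "(\<lambda>\<epsilon> x. u \<epsilon> x + v \<epsilon> x) \<in> moderate_nets \<Omega>"
  unfolding moderate_nets_iff[OF \<Omega>]
proof (intro conjI allI impI)
  note s = moderate_nets_smooth[OF u] moderate_nets_smooth[OF v]
  show "smooth_net \<Omega> (\<lambda>\<epsilon> x. u \<epsilon> x + v \<epsilon> x)" by (rule smooth_net_add[OF \<Omega> s])
  fix K "is" assume K: "compact K" "K \<subseteq> \<Omega>"
  obtain N M :: nat where "net_bound u K is (- real N)" "net_bound v K is (- real M)"
    using u v K unfolding moderate_nets_iff[OF \<Omega>] by meson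
  then have "net_bound u K is (- real (N + M))" "net_bound v K is (- real (N + M))"
    by (auto elim: net_bound_mono)
  from net_bound_add[OF \<Omega> s K(2) this] have "net_bound (\<lambda>\<epsilon> x. u \<epsilon> x + v \<epsilon> x) K is (- real (Suc (N + M)))"
    by (rule net_bound_mono) simp
  then show "\<exists>N::nat. net_bound (\<lambda>\<epsilon> x. u \<epsilon> x + v \<epsilon> x) K is (- real N)" by metis
qed

lemma negligible_nets_add:
  assumes \<Omega>: "open \<Omega>" and u: "u \<in> negligible_nets \<Omega>" and v: "v \<in> negligible_nets \<Omega>"
  shows "(\<lambda>\<epsilon> x. u \<epsilon> x + v \<epsilon> x) \<in> negligible_nets \<Omega>"
  unfolding negligible_nets_iff[OF \<Omega>]
proof (intro conjI allI impI)
  note s = negligible_nets_smooth[OF u] negligible_nets_smooth[OF v]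
  show "smooth_net \<Omega> (\<lambda>\<epsilon> x. u \<epsilon> x + v \<epsilon> x)" by (rule smooth_net_add[OF \<Omega> s])
  fix K "is" and q :: nat assume K: "compact K" "K \<subseteq> \<Omega>"
  have "net_bound u K is (real (Suc q))" "net_bound v K is (real (Suc q))"
    using u v K unfolding negligible_nets_iff[OF \<Omega>] by meson+
  from net_bound_add[OF \<Omega> s K(2) this] show "net_bound (\<lambda>\<epsilon> x. u \<epsilon> x + v \<epsilon> x) K is (real q)"
    by simp
qed

lemma moderate_nets_scale:
  assumes \<Omega>: "open \<Omega>" and u: "u \<in> moderate_nets \<Omega>" and c: "moderate (\<lambda>\<epsilon>. cmod (c \<epsilon>))"
  shows "(\<lambda>\<epsilon> x. c \<epsilon> * u \<epsilon> x) \<in> moderate_nets \<Omega>"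
  unfolding moderate_nets_iff[OF \<Omega>]
proof (intro conjI allI impI)
  show "smooth_net \<Omega> (\<lambda>\<epsilon> x. c \<epsilon> * u \<epsilon> x)" by (rule smooth_net_scale[OF \<Omega> moderate_nets_smooth[OF u]])
  fix K "is" assume K: "compact K" "K \<subseteq> \<Omega>"
  obtain N M :: nat where "net_bound u K is (- real N)" "\<forall>\<^sub>F \<epsilon> in at_right 0. cmod (c \<epsilon>) \<le> \<epsilon> powr - real M"
    using u c K unfolding moderate_nets_iff[OF \<Omega>] moderate_iff abs_norm_cancel by meson
  from net_bound_scale[OF \<Omega> moderate_nets_smooth[OF u] K(2) this]
  have "net_bound (\<lambda>\<epsilon> x. c \<epsilon> * u \<epsilon> x) K is (- real (M + N))" by simp
  then show "\<exists>N::nat. net_bound (\<lambda>\<epsilon> x. c \<epsilon> * u \<epsilon> x) K is (- real N)" by metis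
qed

lemma negligible_nets_scale:
  assumes \<Omega>: "open \<Omega>" and u: "u \<in> negligible_nets \<Omega>" and c: "moderate (\<lambda>\<epsilon>. cmod (c \<epsilon>))"
  shows "(\<lambda>\<epsilon> x. c \<epsilon> * u \<epsilon> x) \<in> negligible_nets \<Omega>"
  unfolding negligible_nets_iff[OF \<Omega>]
proof (intro conjI allI impI)
  show "smooth_net \<Omega> (\<lambda>\<epsilon> x. c \<epsilon> * u \<epsilon> x)" by (rule smooth_net_scale[OF \<Omega> negligible_nets_smooth[OF u]])
  fix K "is" and q :: nat assume K: "compact K" "K \<subseteq> \<Omega>"
  obtain M :: nat where M: "\<forall>\<^sub>F \<epsilon> in at_right 0. cmod (c \<epsilon>) \<le> \<epsilon> powr - real M"
    using c unfolding moderate_iff abs_norm_cancel by meson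
  have "net_bound u K is (real (M + q))"
    using u K unfolding negligible_nets_iff[OF \<Omega>] by meson
  from net_bound_scale[OF \<Omega> negligible_nets_smooth[OF u] K(2) this M]
  show "net_bound (\<lambda>\<epsilon> x. c \<epsilon> * u \<epsilon> x) K is (real q)" by simp
qed

lemma moderate_nets_mult_smooth:
  assumes \<Omega>: "open \<Omega>" and u: "u \<in> moderate_nets \<Omega>" and f: "smooth_on \<Omega> f"
  shows "(\<lambda>\<epsilon> x. f x * u \<epsilon> x) \<in> moderate_nets \<Omega>"
  unfolding moderate_nets_iff[OF \<Omega>]
proof (intro conjI allI impI)
  note s = moderate_nets_smooth[OF u]
  show "smooth_net \<Omega> (\<lambda>\<epsilon> x. f x * u \<epsilon> x)" by (rule smooth_net_mult[OF \<Omega> f s])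
  fix K and "is" :: "'a list" assume K: "compact K" "K \<subseteq> \<Omega>"
  obtain N :: nat where N: "\<And>js. length js \<le> length is \<Longrightarrow> net_bound u K js (- real N)"
    using moderate_nets_uniform[OF \<Omega> u K, of "length is"] by blast
  have "net_bound (\<lambda>\<epsilon> x. f x * u \<epsilon> x) K is (- real N - 1)"
    by (rule net_bound_mult_smooth[OF \<Omega> s K f]) (rule N)
  moreover have "- real N - 1 = - real (Suc N)" by simp
  ultimately have "net_bound (\<lambda>\<epsilon> x. f x * u \<epsilon> x) K is (- real (Suc N))"
    by (rule subst[rotated])
  then show "\<exists>N::nat. net_bound (\<lambda>\<epsilon> x. f x * u \<epsilon> x) K is (- real N)" by metis
qed

lemma net_bound_pderivs: "net_bound (\<lambda>\<epsilon>. pderivs js (u \<epsilon>)) K is b \<longleftrightarrow> net_bound u K (is @ js) b"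
  by (simp add: net_bound_def)

lemma moderate_nets_pderivs:
  assumes "open \<Omega>" "u \<in> moderate_nets \<Omega>"
  shows "(\<lambda>\<epsilon>. pderivs is (u \<epsilon>)) \<in> moderate_nets \<Omega>"
  using assms smooth_net_pderivs[OF moderate_nets_smooth[OF assms(2)]]
  by (simp add: moderate_nets_iff net_bound_pderivs)

lemma negligible_nets_pderivs:
  assumes "open \<Omega>" "u \<in> negligible_nets \<Omega>"
  shows "(\<lambda>\<epsilon>. pderivs is (u \<epsilon>)) \<in> negligible_nets \<Omega>"
  using assms smooth_net_pderivs[OF negligible_nets_smooth[OF assms(2)]]
  by (simp add: negligible_nets_iff net_bound_pderivs)

lemma negligible_nets_cong:
  assumes "open \<Omega>" "u \<in> negligible_nets \<Omega>" "\<And>\<epsilon> x. \<epsilon> \<in> {0<..1} \<Longrightarrow> x \<in> \<Omega> \<Longrightarrow> v \<epsilon> x = u \<epsilon> x"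
  shows "v \<in> negligible_nets \<Omega>"
proof -
  have eq: "pderivs is (v \<epsilon>) x = pderivs is (u \<epsilon>) x" if "\<epsilon> \<in> {0<..1}" "x \<in> \<Omega>" for \<epsilon> x "is"
    using pderivs_cong[OF assms(1) that(2) assms(3)[OF that(1)]] .
  have "net_bound v K is b" if "net_bound u K is b" "K \<subseteq> \<Omega>" for K "is" b
    using that(1) eventually_eps unfolding net_bound_def
    by eventually_elim (use eq that(2) in auto)
  moreover have "smooth_net \<Omega> v"
    using negligible_nets_smooth[OF assms(2)] unfolding smooth_net_def
    by (auto intro!: smooth_on_cong[OF assms(1), of "v _" "u _"] assms(3))
  ultimately show ?thesis using assms(2) unfolding negligible_nets_iff[OF assms(1)] by meson
qed

lemma negligible_nets_zero: "open \<Omega> \<Longrightarrow> (\<lambda>\<epsilon> x. 0) \<in> negligible_nets \<Omega>"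
  unfolding negligible_nets_iff smooth_net_def net_bound_def
  by (simp add: smooth_on_const pderivs_zero)

lemma negligible_nets_uminus:
  assumes "open \<Omega>" "u \<in> negligible_nets \<Omega>"
  shows "(\<lambda>\<epsilon> x. - u \<epsilon> x) \<in> negligible_nets \<Omega>"
  using negligible_nets_scale[OF assms, of "\<lambda>_. -1"] moderate_const[of 1] by simp

lemma negligible_moderate_nets:
  assumes "open \<Omega>" "u \<in> negligible_nets \<Omega>"
  shows "u \<in> moderate_nets \<Omega>"
proof -
  have "net_bound u K is (- real 0)" if "compact K" "K \<subseteq> \<Omega>" for K "is"
  proof -
    have "\<forall>q::nat. net_bound u K is (real q)"
      using assms(2) that unfolding negligible_nets_iff[OF assms(1)] by meson
    from spec[OF this, of 0] show ?thesis by simp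
  qed
  then show ?thesis
    using negligible_nets_smooth[OF assms(2)] unfolding moderate_nets_iff[OF assms(1)] by metis
qed

section \<open>Classes of nets and their operations\<close>

definition net_equiv :: "(real^'n::finite) set \<Rightarrow> 'n net \<Rightarrow> 'n net \<Rightarrow> bool" where
  "net_equiv \<Omega> u v \<longleftrightarrow> (\<lambda>\<epsilon> x. u \<epsilon> x - v \<epsilon> x) \<in> negligible_nets \<Omega>"

lemma net_equiv_sym: "open \<Omega> \<Longrightarrow> net_equiv \<Omega> u v \<Longrightarrow> net_equiv \<Omega> v u"
  unfolding net_equiv_def by (drule (1) negligible_nets_uminus) simp

lemma net_equiv_trans: "open \<Omega> \<Longrightarrow> net_equiv \<Omega> u v \<Longrightarrow> net_equiv \<Omega> v w \<Longrightarrow> net_equiv \<Omega> u w"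
  unfolding net_equiv_def by (drule (2) negligible_nets_add) simp

lemma net_equiv_refl: "open \<Omega> \<Longrightarrow> net_equiv \<Omega> u u"
  unfolding net_equiv_def using negligible_nets_zero by simp

lemma gclass_altdef: "gclass \<Omega> u = {v \<in> moderate_nets \<Omega>. net_equiv \<Omega> v u}"
  by (simp add: gclass_def net_equiv_def)

lemma gclass_eqI: "open \<Omega> \<Longrightarrow> net_equiv \<Omega> u v \<Longrightarrow> gclass \<Omega> u = gclass \<Omega> v"
  unfolding gclass_altdef using net_equiv_trans net_equiv_sym by blast

lemma gclass_self: "open \<Omega> \<Longrightarrow> u \<in> moderate_nets \<Omega> \<Longrightarrow> u \<in> gclass \<Omega> u"
  by (simp add: gclass_altdef net_equiv_refl)

lemma gclass_eqD:
  "open \<Omega> \<Longrightarrow> u \<in> moderate_nets \<Omega> \<Longrightarrow> gclass \<Omega> u = gclass \<Omega> v \<Longrightarrow> net_equiv \<Omega> u v"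
  using gclass_self[of \<Omega> u] by (simp add: gclass_altdef)

lemma gclass_colombeau: "u \<in> moderate_nets \<Omega> \<Longrightarrow> gclass \<Omega> u \<in> colombeau \<Omega>"
  by (simp add: colombeau_def)

text \<open>Together with \<open>rep_equiv\<close> this makes the operations, which are defined through one chosen
  representative, computable from any representative (the rules \<open>gadd_rep\<close>, \<open>gdiff_rep\<close>,
  \<open>gscale_rep\<close> and \<open>gderiv_rep\<close>).\<close>

lemma colombeau_rep:
  assumes "open \<Omega>" "u \<in> colombeau \<Omega>" "w \<in> u"
  shows "w \<in> moderate_nets \<Omega>" "gclass \<Omega> w = u"
proof -
  obtain w0 where "w0 \<in> moderate_nets \<Omega>" "u = gclass \<Omega> w0"
    using assms(2) by (auto simp: colombeau_def)
  then show "w \<in> moderate_nets \<Omega>" "gclass \<Omega> w = u"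
    using assms(3) gclass_eqI[OF assms(1), of w w0] by (auto simp: gclass_altdef)
qed

lemma grep_mem:
  assumes "open \<Omega>" "u \<in> colombeau \<Omega>" shows "grep u \<in> u"
proof -
  obtain w0 where "w0 \<in> u"
    using assms gclass_self by (auto simp: colombeau_def)
  then show ?thesis unfolding grep_def by (rule someI[of "\<lambda>w. w \<in> u"])
qed

lemma rep_equiv:
  assumes "open \<Omega>" "u \<in> colombeau \<Omega>" "w \<in> u" "w' \<in> u"
  shows "net_equiv \<Omega> w w'"
  using colombeau_rep[OF assms(1-3)] colombeau_rep[OF assms(1,2,4)] gclass_eqD[OF assms(1)] by metis

lemma net_equiv_add:
  "open \<Omega> \<Longrightarrow> net_equiv \<Omega> u u' \<Longrightarrow> net_equiv \<Omega> v v' \<Longrightarrow>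
    net_equiv \<Omega> (\<lambda>\<epsilon> x. u \<epsilon> x + v \<epsilon> x) (\<lambda>\<epsilon> x. u' \<epsilon> x + v' \<epsilon> x)"
  unfolding net_equiv_def by (drule (2) negligible_nets_add) (simp add: algebra_simps)

lemma net_equiv_diff:
  assumes "open \<Omega>" "net_equiv \<Omega> u u'" "net_equiv \<Omega> v v'"
  shows "net_equiv \<Omega> (\<lambda>\<epsilon> x. u \<epsilon> x - v \<epsilon> x) (\<lambda>\<epsilon> x. u' \<epsilon> x - v' \<epsilon> x)"
proof -
  have "net_equiv \<Omega> (\<lambda>\<epsilon> x. - v \<epsilon> x) (\<lambda>\<epsilon> x. - v' \<epsilon> x)"
    using negligible_nets_uminus[OF assms(1)] assms(3) unfolding net_equiv_def by fastforce
  from net_equiv_add[OF assms(1,2) this] show ?thesis by simp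
qed

lemma net_equiv_scale:
  "open \<Omega> \<Longrightarrow> net_equiv \<Omega> u u' \<Longrightarrow> moderate (\<lambda>\<epsilon>. cmod (c \<epsilon>)) \<Longrightarrow>
    net_equiv \<Omega> (\<lambda>\<epsilon> x. c \<epsilon> * u \<epsilon> x) (\<lambda>\<epsilon> x. c \<epsilon> * u' \<epsilon> x)"
  unfolding net_equiv_def by (drule (2) negligible_nets_scale) (simp add: algebra_simps)

lemma net_equiv_mderivative:
  assumes "open \<Omega>" "smooth_net \<Omega> u" "smooth_net \<Omega> v" "net_equiv \<Omega> u v"
  shows "net_equiv \<Omega> (\<lambda>\<epsilon>. mderivative \<alpha> (u \<epsilon>)) (\<lambda>\<epsilon>. mderivative \<alpha> (v \<epsilon>))"
  unfolding net_equiv_def mderivative_eq_pderivs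
proof (rule negligible_nets_cong[OF assms(1) negligible_nets_pderivs[OF assms(1) assms(4)[unfolded net_equiv_def]]])
  fix \<epsilon> :: real and x assume "\<epsilon> \<in> {0<..1}" "x \<in> \<Omega>"
  then show "pderivs (mindex_list \<alpha>) (u \<epsilon>) x - pderivs (mindex_list \<alpha>) (v \<epsilon>) x
      = pderivs (mindex_list \<alpha>) (\<lambda>x. u \<epsilon> x - v \<epsilon> x) x"
    using assms(2,3) pderivs_diff[OF assms(1)] unfolding smooth_net_def by metis
qed

lemma gadd_rep:
  assumes "open \<Omega>" "u \<in> colombeau \<Omega>" "v \<in> colombeau \<Omega>" "w \<in> u" "w' \<in> v"
  shows "gadd \<Omega> u v = gclass \<Omega> (\<lambda>\<epsilon> x. w \<epsilon> x + w' \<epsilon> x)"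
  unfolding gadd_def
  by (rule gclass_eqI[OF assms(1) net_equiv_add[OF assms(1)
        rep_equiv[OF assms(1,2) grep_mem[OF assms(1,2)] assms(4)]
        rep_equiv[OF assms(1,3) grep_mem[OF assms(1,3)] assms(5)]]])

lemma gdiff_rep:
  assumes "open \<Omega>" "u \<in> colombeau \<Omega>" "v \<in> colombeau \<Omega>" "w \<in> u" "w' \<in> v"
  shows "gdiff \<Omega> u v = gclass \<Omega> (\<lambda>\<epsilon> x. w \<epsilon> x - w' \<epsilon> x)"
  unfolding gdiff_def
  by (rule gclass_eqI[OF assms(1) net_equiv_diff[OF assms(1)
        rep_equiv[OF assms(1,2) grep_mem[OF assms(1,2)] assms(4)]
        rep_equiv[OF assms(1,3) grep_mem[OF assms(1,3)] assms(5)]]])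

lemma moderate_rep_gcomplex: "moderate (\<lambda>\<epsilon>. cmod (rep_gcomplex c \<epsilon>))"
  using Quotient3_rep_reflp[OF Quotient3_gcomplex, of c] by (simp add: moderate_eq_refl)

lemma gscale_rep:
  assumes "open \<Omega>" "u \<in> colombeau \<Omega>" "w \<in> u"
  shows "gscale \<Omega> c u = gclass \<Omega> (\<lambda>\<epsilon> x. rep_gcomplex c \<epsilon> * w \<epsilon> x)"
  unfolding gscale_def
  by (rule gclass_eqI[OF assms(1) net_equiv_scale[OF assms(1)
        rep_equiv[OF assms(1,2) grep_mem[OF assms(1,2)] assms(3)] moderate_rep_gcomplex]])

lemma gderiv_rep:
  assumes "open \<Omega>" "u \<in> colombeau \<Omega>" "w \<in> u"
  shows "gderiv \<Omega> \<alpha> u = gclass \<Omega> (\<lambda>\<epsilon>. mderivative \<alpha> (w \<epsilon>))"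
  unfolding gderiv_def
  by (rule gclass_eqI[OF assms(1) net_equiv_mderivative[OF assms(1)
        moderate_nets_smooth[OF colombeau_rep(1)[OF assms(1,2) grep_mem[OF assms(1,2)]]]
        moderate_nets_smooth[OF colombeau_rep(1)[OF assms]]
        rep_equiv[OF assms(1,2) grep_mem[OF assms(1,2)] assms(3)]]])

section \<open>Elements with compact support\<close>

lemma moderate_nets_subset: "u \<in> moderate_nets \<Omega> \<Longrightarrow> W \<subseteq> \<Omega> \<Longrightarrow> u \<in> moderate_nets W"
  unfolding moderate_nets_def by (auto intro: smooth_on_subset[of \<Omega> _ W])

lemma negligible_nets_subset: "u \<in> negligible_nets \<Omega> \<Longrightarrow> W \<subseteq> \<Omega> \<Longrightarrow> u \<in> negligible_nets W"
  unfolding negligible_nets_def by (auto intro: smooth_on_subset[of \<Omega> _ W])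

lemma net_equiv_subset: "net_equiv \<Omega> u v \<Longrightarrow> W \<subseteq> \<Omega> \<Longrightarrow> net_equiv W u v"
  unfolding net_equiv_def by (rule negligible_nets_subset)

lemma negligible_of_grestrict_zero:
  assumes "open \<Omega>" "open W" "W \<subseteq> \<Omega>" "u \<in> colombeau \<Omega>" "w \<in> u" "grestrict W u = gzero W"
  shows "w \<in> negligible_nets W"
proof -
  have "grep u \<in> moderate_nets W"
    using colombeau_rep(1)[OF assms(1,4) grep_mem[OF assms(1,4)]] assms(3) by (rule moderate_nets_subset)
  then have "net_equiv W (grep u) (\<lambda>\<epsilon> x. 0)"
    using assms(2,6) unfolding grestrict_def gzero_def by (intro gclass_eqD)
  moreover have "net_equiv W w (grep u)"
    using rep_equiv[OF assms(1,4,5) grep_mem[OF assms(1,4)]] assms(3) by (rule net_equiv_subset)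
  ultimately have "net_equiv W w (\<lambda>\<epsilon> x. 0)" using net_equiv_trans[OF assms(2)] by blast
  then show ?thesis by (simp add: net_equiv_def)
qed

text \<open>Off the support a representative is negligible near every point; finitely many such
  neighbourhoods cover the compact set \<open>K\<close>.\<close>

lemma negligible_off_support:
  assumes \<Omega>: "open \<Omega>" and u: "u \<in> colombeau \<Omega>" "w \<in> u"
    and K: "compact K" "K \<subseteq> \<Omega>" "K \<inter> gsupp \<Omega> u = {}"
  shows "net_bound w K is (real q)"
proof -
  have "\<exists>r>0. net_bound w (cball x r) is (real q)" if x: "x \<in> K" for x
  proof -
    obtain W where W: "open W" "W \<subseteq> \<Omega>" "grestrict W u = gzero W" "x \<in> W"
      using x K unfolding gsupp_def by blast
    obtain r where r: "r > 0" "cball x r \<subseteq> W"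
      using open_contains_cball_eq[OF W(1), rule_format, of x] W(4) by auto
    have "w \<in> negligible_nets W"
      using negligible_of_grestrict_zero[OF \<Omega> W(1,2) u W(3)] .
    then have "net_bound w (cball x r) is (real q)"
      using r(2) compact_cball[of x r] unfolding negligible_nets_iff[OF W(1)] by meson
    then show ?thesis using r(1) by blast
  qed
  then obtain \<rho> where \<rho>: "\<And>x. x \<in> K \<Longrightarrow> 0 < \<rho> x" "\<And>x. x \<in> K \<Longrightarrow> net_bound w (cball x (\<rho> x)) is (real q)"
    by metis
  have cover: "K \<subseteq> (\<Union>a\<in>K. ball a (\<rho> a))" using \<rho>(1) by fastforce
  obtain F where F: "F \<subseteq> K" "finite F" "K \<subseteq> (\<Union>a\<in>F. ball a (\<rho> a))"
    by (rule compactE_image[OF K(1) _ cover]) auto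
  have "\<forall>\<^sub>F \<epsilon> in at_right 0. \<forall>a\<in>F. \<forall>x\<in>cball a (\<rho> a). cmod (pderivs is (w \<epsilon>) x) \<le> \<epsilon> powr real q"
    using \<rho>(2) F unfolding net_bound_def by (intro eventually_ball_finite) auto
  then show ?thesis
    unfolding net_bound_def
  proof eventually_elim
    case (elim \<epsilon>)
    show ?case
    proof
      fix x assume "x \<in> K"
      then obtain a where "a \<in> F" "x \<in> ball a (\<rho> a)" using F(3) by blast
      then show "cmod (pderivs is (w \<epsilon>) x) \<le> \<epsilon> powr real q" using elim by auto
    qed
  qed
qed

text \<open>A moderate net with supports in one compact set. These nets are exactly the
  representatives through which functionals defined by integration are evaluated.\<close>

definition compact_net :: "(real^'n::finite) set \<Rightarrow> 'n net \<Rightarrow> bool" where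
  "compact_net \<Omega> w \<longleftrightarrow> w \<in> moderate_nets \<Omega> \<and>
    (\<exists>K. compact K \<and> K \<subseteq> \<Omega> \<and> (\<forall>\<epsilon>\<in>{0<..1}. w \<epsilon> \<in> smooth_supported \<Omega> K))"

text \<open>If \<open>w\<close> is supported in \<open>K\<close>, then the class of \<open>w\<close> vanishes on \<open>\<Omega> - K\<close>, so its support is a
  closed part of \<open>K\<close>.\<close>

lemma compact_net_rep:
  assumes \<Omega>: "open \<Omega>" and w: "compact_net \<Omega> w"
  shows "gclass \<Omega> w \<in> colombeau_c \<Omega>" "w \<in> compact_reps \<Omega> (gclass \<Omega> w)"
proof -
  have m: "w \<in> moderate_nets \<Omega>" using w by (simp add: compact_net_def)
  note u = gclass_colombeau[OF m]
  show "w \<in> compact_reps \<Omega> (gclass \<Omega> w)"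
    using w gclass_self[OF \<Omega> m] by (simp add: compact_net_def compact_reps_def)
  obtain K where K: "compact K" "K \<subseteq> \<Omega>" and s: "\<And>\<epsilon>. \<epsilon> \<in> {0<..1} \<Longrightarrow> w \<epsilon> \<in> smooth_supported \<Omega> K"
    using w by (auto simp: compact_net_def)
  define \<W> where "\<W> = {W. open W \<and> W \<subseteq> \<Omega> \<and> grestrict W (gclass \<Omega> w) = gzero W}"
  have W: "open (\<Omega> - K)" using \<Omega> K(1) by (simp add: compact_imp_closed open_Diff)
  have "net_equiv (\<Omega> - K) (grep (gclass \<Omega> w)) w"
    by (rule net_equiv_subset[OF rep_equiv[OF \<Omega> u grep_mem[OF \<Omega> u] gclass_self[OF \<Omega> m]]]) auto
  moreover have "net_equiv (\<Omega> - K) w (\<lambda>\<epsilon> x. 0)"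
    unfolding net_equiv_def using s
    by (intro negligible_nets_cong[OF W negligible_nets_zero[OF W]]) (auto simp: smooth_supported_def)
  ultimately have "net_equiv (\<Omega> - K) (grep (gclass \<Omega> w)) (\<lambda>\<epsilon> x. 0)"
    using net_equiv_trans[OF W] by blast
  then have "grestrict (\<Omega> - K) (gclass \<Omega> w) = gzero (\<Omega> - K)"
    unfolding grestrict_def gzero_def by (rule gclass_eqI[OF W])
  then have "\<Omega> - K \<in> \<W>" using W by (auto simp: \<W>_def)
  then have "gsupp \<Omega> (gclass \<Omega> w) = K - \<Union>\<W>"
    using K(2) unfolding gsupp_def \<W>_def by blast
  moreover have "open (\<Union>\<W>)" by (auto simp: \<W>_def)
  ultimately show "gclass \<Omega> w \<in> colombeau_c \<Omega>"
    using K(1) u by (simp add: colombeau_c_def compact_diff)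
qed

lemma compact_reps_net:
  assumes "open \<Omega>" "u \<in> colombeau \<Omega>" "w \<in> compact_reps \<Omega> u"
  shows "compact_net \<Omega> w" "w \<in> u" "gclass \<Omega> w = u"
proof -
  show "w \<in> u" using assms(3) by (simp add: compact_reps_def)
  from colombeau_rep[OF assms(1,2) this] show "compact_net \<Omega> w" "gclass \<Omega> w = u"
    using assms(3) by (simp_all add: compact_net_def compact_reps_def)
qed

lemma colombeau_c_colombeau: "u \<in> colombeau_c \<Omega> \<Longrightarrow> u \<in> colombeau \<Omega>"
  by (simp add: colombeau_c_def)

text \<open>Multiplying by a cutoff does not change the class: the error \<open>(\<theta> - 1) w\<close> vanishes near the
  support of \<open>u\<close>, and off the support \<open>w\<close> is negligible anyway.\<close>

lemma cutoff_compact_rep: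
  assumes \<Omega>: "open \<Omega>" and u: "u \<in> colombeau \<Omega>" "w \<in> u"
    and \<theta>: "smooth_on UNIV \<theta>" "open V" "gsupp \<Omega> u \<subseteq> V" "\<And>x. x \<in> V \<Longrightarrow> \<theta> x = 1"
    and L: "compact L" "L \<subseteq> \<Omega>" "\<And>x. x \<notin> L \<Longrightarrow> \<theta> x = 0"
  shows "(\<lambda>\<epsilon> x. \<theta> x * w \<epsilon> x) \<in> compact_reps \<Omega> u"
proof -
  have \<theta>\<Omega>: "smooth_on \<Omega> \<theta>" using \<theta>(1) by (rule smooth_on_subset) simp
  note m = colombeau_rep[OF \<Omega> u]
  have mw: "(\<lambda>\<epsilon> x. \<theta> x * w \<epsilon> x) \<in> moderate_nets \<Omega>" by (rule moderate_nets_mult_smooth[OF \<Omega> m(1) \<theta>\<Omega>])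
  have \<theta>1: "smooth_on \<Omega> (\<lambda>x. \<theta> x - 1)"
    by (rule smooth_on_diff[OF \<Omega> \<theta>\<Omega> smooth_on_const[OF \<Omega>]])
  have sn: "smooth_net \<Omega> (\<lambda>\<epsilon> x. (\<theta> x - 1) * w \<epsilon> x)"
    by (rule smooth_net_mult[OF \<Omega> \<theta>1 moderate_nets_smooth[OF m(1)]])
  have "net_bound (\<lambda>\<epsilon> x. (\<theta> x - 1) * w \<epsilon> x) K is (real q)" if K: "compact K" "K \<subseteq> \<Omega>" for K "is" q
  proof -
    have "net_bound w (K - V) js (real (Suc q))" for js
      using K \<theta>(2,3) by (intro negligible_off_support[OF \<Omega> u]) (auto intro: compact_diff)
    from net_bound_mult_smooth[OF \<Omega> moderate_nets_smooth[OF m(1)] compact_diff[OF K(1) \<theta>(2)] _ \<theta>1 this, of "is"]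
    have "net_bound (\<lambda>\<epsilon> x. (\<theta> x - 1) * w \<epsilon> x) (K - V) is (real q)" using K(2) by auto
    then show ?thesis unfolding net_bound_def
    proof eventually_elim
      case (elim \<epsilon>)
      have "pderivs is (\<lambda>x. (\<theta> x - 1) * w \<epsilon> x) x = 0" if x: "x \<in> V" for x
        using pderivs_cong[OF \<theta>(2) x, of "\<lambda>x. (\<theta> x - 1) * w \<epsilon> x" "\<lambda>x. 0" "is"] \<theta>(4)
        by (simp add: pderivs_zero)
      then show ?case using elim by (metis Diff_iff norm_zero powr_ge_zero)
    qed
  qed
  then have "(\<lambda>\<epsilon> x. (\<theta> x - 1) * w \<epsilon> x) \<in> negligible_nets \<Omega>"
    unfolding negligible_nets_iff[OF \<Omega>] using sn by blast
  then have "net_equiv \<Omega> (\<lambda>\<epsilon> x. \<theta> x * w \<epsilon> x) w"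
    by (simp add: net_equiv_def algebra_simps)
  then have "(\<lambda>\<epsilon> x. \<theta> x * w \<epsilon> x) \<in> u"
    using mw m(2) by (auto simp: gclass_altdef)
  moreover have "(\<lambda>x. \<theta> x * w \<epsilon> x) \<in> smooth_supported \<Omega> L" if "\<epsilon> \<in> {0<..1}" for \<epsilon>
    using that moderate_nets_smooth[OF mw] L(3) by (auto simp: smooth_supported_def smooth_net_def)
  ultimately show ?thesis using L(1,2) by (auto simp: compact_reps_def)
qed

lemma compact_reps_nonempty:
  assumes \<Omega>: "open \<Omega>" and u: "u \<in> colombeau_c \<Omega>"
  obtains w where "w \<in> compact_reps \<Omega> u"
proof -
  have "compact (gsupp \<Omega> u)" "gsupp \<Omega> u \<subseteq> \<Omega>"
    using u by (auto simp: colombeau_c_def gsupp_def)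
  then obtain \<theta> V L where "smooth_on UNIV \<theta>" "open V" "gsupp \<Omega> u \<subseteq> V" "\<And>x. x \<in> V \<Longrightarrow> \<theta> x = 1"
    "compact L" "V \<subseteq> L" "L \<subseteq> \<Omega>" "\<And>x. x \<notin> L \<Longrightarrow> \<theta> x = 0"
    using smooth_cutoff[OF _ \<Omega>] by metis
  then have "(\<lambda>\<epsilon> x. \<theta> x * grep u \<epsilon> x) \<in> compact_reps \<Omega> u"
    using cutoff_compact_rep[OF \<Omega> colombeau_c_colombeau[OF u] grep_mem[OF \<Omega> colombeau_c_colombeau[OF u]]]
    by blast
  then show ?thesis by (rule that)
qed

lemma compact_net_add:
  assumes \<Omega>: "open \<Omega>" and "compact_net \<Omega> u" "compact_net \<Omega> v"
  shows "compact_net \<Omega> (\<lambda>\<epsilon> x. u \<epsilon> x + v \<epsilon> x)"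
proof -
  obtain K L where K: "compact K" "K \<subseteq> \<Omega>" "\<forall>\<epsilon>\<in>{0<..1}. u \<epsilon> \<in> smooth_supported \<Omega> K"
    and L: "compact L" "L \<subseteq> \<Omega>" "\<forall>\<epsilon>\<in>{0<..1}. v \<epsilon> \<in> smooth_supported \<Omega> L"
    using assms(2,3) unfolding compact_net_def by blast
  have "\<forall>\<epsilon>\<in>{0<..1}. (\<lambda>x. u \<epsilon> x + v \<epsilon> x) \<in> smooth_supported \<Omega> (K \<union> L)"
    using K L by (auto simp: smooth_supported_def intro!: smooth_on_add[OF \<Omega>])
  moreover have "compact (K \<union> L)" "K \<union> L \<subseteq> \<Omega>" using K L by auto
  ultimately show ?thesis
    using moderate_nets_add[OF \<Omega>] assms(2,3) unfolding compact_net_def by meson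
qed

lemma compact_net_scale:
  assumes \<Omega>: "open \<Omega>" and "compact_net \<Omega> u" "moderate (\<lambda>\<epsilon>. cmod (c \<epsilon>))"
  shows "compact_net \<Omega> (\<lambda>\<epsilon> x. c \<epsilon> * u \<epsilon> x)"
proof -
  obtain K where K: "compact K" "K \<subseteq> \<Omega>" "\<forall>\<epsilon>\<in>{0<..1}. u \<epsilon> \<in> smooth_supported \<Omega> K"
    using assms(2) unfolding compact_net_def by blast
  have "\<forall>\<epsilon>\<in>{0<..1}. (\<lambda>x. c \<epsilon> * u \<epsilon> x) \<in> smooth_supported \<Omega> K"
    using K by (auto simp: smooth_supported_def intro!: smooth_on_cmult[OF \<Omega>])
  then show ?thesis
    using K moderate_nets_scale[OF \<Omega> _ assms(3)] assms(2) unfolding compact_net_def by meson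
qed

lemma compact_net_mderivative:
  assumes \<Omega>: "open \<Omega>" and "compact_net \<Omega> u"
  shows "compact_net \<Omega> (\<lambda>\<epsilon>. mderivative \<alpha> (u \<epsilon>))"
proof -
  obtain K where K: "compact K" "K \<subseteq> \<Omega>" "\<forall>\<epsilon>\<in>{0<..1}. u \<epsilon> \<in> smooth_supported \<Omega> K"
    using assms(2) unfolding compact_net_def by blast
  have "\<forall>\<epsilon>\<in>{0<..1}. mderivative \<alpha> (u \<epsilon>) \<in> smooth_supported \<Omega> K"
    using K(3) pderivs_zero_off[OF compact_imp_closed[OF K(1)]]
    by (simp add: smooth_supported_def mderivative_eq_pderivs smooth_on_pderivs)
  then show ?thesis
    using K moderate_nets_pderivs[OF \<Omega>] assms(2) unfolding compact_net_def mderivative_eq_pderivs by meson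
qed

lemma compact_net_zero: "open \<Omega> \<Longrightarrow> compact_net \<Omega> (\<lambda>\<epsilon> x. 0)"
  unfolding compact_net_def using negligible_moderate_nets negligible_nets_zero
  by (auto simp: smooth_supported_def smooth_on_const intro!: exI[of _ "{}"])

lemma gzero_colombeau_c: "open \<Omega> \<Longrightarrow> gzero \<Omega> \<in> colombeau_c \<Omega>"
  unfolding gzero_def by (intro compact_net_rep(1) compact_net_zero)

lemma gadd_compact_rep:
  assumes \<Omega>: "open \<Omega>" and "u \<in> colombeau \<Omega>" "v \<in> colombeau \<Omega>" "w \<in> compact_reps \<Omega> u" "w' \<in> compact_reps \<Omega> v"
  shows "gadd \<Omega> u v \<in> colombeau_c \<Omega>" "(\<lambda>\<epsilon> x. w \<epsilon> x + w' \<epsilon> x) \<in> compact_reps \<Omega> (gadd \<Omega> u v)"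
  using compact_net_rep[OF \<Omega> compact_net_add[OF \<Omega> compact_reps_net(1)[OF assms(1,2,4)] compact_reps_net(1)[OF assms(1,3,5)]]]
    gadd_rep[OF assms(1-3) compact_reps_net(2)[OF assms(1,2,4)] compact_reps_net(2)[OF assms(1,3,5)]]
  by simp_all

lemma gscale_compact_rep:
  assumes \<Omega>: "open \<Omega>" and "u \<in> colombeau \<Omega>" "w \<in> compact_reps \<Omega> u"
  shows "gscale \<Omega> c u \<in> colombeau_c \<Omega>" "(\<lambda>\<epsilon> x. rep_gcomplex c \<epsilon> * w \<epsilon> x) \<in> compact_reps \<Omega> (gscale \<Omega> c u)"
  using compact_net_rep[OF \<Omega> compact_net_scale[OF \<Omega> compact_reps_net(1)[OF assms] moderate_rep_gcomplex]]
    gscale_rep[OF assms(1,2) compact_reps_net(2)[OF assms]]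
  by simp_all

lemma gderiv_compact_rep:
  assumes \<Omega>: "open \<Omega>" and "u \<in> colombeau \<Omega>" "w \<in> compact_reps \<Omega> u"
  shows "gderiv \<Omega> \<alpha> u \<in> colombeau_c \<Omega>" "(\<lambda>\<epsilon>. mderivative \<alpha> (w \<epsilon>)) \<in> compact_reps \<Omega> (gderiv \<Omega> \<alpha> u)"
  using compact_net_rep[OF \<Omega> compact_net_mderivative[OF \<Omega> compact_reps_net(1)[OF assms]]]
    gderiv_rep[OF assms(1,2) compact_reps_net(2)[OF assms]]
  by simp_all

lemma gadd_gzero: "open \<Omega> \<Longrightarrow> u \<in> colombeau \<Omega> \<Longrightarrow> gadd \<Omega> u (gzero \<Omega>) = u"
proof -
  assume \<Omega>: "open \<Omega>" and u: "u \<in> colombeau \<Omega>"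
  have "(\<lambda>\<epsilon> x. 0) \<in> gzero \<Omega>"
    unfolding gzero_def by (intro gclass_self \<Omega> negligible_moderate_nets negligible_nets_zero)
  from gadd_rep[OF \<Omega> u colombeau_c_colombeau[OF gzero_colombeau_c[OF \<Omega>]] grep_mem[OF \<Omega> u] this]
  show ?thesis using colombeau_rep(2)[OF \<Omega> u grep_mem[OF \<Omega> u]] by simp
qed

lemma gdiff_gzero: "open \<Omega> \<Longrightarrow> u \<in> colombeau \<Omega> \<Longrightarrow> gdiff \<Omega> u (gzero \<Omega>) = u"
proof -
  assume \<Omega>: "open \<Omega>" and u: "u \<in> colombeau \<Omega>"
  have "(\<lambda>\<epsilon> x. 0) \<in> gzero \<Omega>"
    unfolding gzero_def by (intro gclass_self \<Omega> negligible_moderate_nets negligible_nets_zero)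
  from gdiff_rep[OF \<Omega> u colombeau_c_colombeau[OF gzero_colombeau_c[OF \<Omega>]] grep_mem[OF \<Omega> u] this]
  show ?thesis using colombeau_rep(2)[OF \<Omega> u grep_mem[OF \<Omega> u]] by simp
qed

section \<open>The ultra-norm and continuity on inductive limits\<close>

lemma abs_gcomplex_eqI: "moderate_eq r s \<Longrightarrow> abs_gcomplex r = abs_gcomplex s"
  by (rule Quotient3_rel_abs[OF Quotient3_gcomplex])

lemma abs_gcomplex_eventually_eq:
  assumes "moderate (\<lambda>\<epsilon>. cmod (r \<epsilon>))" "\<forall>\<^sub>F \<epsilon> in at_right 0. s \<epsilon> = r \<epsilon>"
  shows "abs_gcomplex s = abs_gcomplex r"
proof (rule abs_gcomplex_eqI)
  have "moderate (\<lambda>\<epsilon>. cmod (s \<epsilon>))"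
    by (rule moderate_eventually_le[OF assms(1)]) (use assms(2) in \<open>auto elim: eventually_mono\<close>)
  moreover have "negligible_net (\<lambda>\<epsilon>. cmod (s \<epsilon> - r \<epsilon>))"
    by (rule negligible_eventually_zero) (use assms(2) in \<open>auto elim: eventually_mono\<close>)
  ultimately show "moderate_eq s r" using assms(1) by (simp add: moderate_eq_def)
qed

text \<open>Moderateness excludes the valuation \<open>-\<infinity>\<close>, which \<^const>\<open>real_of_ereal\<close> would map to \<open>0\<close>.\<close>

lemma sharp_norm_less_iff:
  assumes "moderate r" "\<delta> > 0"
  shows "sharp_norm r < \<delta> \<longleftrightarrow> (\<exists>b > - ln \<delta>. big_O_eps r b)"
proof -
  have iff: "ereal (- ln \<delta>) < valuation r \<longleftrightarrow> (\<exists>b > - ln \<delta>. big_O_eps r b)"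
    unfolding valuation_def less_Sup_iff by auto
  obtain N :: nat where "big_O_eps r (- real N)" using assms(1) unfolding moderate_def by blast
  then have "ereal (- real N) \<le> valuation r" unfolding valuation_def by (intro Sup_upper) blast
  then have ninf: "valuation r \<noteq> - \<infinity>" by auto
  show ?thesis
  proof (cases "valuation r = \<infinity>")
    case True
    then show ?thesis using iff assms(2) by (simp add: sharp_norm_def)
  next
    case False
    then obtain v where v: "valuation r = ereal v" using ninf by (cases "valuation r") auto
    have "exp (- v) < \<delta> \<longleftrightarrow> - v < ln \<delta>"
      using assms(2) by (metis exp_less_cancel_iff exp_ln)
    then show ?thesis unfolding iff[symmetric] by (auto simp: sharp_norm_def v)
  qed
qed

lemma enorm_abs_less_iff:
  assumes "moderate (\<lambda>\<epsilon>. cmod (r \<epsilon>))" "\<delta> > 0"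
  shows "enorm (abs_gcomplex r) < \<delta> \<longleftrightarrow> (\<exists>b > - ln \<delta>. big_O_eps (\<lambda>\<epsilon>. cmod (r \<epsilon>)) b)"
  using assms sharp_norm_less_iff by (simp add: enorm.abs_eq moderate_eq_refl)

lemma gcomplex_cases:
  obtains r where "moderate (\<lambda>\<epsilon>. cmod (r \<epsilon>))" "z = abs_gcomplex r"
  using that[OF moderate_rep_gcomplex, of z] Quotient3_abs_rep[OF Quotient3_gcomplex, of z] by simp

text \<open>The strong triangle inequality: a sum of nets is of the order of its larger term.\<close>

lemma enorm_add_less:
  assumes "enorm y < \<delta>" "enorm z < \<delta>" "\<delta> > 0"
  shows "enorm (y + z) < \<delta>"
proof -
  obtain r where r: "moderate (\<lambda>\<epsilon>. cmod (r \<epsilon>))" "y = abs_gcomplex r" by (rule gcomplex_cases)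
  obtain s where s: "moderate (\<lambda>\<epsilon>. cmod (s \<epsilon>))" "z = abs_gcomplex s" by (rule gcomplex_cases)
  obtain a b where ab: "a > - ln \<delta>" "big_O_eps (\<lambda>\<epsilon>. cmod (r \<epsilon>)) a" "b > - ln \<delta>" "big_O_eps (\<lambda>\<epsilon>. cmod (s \<epsilon>)) b"
    using assms r s enorm_abs_less_iff by blast
  have "big_O_eps (\<lambda>\<epsilon>. cmod (r \<epsilon>) + cmod (s \<epsilon>)) (min a b)"
    using ab by (intro sum_in_bigo) (auto intro: big_O_eps_mono)
  then have "big_O_eps (\<lambda>\<epsilon>. cmod (r \<epsilon> + s \<epsilon>)) (min a b)"
    by (rule big_O_eps_le) (simp add: norm_triangle_ineq)
  moreover have "y + z = abs_gcomplex (\<lambda>\<epsilon>. r \<epsilon> + s \<epsilon>)"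
    using r s by (simp add: plus_gcomplex.abs_eq moderate_eq_refl)
  moreover have "min a b > - ln \<delta>" using ab by simp
  ultimately show ?thesis
    using enorm_abs_less_iff[OF moderate_norm_add[OF r(1) s(1)] assms(3)] by metis
qed

text \<open>An ultra-norm of at most \<open>1\<close> gives the order \<open>\<epsilon>\<^sup>a\<close> for every \<open>a < 0\<close> only, and not
  necessarily for \<open>a = 0\<close>. The strict inequality for \<open>z\<close> leaves room for such an \<open>a\<close>.\<close>

lemma enorm_mult_less:
  assumes "enorm c \<le> 1" "enorm z < \<delta>" "\<delta> > 0"
  shows "enorm (c * z) < \<delta>"
proof -
  obtain r where r: "moderate (\<lambda>\<epsilon>. cmod (r \<epsilon>))" "c = abs_gcomplex r" by (rule gcomplex_cases)
  obtain s where s: "moderate (\<lambda>\<epsilon>. cmod (s \<epsilon>))" "z = abs_gcomplex s" by (rule gcomplex_cases)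
  obtain b where b: "b > - ln \<delta>" "big_O_eps (\<lambda>\<epsilon>. cmod (s \<epsilon>)) b"
    using assms(2,3) s enorm_abs_less_iff by blast
  define t where "t = (b + ln \<delta>) / 2"
  have t: "t > 0" using b(1) by (simp add: t_def)
  then have "enorm c < exp t" using assms(1) by (smt (verit) one_less_exp_iff)
  then obtain a where a: "a > - t" "big_O_eps (\<lambda>\<epsilon>. cmod (r \<epsilon>)) a"
    using r enorm_abs_less_iff[OF r(1), of "exp t"] by auto
  have "big_O_eps (\<lambda>\<epsilon>. cmod (r \<epsilon> * s \<epsilon>)) (a + b)"
    using big_O_eps_mult[OF a(2) b(2)] by (simp add: norm_mult)
  moreover have "c * z = abs_gcomplex (\<lambda>\<epsilon>. r \<epsilon> * s \<epsilon>)"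
    using r s by (simp add: times_gcomplex.abs_eq moderate_eq_refl)
  moreover have "a + b > - ln \<delta>" using a(1) b(1) by (simp add: t_def field_simps)
  ultimately show ?thesis
    using enorm_abs_less_iff[OF moderate_norm_mult[OF r(1) s(1)] assms(3)] by metis
qed

lemma enorm_zero_less: "\<delta> > 0 \<Longrightarrow> enorm 0 < \<delta>"
  unfolding zero_gcomplex_def using moderate_const[of 0]
  by (subst enorm_abs_less_iff) (auto intro!: exI[of _ "- ln \<delta> + 1"])

text \<open>A linear functional is continuous once its sublevel sets at zero are basic neighbourhoods
  of zero: by the strong triangle inequality, the translate by \<open>u\<close> of a sublevel set is mapped
  into the ball around any \<open>r\<close> of the same radius, provided that \<open>T u\<close> lies in this ball.\<close>

lemma continuous_map_inductive_limit:
  assumes \<Omega>: "open \<Omega>" and T: "glinear \<Omega> (colombeau_c \<Omega>) T"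
    and nb: "\<And>\<delta>. \<delta> > 0 \<Longrightarrow> {v \<in> colombeau_c \<Omega>. enorm (T v) < \<delta>} \<in> inductive_nbhds \<Omega> \<tau>"
  shows "continuous_map (inductive_limit_topology \<Omega> \<tau>) gcomplex_topology T"
proof -
  let ?X = "inductive_limit_topology \<Omega> \<tau>"
  define \<B> where "\<B> = {gadd \<Omega> u ` V | u V. u \<in> colombeau_c \<Omega> \<and> V \<in> inductive_nbhds \<Omega> \<tau>}"
  have X: "?X = topology_generated_by \<B>" by (simp add: inductive_limit_topology_def \<B>_def)
  have "\<Union>\<B> \<subseteq> colombeau_c \<Omega>"
  proof
    fix y assume "y \<in> \<Union>\<B>"
    then obtain u v where uv: "u \<in> colombeau_c \<Omega>" "v \<in> colombeau_c \<Omega>" "y = gadd \<Omega> u v"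
      unfolding \<B>_def inductive_nbhds_def by blast
    obtain w w' where "w \<in> compact_reps \<Omega> u" "w' \<in> compact_reps \<Omega> v"
      using uv compact_reps_nonempty[OF \<Omega>] by metis
    then show "y \<in> colombeau_c \<Omega>"
      using gadd_compact_rep(1)[OF \<Omega>] uv colombeau_c_colombeau by metis
  qed
  then have top: "topspace ?X \<subseteq> colombeau_c \<Omega>" by (simp add: X)
  show ?thesis
    unfolding gcomplex_topology_def
  proof (rule continuous_on_generated_topo)
    show "T ` topspace ?X \<subseteq> \<Union>{{s. enorm (s - r) < \<delta>} | r \<delta>. 0 < \<delta>}"
    proof
      fix z assume "z \<in> T ` topspace ?X"
      have "z \<in> {s. enorm (s - z) < 1}" using enorm_zero_less[of 1] by simp
      then show "z \<in> \<Union>{{s. enorm (s - r) < \<delta>} | r \<delta>. 0 < \<delta>}"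
        using zero_less_one by blast
    qed
    fix U assume "U \<in> {{s. enorm (s - r) < \<delta>} | r \<delta>. 0 < \<delta>}"
    then obtain r \<delta> where U: "U = {s. enorm (s - r) < \<delta>}" "\<delta> > 0" by blast
    define V where "V = {v \<in> colombeau_c \<Omega>. enorm (T v) < \<delta>}"
    have V: "V \<in> inductive_nbhds \<Omega> \<tau>" unfolding V_def by (rule nb[OF U(2)])
    have z: "gzero \<Omega> \<in> V"
    proof -
      have "\<exists>O'. openin (\<tau> {}) O' \<and> gzero \<Omega> \<in> O' \<and> O' \<subseteq> V"
        using V unfolding inductive_nbhds_def by auto
      then show ?thesis by blast
    qed
    show "openin ?X (T -` U \<inter> topspace ?X)"
    proof (subst openin_subopen, intro ballI)
      fix u assume u: "u \<in> T -` U \<inter> topspace ?X"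
      then have uc: "u \<in> colombeau_c \<Omega>" using top by blast
      have mem: "gadd \<Omega> u ` V \<in> \<B>" using uc V unfolding \<B>_def by blast
      then have op: "openin ?X (gadd \<Omega> u ` V)" unfolding X by (rule topology_generated_by_Basis)
      moreover have "u \<in> gadd \<Omega> u ` V"
        using z gadd_gzero[OF \<Omega> colombeau_c_colombeau[OF uc]] by (metis imageI)
      moreover have "gadd \<Omega> u ` V \<subseteq> T -` U \<inter> topspace ?X"
      proof
        fix y assume y: "y \<in> gadd \<Omega> u ` V"
        then obtain v where v: "v \<in> colombeau_c \<Omega>" "enorm (T v) < \<delta>" "y = gadd \<Omega> u v"
          unfolding V_def by blast
        have "T y = T u + T v" using T uc v unfolding glinear_def by blast
        then have "T y - r = (T u - r) + T v" by simp
        moreover have "enorm (T u - r) < \<delta>" using u U by simp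
        ultimately have "enorm (T y - r) < \<delta>" using enorm_add_less[OF _ v(2) U(2)] by metis
        then show "y \<in> T -` U \<inter> topspace ?X"
          using y openin_subset[OF op] by (auto simp: U)
      qed
      ultimately show "\<exists>S. openin ?X S \<and> u \<in> S \<and> S \<subseteq> T -` U \<inter> topspace ?X" by blast
    qed
  qed
qed

section \<open>Functionals defined by nets of continuous functions\<close>

definition gpair :: "(real^'n::finite) set \<Rightarrow> 'n net \<Rightarrow> 'n net \<Rightarrow> real \<Rightarrow> complex" where
  "gpair \<Omega> g w = (\<lambda>\<epsilon>. set_lebesgue_integral lborel \<Omega> (\<lambda>x. g \<epsilon> x * w \<epsilon> x))"

lemma compactly_supported_integral:
  fixes h :: "real^'n::finite \<Rightarrow> complex"
  assumes K: "compact K" "K \<subseteq> \<Omega>" and h: "continuous_on \<Omega> h" "\<And>x. x \<notin> K \<Longrightarrow> h x = 0"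
  shows "set_integrable lborel \<Omega> h"
    and "\<And>A. (\<And>x. x \<in> K \<Longrightarrow> cmod (h x) \<le> A) \<Longrightarrow> cmod (set_lebesgue_integral lborel \<Omega> h) \<le> A * measure lborel K"
proof -
  have eq: "(\<lambda>x. indicator \<Omega> x *\<^sub>R h x) = (\<lambda>x. indicator K x *\<^sub>R h x)"
    using K(2) h(2) by (auto simp: indicator_def fun_eq_iff)
  have int: "integrable lborel (\<lambda>x. indicator K x *\<^sub>R h x)"
    using borel_integrable_compact[OF K(1) continuous_on_subset[OF h(1) K(2)]] .
  then show "set_integrable lborel \<Omega> h" by (simp add: set_integrable_def eq)
  fix A assume A: "\<And>x. x \<in> K \<Longrightarrow> cmod (h x) \<le> A"
  have fin: "emeasure lborel K < \<infinity>" using K(1) by (rule emeasure_compact_finite)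
  have Kb: "K \<in> sets lborel" using K(1) by (simp add: compact_imp_closed)
  have int': "integrable lborel (\<lambda>x. indicator K x *\<^sub>R A)"
    using Kb fin by (intro integrable_scaleR_left integrable_real_indicator)
  have "cmod (\<integral>x. indicator K x *\<^sub>R h x \<partial>lborel) \<le> (\<integral>x. indicator K x *\<^sub>R A \<partial>lborel)"
    using int int' A
    by (intro Bochner_Integration.integral_norm_bound_integral) (auto simp: indicator_def)
  also have "\<dots> = A * measure lborel K" using Kb fin by simp
  finally show "cmod (set_lebesgue_integral lborel \<Omega> h) \<le> A * measure lborel K"
    by (simp add: set_lebesgue_integral_def eq)
qed

text \<open>The number \<open>N\<close>, which absorbs the growth of \<open>g\<close> and the volume of \<open>K\<close>, does not depend on
  \<open>w\<close>. This uniformity gives moderateness, independence of the representative, and continuity of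
  the pairing.\<close>

lemma gpair_bound:
  assumes \<Omega>: "open \<Omega>" and g: "g \<in> moderate_continuous_nets \<Omega>" and K: "compact K" "K \<subseteq> \<Omega>"
  obtains N :: nat where "\<And>w b. (\<And>\<epsilon>. \<epsilon> \<in> {0<..1} \<Longrightarrow> w \<epsilon> \<in> smooth_supported \<Omega> K) \<Longrightarrow> net_bound w K [] b \<Longrightarrow>
     \<forall>\<^sub>F \<epsilon> in at_right 0. cmod (gpair \<Omega> g w \<epsilon>) \<le> \<epsilon> powr (b - real N)"
proof -
  obtain N :: nat where N: "\<forall>\<^sub>F \<epsilon> in at_right 0. \<bar>sup_on K (g \<epsilon>)\<bar> \<le> \<epsilon> powr - real N"
    using g K unfolding moderate_continuous_nets_def moderate_iff by blast
  have "\<forall>\<^sub>F \<epsilon> in at_right 0. cmod (gpair \<Omega> g w \<epsilon>) \<le> \<epsilon> powr (b - real (Suc N))"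
    if w: "\<And>\<epsilon>. \<epsilon> \<in> {0<..1} \<Longrightarrow> w \<epsilon> \<in> smooth_supported \<Omega> K" and b: "net_bound w K [] b" for w b
  proof -
    have "\<forall>\<^sub>F \<epsilon> in at_right 0. measure lborel K * \<epsilon> powr (b - real N) \<le> \<epsilon> powr (b - real (Suc N))"
      by (rule eventually_mult_powr_le) simp
    with N b[unfolded net_bound_def] eventually_eps show ?thesis
    proof eventually_elim
      case (elim \<epsilon>)
      have gc: "continuous_on \<Omega> (g \<epsilon>)" using g elim by (auto simp: moderate_continuous_nets_def)
      have wc: "continuous_on \<Omega> (w \<epsilon>)" "\<And>x. x \<notin> K \<Longrightarrow> w \<epsilon> x = 0"
        using w[OF elim(3)] by (auto simp: smooth_supported_def smooth_on_continuous)
      have "cmod (g \<epsilon> x * w \<epsilon> x) \<le> \<epsilon> powr - real N * \<epsilon> powr b" if "x \<in> K" for x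
        unfolding norm_mult
        using le_sup_on[OF K(1) continuous_on_subset[OF gc K(2)] that] elim that
        by (intro mult_mono) auto
      then have "cmod (gpair \<Omega> g w \<epsilon>) \<le> \<epsilon> powr - real N * \<epsilon> powr b * measure lborel K"
        unfolding gpair_def using wc
        by (intro compactly_supported_integral(2)[OF K] continuous_on_mult gc) auto
      also have "\<dots> = measure lborel K * \<epsilon> powr (b - real N)"
        by (simp add: powr_diff powr_minus divide_inverse mult_ac)
      finally show ?case using elim by linarith
    qed
  qed
  then show ?thesis by (rule that)
qed

lemma gpair_add:
  assumes "g \<in> moderate_continuous_nets \<Omega>" "compact_net \<Omega> u" "compact_net \<Omega> v" "\<epsilon> \<in> {0<..1}"
  shows "gpair \<Omega> g (\<lambda>\<epsilon> x. u \<epsilon> x + v \<epsilon> x) \<epsilon> = gpair \<Omega> g u \<epsilon> + gpair \<Omega> g v \<epsilon>"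
proof -
  have "set_integrable lborel \<Omega> (\<lambda>x. g \<epsilon> x * w \<epsilon> x)" if w: "compact_net \<Omega> w" for w
  proof -
    obtain K where K: "compact K" "K \<subseteq> \<Omega>" "w \<epsilon> \<in> smooth_supported \<Omega> K"
      using w assms(4) unfolding compact_net_def by blast
    have "continuous_on \<Omega> (g \<epsilon>)" using assms(1,4) by (auto simp: moderate_continuous_nets_def)
    then show ?thesis
      using K by (intro compactly_supported_integral(1)[OF K(1,2)] continuous_on_mult)
        (auto simp: smooth_supported_def smooth_on_continuous)
  qed
  then show ?thesis using assms(2,3) by (simp add: gpair_def distrib_left set_integral_add(2))
qed

lemma gpair_scale: "gpair \<Omega> g (\<lambda>\<epsilon> x. c \<epsilon> * u \<epsilon> x) \<epsilon> = c \<epsilon> * gpair \<Omega> g u \<epsilon>"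
proof -
  have "(\<lambda>x. g \<epsilon> x * (c \<epsilon> * u \<epsilon> x)) = (\<lambda>x. c \<epsilon> * (g \<epsilon> x * u \<epsilon> x))" by (simp add: mult_ac)
  then show ?thesis unfolding gpair_def by (simp only: set_integral_mult_right)
qed

lemma moderate_gpair:
  assumes \<Omega>: "open \<Omega>" and g: "g \<in> moderate_continuous_nets \<Omega>" and w: "compact_net \<Omega> w"
  shows "moderate (\<lambda>\<epsilon>. cmod (gpair \<Omega> g w \<epsilon>))"
proof -
  obtain K where K: "compact K" "K \<subseteq> \<Omega>" and s: "\<And>\<epsilon>. \<epsilon> \<in> {0<..1} \<Longrightarrow> w \<epsilon> \<in> smooth_supported \<Omega> K"
    using w unfolding compact_net_def by blast
  obtain M :: nat where M: "net_bound w K [] (- real M)"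
    using w K unfolding compact_net_def moderate_nets_iff[OF \<Omega>] by meson
  obtain N :: nat where "\<forall>\<^sub>F \<epsilon> in at_right 0. cmod (gpair \<Omega> g w \<epsilon>) \<le> \<epsilon> powr (- real M - real N)"
    using gpair_bound[OF \<Omega> g K] s M by metis
  then show ?thesis unfolding moderate_iff by (intro exI[of _ "M + N"]) (simp add: algebra_simps)
qed

lemma negligible_gpair:
  assumes \<Omega>: "open \<Omega>" and g: "g \<in> moderate_continuous_nets \<Omega>"
    and w: "compact_net \<Omega> w" and w': "compact_net \<Omega> w'" and "net_equiv \<Omega> w w'"
  shows "negligible_net (\<lambda>\<epsilon>. cmod (gpair \<Omega> g w \<epsilon> - gpair \<Omega> g w' \<epsilon>))"
proof -
  define d where "d = (\<lambda>\<epsilon> x. w \<epsilon> x + (-1) * w' \<epsilon> x)"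
  have m1: "compact_net \<Omega> (\<lambda>\<epsilon> x. (-1) * w' \<epsilon> x)"
    using compact_net_scale[OF \<Omega> w', of "\<lambda>_. -1"] moderate_const[of 1] by simp
  have d: "compact_net \<Omega> d" unfolding d_def by (rule compact_net_add[OF \<Omega> w m1])
  have dn: "d \<in> negligible_nets \<Omega>" using assms(5) by (simp add: d_def net_equiv_def)
  obtain K where K: "compact K" "K \<subseteq> \<Omega>" and s: "\<And>\<epsilon>. \<epsilon> \<in> {0<..1} \<Longrightarrow> d \<epsilon> \<in> smooth_supported \<Omega> K"
    using d unfolding compact_net_def by blast
  obtain N :: nat where N: "\<And>b. net_bound d K [] b \<Longrightarrow> \<forall>\<^sub>F \<epsilon> in at_right 0. cmod (gpair \<Omega> g d \<epsilon>) \<le> \<epsilon> powr (b - real N)"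
    using gpair_bound[OF \<Omega> g K] s by metis
  show ?thesis
    unfolding negligible_iff
  proof
    fix q :: nat
    have "net_bound d K [] (real (q + N))" using dn K unfolding negligible_nets_iff[OF \<Omega>] by meson
    from N[OF this] have "\<forall>\<^sub>F \<epsilon> in at_right 0. cmod (gpair \<Omega> g d \<epsilon>) \<le> \<epsilon> powr real q" by simp
    with eventually_eps show "\<forall>\<^sub>F \<epsilon> in at_right 0. \<bar>cmod (gpair \<Omega> g w \<epsilon> - gpair \<Omega> g w' \<epsilon>)\<bar> \<le> \<epsilon> powr real q"
    proof eventually_elim
      case (elim \<epsilon>)
      have "gpair \<Omega> g d \<epsilon> = gpair \<Omega> g w \<epsilon> - gpair \<Omega> g w' \<epsilon>"
        unfolding d_def gpair_add[OF g w m1 elim(1)] using gpair_scale[of \<Omega> g "\<lambda>_. -1" w' \<epsilon>] by simp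
      then show ?case using elim by simp
    qed
  qed
qed

text \<open>Only representatives supported in one compact set can be integrated against an arbitrary
  continuous net; by \<open>net_functional_eq\<close> the choice among them is immaterial.\<close>

definition net_functional :: "(real^'n::finite) set \<Rightarrow> 'n net \<Rightarrow> 'n functional" where
  "net_functional \<Omega> g u = abs_gcomplex (gpair \<Omega> g (SOME w. w \<in> compact_reps \<Omega> u))"

lemma net_functional_eq:
  assumes \<Omega>: "open \<Omega>" and g: "g \<in> moderate_continuous_nets \<Omega>"
    and u: "u \<in> colombeau \<Omega>" and w: "w \<in> compact_reps \<Omega> u"
  shows "net_functional \<Omega> g u = abs_gcomplex (gpair \<Omega> g w)"
proof -
  define w' where "w' = (SOME w. w \<in> compact_reps \<Omega> u)"
  have w': "w' \<in> compact_reps \<Omega> u" unfolding w'_def using w by (rule someI[of "\<lambda>w. w \<in> compact_reps \<Omega> u"])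
  note c = compact_reps_net[OF \<Omega> u w] compact_reps_net[OF \<Omega> u w']
  have "moderate_eq (gpair \<Omega> g w') (gpair \<Omega> g w)"
    unfolding moderate_eq_def
    using moderate_gpair[OF \<Omega> g c(1)] moderate_gpair[OF \<Omega> g c(4)]
      negligible_gpair[OF \<Omega> g c(4,1) rep_equiv[OF \<Omega> u c(5,2)]] by blast
  then show ?thesis unfolding net_functional_def w'_def[symmetric] by (rule abs_gcomplex_eqI)
qed

lemma defined_by_net_functional:
  "open \<Omega> \<Longrightarrow> g \<in> moderate_continuous_nets \<Omega> \<Longrightarrow> defined_by_net \<Omega> (net_functional \<Omega> g) g"
  unfolding defined_by_net_def using net_functional_eq[of \<Omega> g] colombeau_c_colombeau
  unfolding gpair_def by blast

lemma glinear_net_functional: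
  assumes \<Omega>: "open \<Omega>" and g: "g \<in> moderate_continuous_nets \<Omega>"
  shows "glinear \<Omega> (colombeau_c \<Omega>) (net_functional \<Omega> g)"
  unfolding glinear_def
proof (intro conjI ballI allI)
  fix u assume uc: "u \<in> colombeau_c \<Omega>"
  note u = colombeau_c_colombeau[OF uc]
  obtain w where w: "w \<in> compact_reps \<Omega> u" using compact_reps_nonempty[OF \<Omega> uc] .
  note cw = compact_reps_net(1)[OF \<Omega> u w]
  note mw = moderate_gpair[OF \<Omega> g cw]
  {
    fix v assume vc: "v \<in> colombeau_c \<Omega>"
    note v = colombeau_c_colombeau[OF vc]
    obtain w' where w': "w' \<in> compact_reps \<Omega> v" using compact_reps_nonempty[OF \<Omega> vc] .
    note cw' = compact_reps_net(1)[OF \<Omega> v w']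
    note mw' = moderate_gpair[OF \<Omega> g cw']
    note s = gadd_compact_rep[OF \<Omega> u v w w']
    have "net_functional \<Omega> g (gadd \<Omega> u v) = abs_gcomplex (gpair \<Omega> g (\<lambda>\<epsilon> x. w \<epsilon> x + w' \<epsilon> x))"
      by (rule net_functional_eq[OF \<Omega> g colombeau_c_colombeau[OF s(1)] s(2)])
    also have "\<dots> = abs_gcomplex (\<lambda>\<epsilon>. gpair \<Omega> g w \<epsilon> + gpair \<Omega> g w' \<epsilon>)"
      by (rule abs_gcomplex_eventually_eq[OF moderate_norm_add[OF mw mw']])
         (use eventually_eps gpair_add[OF g cw cw'] in \<open>auto elim: eventually_mono\<close>)
    also have "\<dots> = abs_gcomplex (gpair \<Omega> g w) + abs_gcomplex (gpair \<Omega> g w')"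
      using mw mw' by (simp add: plus_gcomplex.abs_eq moderate_eq_refl)
    finally show "net_functional \<Omega> g (gadd \<Omega> u v) = net_functional \<Omega> g u + net_functional \<Omega> g v"
      by (simp add: net_functional_eq[OF \<Omega> g u w] net_functional_eq[OF \<Omega> g v w'])
  }
  fix c
  note s = gscale_compact_rep[OF \<Omega> u w, of c]
  have "net_functional \<Omega> g (gscale \<Omega> c u) = abs_gcomplex (gpair \<Omega> g (\<lambda>\<epsilon> x. rep_gcomplex c \<epsilon> * w \<epsilon> x))"
    by (rule net_functional_eq[OF \<Omega> g colombeau_c_colombeau[OF s(1)] s(2)])
  also have "\<dots> = abs_gcomplex (\<lambda>\<epsilon>. rep_gcomplex c \<epsilon> * gpair \<Omega> g w \<epsilon>)"
    by (intro arg_cong[of _ _ abs_gcomplex] ext gpair_scale)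
  also have "\<dots> = abs_gcomplex (rep_gcomplex c) * abs_gcomplex (gpair \<Omega> g w)"
    using mw moderate_rep_gcomplex[of c] by (simp add: times_gcomplex.abs_eq moderate_eq_refl)
  finally show "net_functional \<Omega> g (gscale \<Omega> c u) = c * net_functional \<Omega> g u"
    by (simp add: net_functional_eq[OF \<Omega> g u w] Quotient3_abs_rep[OF Quotient3_gcomplex])
qed

lemma compact_nbhd_props:
  assumes "open \<Omega>" "compact K" "K \<subseteq> \<Omega>"
  shows "compact (compact_nbhd \<Omega> K)" "K \<subseteq> interior (compact_nbhd \<Omega> K)" "compact_nbhd \<Omega> K \<subseteq> \<Omega>"
proof -
  obtain \<theta> :: "real^'a \<Rightarrow> complex" and V L where "open V" "K \<subseteq> V" "compact L" "V \<subseteq> L" "L \<subseteq> \<Omega>"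
    using smooth_cutoff[OF assms(2,1,3)] by metis
  then have "compact L \<and> K \<subseteq> interior L \<and> L \<subseteq> \<Omega>" using interior_maximal[of V L] by auto
  then have "compact (compact_nbhd \<Omega> K) \<and> K \<subseteq> interior (compact_nbhd \<Omega> K) \<and> compact_nbhd \<Omega> K \<subseteq> \<Omega>"
    unfolding compact_nbhd_def by (rule someI)
  then show "compact (compact_nbhd \<Omega> K)" "K \<subseteq> interior (compact_nbhd \<Omega> K)" "compact_nbhd \<Omega> K \<subseteq> \<Omega>"
    by auto
qed

text \<open>Smallness of the seminorm is a statement about \<open>O\<close>-estimates with some exponent larger
  than \<open>- ln \<delta>\<close>; a slightly smaller exponent turns it into a pointwise bound.\<close>

lemma ups_small_imp_net_bound:
  assumes \<Omega>: "open \<Omega>" and u: "u \<in> colombeau \<Omega>" and L: "compact L" "L \<subseteq> \<Omega>"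
    and "ups L 0 u < \<delta>" "\<delta> > 0"
  obtains b where "b > - ln \<delta>" "net_bound (grep u) L [] b"
proof -
  note m = colombeau_rep(1)[OF \<Omega> u grep_mem[OF \<Omega> u]]
  have smooth: "smooth_on \<Omega> (grep u \<epsilon>)" if "\<epsilon> \<in> {0<..1}" for \<epsilon>
    using moderate_nets_smooth[OF m] that by (simp add: smooth_net_def)
  obtain N :: nat where N: "net_bound (grep u) L [] (- real N)"
    using m L unfolding moderate_nets_iff[OF \<Omega>] by meson
  have "\<forall>\<^sub>F \<epsilon> in at_right 0. \<bar>ck_norm L 0 (grep u \<epsilon>)\<bar> \<le> \<epsilon> powr - real N"
    using N[unfolded net_bound_def] eventually_eps
  proof eventually_elim
    case (elim \<epsilon>)
    have "ck_norm L 0 (grep u \<epsilon>) \<le> \<epsilon> powr - real N" using elim by (intro ck_norm_le) auto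
    then show ?case using ck_norm_nonneg[OF \<Omega> smooth[OF elim(2)] L, of 0] by simp
  qed
  then have "moderate (\<lambda>\<epsilon>. ck_norm L 0 (grep u \<epsilon>))" unfolding moderate_iff by blast
  then obtain b where b: "b > - ln \<delta>" "big_O_eps (\<lambda>\<epsilon>. ck_norm L 0 (grep u \<epsilon>)) b"
    using assms(5,6) sharp_norm_less_iff unfolding ups_def by blast
  define b' where "b' = (b - ln \<delta>) / 2"
  have b': "- ln \<delta> < b'" "b' < b" using b(1) by (auto simp: b'_def)
  have "net_bound (grep u) L [] b'"
    using big_O_epsD[OF b(2) b'(2)] eventually_eps unfolding net_bound_def
  proof eventually_elim
    case (elim \<epsilon>)
    show ?case
    proof
      fix x assume "x \<in> L"
      from le_ck_norm[OF \<Omega> smooth[OF elim(2)] L this, of "[]" 0]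
      show "cmod (pderivs [] (grep u \<epsilon>) x) \<le> \<epsilon> powr b'" using elim(1) by simp
    qed
  qed
  with b'(1) show ?thesis by (rule that)
qed

lemma ups_gzero_less:
  assumes \<Omega>: "open \<Omega>" and L: "compact L" "L \<subseteq> \<Omega>" and "\<delta> > 0"
  shows "ups L 0 (gzero \<Omega>) < \<delta>"
proof -
  note z = colombeau_c_colombeau[OF gzero_colombeau_c[OF \<Omega>]]
  have n: "grep (gzero \<Omega>) \<in> negligible_nets \<Omega>"
    using grep_mem[OF \<Omega> z] by (simp add: gzero_def gclass_def)
  obtain q :: nat where q: "- ln \<delta> < real q" using reals_Archimedean2 by blast
  have "net_bound (grep (gzero \<Omega>)) L [] (real q)"
    using n L unfolding negligible_nets_iff[OF \<Omega>] by meson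
  then have ev: "\<forall>\<^sub>F \<epsilon> in at_right 0. \<bar>ck_norm L 0 (grep (gzero \<Omega>) \<epsilon>)\<bar> \<le> 1 * \<epsilon> powr real q"
    using eventually_eps unfolding net_bound_def
  proof eventually_elim
    case (elim \<epsilon>)
    have "ck_norm L 0 (grep (gzero \<Omega>) \<epsilon>) \<le> \<epsilon> powr real q" using elim by (intro ck_norm_le) auto
    moreover have "smooth_on \<Omega> (grep (gzero \<Omega>) \<epsilon>)"
      using negligible_nets_smooth[OF n] elim by (simp add: smooth_net_def)
    ultimately show ?case using ck_norm_nonneg[OF \<Omega> _ L, of "grep (gzero \<Omega>) \<epsilon>" 0] by simp
  qed
  from big_O_epsI[OF this] have O: "big_O_eps (\<lambda>\<epsilon>. ck_norm L 0 (grep (gzero \<Omega>) \<epsilon>)) (real q)" .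
  then have "big_O_eps (\<lambda>\<epsilon>. ck_norm L 0 (grep (gzero \<Omega>) \<epsilon>)) (- real 0)" by (rule big_O_eps_mono) simp
  then have "moderate (\<lambda>\<epsilon>. ck_norm L 0 (grep (gzero \<Omega>) \<epsilon>))" unfolding moderate_def by blast
  then show ?thesis unfolding ups_def using sharp_norm_less_iff[OF _ assms(4)] q O by blast
qed

lemma gzero_colombeau_K:
  assumes \<Omega>: "open \<Omega>" shows "gzero \<Omega> \<in> colombeau_K \<Omega> K"
proof -
  have "grestrict \<Omega> (gzero \<Omega>) = gzero \<Omega>"
    unfolding grestrict_def
    using colombeau_rep(2)[OF \<Omega> colombeau_c_colombeau[OF gzero_colombeau_c[OF \<Omega>]] grep_mem[OF \<Omega> colombeau_c_colombeau[OF gzero_colombeau_c[OF \<Omega>]]]] .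
  then have "gsupp \<Omega> (gzero \<Omega>) = {}" unfolding gsupp_def using \<Omega> by blast
  then show ?thesis using gzero_colombeau_c[OF \<Omega>] by (simp add: colombeau_K_def)
qed

text \<open>On the elements supported in \<open>K\<close> the functional loses the power \<open>N\<close> of \<open>gpair_bound\<close> and
  one further power for the cutoff that produces a compactly supported representative. So the
  ball of radius \<open>\<delta> e\<^bsup>-(N+1)\<^esup>\<close> of the seminorm of order \<open>0\<close> is mapped into the ball of radius
  \<open>\<delta>\<close>.\<close>

lemma net_functional_dual:
  assumes \<Omega>: "open \<Omega>" and g: "g \<in> moderate_continuous_nets \<Omega>"
  shows "net_functional \<Omega> g \<in> dual_Gcm 0 \<Omega>"
proof -
  let ?T = "net_functional \<Omega> g"
  note lin = glinear_net_functional[OF \<Omega> g]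
  have "{v \<in> colombeau_c \<Omega>. enorm (?T v) < \<delta>} \<in> inductive_nbhds \<Omega> (colombeau_Km_topology 0 \<Omega>)"
    if \<delta>: "\<delta> > 0" for \<delta>
  proof -
    let ?V = "{v \<in> colombeau_c \<Omega>. enorm (?T v) < \<delta>}"
    have "absolutely_convex \<Omega> ?V"
      unfolding absolutely_convex_def
    proof (intro conjI ballI allI impI)
      fix u v assume uv: "u \<in> ?V" "v \<in> ?V"
      then obtain w w' where "w \<in> compact_reps \<Omega> u" "w' \<in> compact_reps \<Omega> v"
        using compact_reps_nonempty[OF \<Omega>] by (metis (mono_tags, lifting) mem_Collect_eq)
      then have "gadd \<Omega> u v \<in> colombeau_c \<Omega>"
        using gadd_compact_rep(1)[OF \<Omega>, of u v w w'] uv colombeau_c_colombeau by blast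
      moreover have "enorm (?T (gadd \<Omega> u v)) < \<delta>"
        using uv lin enorm_add_less[OF _ _ \<delta>] unfolding glinear_def by simp
      ultimately show "gadd \<Omega> u v \<in> ?V" by simp
    next
      fix c u assume u: "u \<in> ?V" and c: "enorm c \<le> 1"
      then obtain w where "w \<in> compact_reps \<Omega> u"
        using compact_reps_nonempty[OF \<Omega>] by (metis (mono_tags, lifting) mem_Collect_eq)
      then have "gscale \<Omega> c u \<in> colombeau_c \<Omega>"
        using gscale_compact_rep(1)[OF \<Omega>, of u w c] u colombeau_c_colombeau by blast
      moreover have "enorm (?T (gscale \<Omega> c u)) < \<delta>"
        using u lin enorm_mult_less[OF c _ \<delta>] unfolding glinear_def by simp
      ultimately show "gscale \<Omega> c u \<in> ?V" by simp
    qed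
    moreover have "\<exists>O'. openin (colombeau_Km_topology 0 \<Omega> K) O' \<and> gzero \<Omega> \<in> O' \<and> O' \<subseteq> ?V"
      if K: "compact K" "K \<subseteq> \<Omega>" for K
    proof -
      define L where "L = compact_nbhd \<Omega> K"
      have L: "compact L" "K \<subseteq> interior L" "L \<subseteq> \<Omega>"
        unfolding L_def using compact_nbhd_props[OF \<Omega> K] by auto
      obtain N :: nat where N: "\<And>w b. (\<And>\<epsilon>. \<epsilon> \<in> {0<..1} \<Longrightarrow> w \<epsilon> \<in> smooth_supported \<Omega> L) \<Longrightarrow> net_bound w L [] b \<Longrightarrow>
          \<forall>\<^sub>F \<epsilon> in at_right 0. cmod (gpair \<Omega> g w \<epsilon>) \<le> \<epsilon> powr (b - real N)"
        using gpair_bound[OF \<Omega> g L(1,3)] by metis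
      obtain \<theta> :: "real^'a \<Rightarrow> complex" and V L' where \<theta>: "smooth_on UNIV \<theta>" "open V" "K \<subseteq> V" "\<And>x. x \<in> V \<Longrightarrow> \<theta> x = 1"
          "compact L'" "V \<subseteq> L'" "L' \<subseteq> interior L" "\<And>x. x \<notin> L' \<Longrightarrow> \<theta> x = 0"
        using smooth_cutoff[OF K(1) open_interior L(2)] by metis
      have \<theta>L: "\<theta> x = 0" if "x \<notin> L" for x using \<theta>(7,8) interior_subset that by blast
      define \<delta>' where "\<delta>' = \<delta> * exp (- real (Suc N))"
      have \<delta>': "\<delta>' > 0" "- ln \<delta>' = - ln \<delta> + real (Suc N)" using \<delta> by (auto simp: \<delta>'_def ln_mult)
      define O' where "O' = {v \<in> colombeau_K \<Omega> K. ups L 0 (gdiff \<Omega> v (gzero \<Omega>)) < \<delta>'}"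
      have "openin (colombeau_Km_topology 0 \<Omega> K) O'"
        unfolding colombeau_Km_topology_def ups_topology_def O'_def L_def
        using gzero_colombeau_K[OF \<Omega>, of K] \<delta>'(1) by (intro topology_generated_by_Basis) blast
      moreover have "gzero \<Omega> \<in> O'"
        using gzero_colombeau_K[OF \<Omega>, of K] ups_gzero_less[OF \<Omega> L(1,3) \<delta>'(1)]
          gdiff_gzero[OF \<Omega> colombeau_c_colombeau[OF gzero_colombeau_c[OF \<Omega>]]]
        by (simp add: O'_def)
      moreover have "O' \<subseteq> ?V"
      proof
        fix v assume "v \<in> O'"
        then have vc: "v \<in> colombeau_c \<Omega>" and supp: "gsupp \<Omega> v \<subseteq> K"
          and small: "ups L 0 (gdiff \<Omega> v (gzero \<Omega>)) < \<delta>'"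
          by (auto simp: O'_def colombeau_K_def)
        note v = colombeau_c_colombeau[OF vc]
        obtain b where b: "b > - ln \<delta>'" "net_bound (grep v) L [] b"
          using ups_small_imp_net_bound[OF \<Omega> v L(1,3) small[unfolded gdiff_gzero[OF \<Omega> v]] \<delta>'(1)] .
        define w where "w = (\<lambda>\<epsilon> x. \<theta> x * grep v \<epsilon> x)"
        note m = colombeau_rep(1)[OF \<Omega> v grep_mem[OF \<Omega> v]]
        have w: "w \<in> compact_reps \<Omega> v"
          unfolding w_def using supp \<theta>(3,4) \<theta>L L(1,3)
          by (intro cutoff_compact_rep[OF \<Omega> v grep_mem[OF \<Omega> v] \<theta>(1,2)]) auto
        have \<theta>\<Omega>: "smooth_on \<Omega> \<theta>" using \<theta>(1) by (rule smooth_on_subset) simp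
        have "net_bound w L [] (b - 1)"
          unfolding w_def using b(2)
          by (intro net_bound_mult_smooth[OF \<Omega> moderate_nets_smooth[OF m] L(1,3) \<theta>\<Omega>]) simp
        moreover have "w \<epsilon> \<in> smooth_supported \<Omega> L" if "\<epsilon> \<in> {0<..1}" for \<epsilon>
          using that smooth_net_mult[OF \<Omega> \<theta>\<Omega> moderate_nets_smooth[OF m]] \<theta>L
          by (auto simp: w_def smooth_supported_def smooth_net_def)
        ultimately have "\<forall>\<^sub>F \<epsilon> in at_right 0. cmod (gpair \<Omega> g w \<epsilon>) \<le> \<epsilon> powr (b - 1 - real N)"
          using N by blast
        then have "big_O_eps (\<lambda>\<epsilon>. cmod (gpair \<Omega> g w \<epsilon>)) (b - 1 - real N)"
          by (intro big_O_epsI[where c = 1]) simp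
        moreover have "b - 1 - real N > - ln \<delta>" using b(1) \<delta>'(2) by simp
        ultimately have "enorm (abs_gcomplex (gpair \<Omega> g w)) < \<delta>"
          using enorm_abs_less_iff[OF moderate_gpair[OF \<Omega> g compact_reps_net(1)[OF \<Omega> v w]] \<delta>] by blast
        then show "v \<in> ?V" using vc net_functional_eq[OF \<Omega> g v w] by simp
      qed
      ultimately show ?thesis by blast
    qed
    ultimately show ?thesis unfolding inductive_nbhds_def by blast
  qed
  from continuous_map_inductive_limit[OF \<Omega> lin this] show ?thesis
    using lin by (simp add: dual_Gcm_def colombeau_cm_topology_def)
qed

section \<open>Plane waves on a cube\<close>

definition wave :: "real^'n::finite \<Rightarrow> real^'n \<Rightarrow> complex" where
  "wave \<xi> x = cis (\<xi> \<bullet> x)"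

lemma norm_wave [simp]: "cmod (wave \<xi> x) = 1"
  by (simp add: wave_def)

lemma wave_add: "wave (\<xi> + \<zeta>) x = wave \<xi> x * wave \<zeta> x"
  by (simp add: wave_def cis_mult inner_add_left)

lemma wave_zero [simp]: "wave 0 x = 1"
  by (simp add: wave_def)

lemma wave_has_derivative:
  "(wave \<xi> has_derivative (\<lambda>h. \<i> * of_real (\<xi> \<bullet> h) * wave \<xi> x)) (at x within A)"
proof -
  have "((\<lambda>x. \<i> * complex_of_real (\<xi> \<bullet> x)) has_derivative (\<lambda>h. \<i> * of_real (\<xi> \<bullet> h))) (at x within A)"
    by (auto intro!: derivative_eq_intros)
  from has_derivative_compose[OF this DERIV_exp[unfolded has_field_derivative_def]]
  show ?thesis unfolding wave_def cis_conv_exp by (simp add: mult_ac)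
qed

lemma continuous_on_wave [continuous_intros]: "continuous_on A (wave \<xi>)"
  by (rule has_derivative_continuous_on[OF wave_has_derivative])

lemma smooth_on_wave:
  assumes "open \<Omega>" shows "smooth_on \<Omega> (wave \<xi>)"
proof (rule smooth_onI_closed[OF assms, where F = "range (\<lambda>c x. c * wave \<xi> x)"])
  fix f i assume "f \<in> range (\<lambda>c x. c * wave \<xi> x)"
  then obtain c where f: "f = (\<lambda>x. c * wave \<xi> x)" by blast
  have d: "(f has_derivative (\<lambda>h. c * (\<i> * of_real (\<xi> \<bullet> h) * wave \<xi> x))) (at x within A)" for x A
    unfolding f by (rule has_derivative_mult_right[OF wave_has_derivative])
  then show "f differentiable_on \<Omega>"
    unfolding differentiable_on_def differentiable_def by (intro ballI exI)
  define K where "K = c * \<i> * of_real (\<xi> \<bullet> axis i 1)"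
  show "\<exists>g\<in>range (\<lambda>c x. c * wave \<xi> x). \<forall>x\<in>\<Omega>. pderivative i f x = g x"
  proof (rule bexI)
    show "\<forall>x\<in>\<Omega>. pderivative i f x = K * wave \<xi> x"
      unfolding pderivative_eq_derivative[OF d] by (simp add: K_def)
    show "(\<lambda>x. K * wave \<xi> x) \<in> range (\<lambda>c x. c * wave \<xi> x)"
      by (rule range_eqI[of _ _ K]) simp
  qed
next
  show "wave \<xi> \<in> range (\<lambda>c x. c * wave \<xi> x)"
    by (rule range_eqI[of _ _ 1]) simp
qed

lemma pderivative_wave: "pderivative i (wave \<xi>) x = \<i> * of_real (\<xi> $ i) * wave \<xi> x"
  unfolding pderivative_eq_derivative[OF wave_has_derivative] by (simp add: inner_axis)

lemma pderivs_wave: "pderivs is (wave \<xi>) x = (\<Prod>i\<leftarrow>is. \<i> * of_real (\<xi> $ i)) * wave \<xi> x"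
proof (induction "is" arbitrary: x)
  case (Cons i "is")
  have "pderivs is (wave \<xi>) = (\<lambda>x. (\<Prod>i\<leftarrow>is. \<i> * of_real (\<xi> $ i)) * wave \<xi> x)"
    using Cons.IH by (rule ext)
  then have "pderivs (i # is) (wave \<xi>) x = pderivative i (\<lambda>x. (\<Prod>i\<leftarrow>is. \<i> * of_real (\<xi> $ i)) * wave \<xi> x) x"
    by simp
  also have "\<dots> = (\<Prod>i\<leftarrow>is. \<i> * of_real (\<xi> $ i)) * pderivative i (wave \<xi>) x"
    using pderivs_cmult[OF open_UNIV smooth_on_wave[OF open_UNIV] UNIV_I, of "[i]"] by simp
  finally show ?case by (simp add: pderivative_wave)
qed simp

definition cube :: "real \<Rightarrow> (real^'n::finite) set" where
  "cube R = {x. \<forall>i. \<bar>x $ i\<bar> \<le> R}"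

definition open_cube :: "real \<Rightarrow> (real^'n::finite) set" where
  "open_cube R = {x. \<forall>i. \<bar>x $ i\<bar> < R}"

lemma cube_eq_cbox: "cube R = cbox (\<chi> i. - R) (\<chi> i. R)"
proof -
  have "\<bar>t\<bar> \<le> R \<longleftrightarrow> - R \<le> t \<and> t \<le> R" for t by auto
  then show ?thesis by (simp add: set_eq_iff cube_def mem_box_cart)
qed

lemma open_cube_eq_box: "open_cube R = box (\<chi> i. - R) (\<chi> i. R)"
proof -
  have "\<bar>t\<bar> < R \<longleftrightarrow> - R < t \<and> t < R" for t by auto
  then show ?thesis by (simp add: set_eq_iff open_cube_def mem_box_cart)
qed

lemma compact_cube: "compact (cube R)" by (simp add: cube_eq_cbox)
lemma open_open_cube: "open (open_cube R)" by (simp add: open_cube_eq_box open_box)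
lemma open_cube_subset_cube: "open_cube R \<subseteq> cube R" by (auto simp: open_cube_def cube_def less_imp_le)

text \<open>Lebesgue measure on \<open>\<real>\<^sup>n\<close> is the image of a product measure indexed by the basis vectors;
  the coordinates are the inner products with them.\<close>

lemma lborel_integral_prod_vec:
  fixes \<phi> :: "'n::finite \<Rightarrow> real \<Rightarrow> complex"
  assumes "\<And>i. integrable lborel (\<phi> i)"
  shows "(\<integral>x. (\<Prod>i\<in>UNIV. \<phi> i ((x::real^'n) $ i)) \<partial>lborel) = (\<Prod>i\<in>UNIV. integral\<^sup>L lborel (\<phi> i))"
proof -
  interpret product_sigma_finite "\<lambda>b :: real^'n. lborel :: real measure"
    by (simp add: product_sigma_finite_def sigma_finite_lborel)
  define ax where "ax = (\<lambda>i :: 'n. axis i (1::real))"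
  have inj: "inj ax" by (auto simp: ax_def inj_def axis_eq_axis)
  have inner_ax: "x \<bullet> ax i = x $ i" for x :: "real^'n" and i by (simp add: ax_def inner_axis)
  have Basis: "(Basis :: (real^'n) set) = range ax" by (auto simp: ax_def Basis_vec_def)
  define \<phi>' where "\<phi>' = (\<lambda>b. \<phi> (inv ax b))"
  have [measurable]: "\<phi> i \<in> borel_measurable borel" for i
    using borel_measurable_integrable[OF assms] by simp
  have prod_eq: "(\<Prod>i\<in>UNIV. \<phi> i (x $ i)) = (\<Prod>b\<in>Basis. \<phi>' b (x \<bullet> b))" for x
    unfolding Basis by (subst prod.reindex[OF inj]) (simp add: \<phi>'_def inj inner_ax)
  have meas: "(\<lambda>x::real^'n. \<Prod>b\<in>Basis. \<phi>' b (x \<bullet> b)) \<in> borel_measurable borel"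
    unfolding \<phi>'_def by measurable
  have "(\<integral>x. (\<Prod>i\<in>UNIV. \<phi> i ((x::real^'n) $ i)) \<partial>lborel)
      = (\<integral>f. (\<Prod>b\<in>Basis. \<phi>' b ((\<Sum>b\<in>Basis. f b *\<^sub>R b) \<bullet> b)) \<partial>(\<Pi>\<^sub>M b\<in>(Basis :: (real^'n) set). lborel))"
    unfolding prod_eq by (subst lborel_eq, subst integral_distr) (use meas in \<open>simp_all add: \<phi>'_def\<close>)
  also have "\<dots> = (\<integral>f. (\<Prod>b\<in>Basis. \<phi>' b (f b)) \<partial>(\<Pi>\<^sub>M b\<in>(Basis :: (real^'n) set). lborel))"
    by (intro Bochner_Integration.integral_cong refl prod.cong) simp_all
  also have "\<dots> = (\<Prod>b\<in>Basis. integral\<^sup>L lborel (\<phi>' b))"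
    by (rule product_integral_prod) (simp_all add: \<phi>'_def assms)
  also have "\<dots> = (\<Prod>i\<in>UNIV. integral\<^sup>L lborel (\<phi> i))"
    unfolding Basis by (subst prod.reindex[OF inj]) (simp add: \<phi>'_def inj)
  finally show ?thesis .
qed

lemma integral_cis_period:
  assumes R: "R > 0"
  shows "(\<integral>t. indicator {-R..R} t *\<^sub>R cis (pi / R * of_int m * t) \<partial>lborel) = (if m = 0 then complex_of_real (2 * R) else 0)"
proof (cases "m = 0")
  case True
  then show ?thesis using R by (simp add: scaleR_conv_of_real)
next
  case False
  define c where "c = pi / R * of_int m"
  have c: "c \<noteq> 0" using False R by (simp add: c_def)
  have "(\<integral>t. indicator {-R..R} t *\<^sub>R cis (c * t) \<partial>lborel)
      = cis (c * R) / (\<i> * of_real c) - cis (c * - R) / (\<i> * of_real c)"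
  proof (rule integral_FTC_Icc)
    show "- R \<le> R" using R by simp
    show "continuous_on {-R..R} (\<lambda>t. cis (c * t))" by (intro continuous_intros)
    fix t
    have "((\<lambda>t. \<i> * complex_of_real (c * t)) has_derivative (\<lambda>h. \<i> * of_real (c * h))) (at t within {-R..R})"
      by (auto intro!: derivative_eq_intros)
    from has_derivative_compose[OF this DERIV_exp[unfolded has_field_derivative_def]]
    have "((\<lambda>t. exp (\<i> * of_real (c * t))) has_vector_derivative \<i> * of_real c * exp (\<i> * of_real (c * t)))
        (at t within {-R..R})"
      by (simp add: has_vector_derivative_def scaleR_conv_of_real mult_ac)
    from has_vector_derivative_mult_right[OF this, of "1 / (\<i> * of_real c)"]
    have "((\<lambda>t. exp (\<i> * of_real (c * t)) / (\<i> * of_real c)) has_vector_derivative exp (\<i> * of_real (c * t)))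
        (at t within {-R..R})"
      using c by simp
    then show "((\<lambda>t. cis (c * t) / (\<i> * of_real c)) has_vector_derivative cis (c * t)) (at t within {-R..R})"
      by (simp add: cis_conv_exp)
  qed
  moreover have "cis (c * R) = cis (c * - R)"
  proof -
    have "c * R = pi * of_int m" using R by (simp add: c_def)
    moreover have "cis (pi * of_int m) = cis (pi * of_int m - 2 * pi * of_int m)"
      using cis_mult[of "pi * of_int m" "- (2 * pi * of_int m)"] cis_multiple_2pi[of "- of_int m"] by simp
    ultimately show ?thesis by simp
  qed
  ultimately show ?thesis using False by (simp add: c_def)
qed

lemma integral_wave_cube:
  fixes m :: "'n::finite \<Rightarrow> int"
  assumes R: "R > 0"
  shows "set_lebesgue_integral lborel (cube R) (wave (\<chi> i. pi / R * of_int (m i)))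
     = (if m = (\<lambda>_. 0) then complex_of_real ((2 * R) ^ CARD('n)) else 0)"
proof -
  have eq: "indicator (cube R) x *\<^sub>R wave (\<chi> i. pi / R * of_int (m i)) x
     = (\<Prod>i\<in>UNIV. indicator {-R..R} (x $ i) *\<^sub>R cis (pi / R * of_int (m i) * (x $ i)))" for x :: "real^'n"
  proof -
    have "cis (\<Sum>i\<in>A. f i) = (\<Prod>i\<in>A. cis (f i))" if "finite A" for f :: "'n \<Rightarrow> real" and A
      using that by induction (simp_all add: cis_mult[symmetric])
    then have w: "wave (\<chi> i. pi / R * of_int (m i)) x = (\<Prod>i\<in>UNIV. cis (pi / R * of_int (m i) * (x $ i)))"
      by (simp add: wave_def inner_vec_def)
    show ?thesis
    proof (cases "x \<in> cube R")
      case True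
      then have "\<bar>x $ i\<bar> \<le> R" for i by (simp add: cube_def)
      then have "x $ i \<in> {-R..R}" for i by (simp add: abs_le_iff) (metis minus_le_iff)
      then have "indicator {-R..R} (x $ i) = (1::real)" for i by simp
      then show ?thesis using True w by simp
    next
      case False
      then obtain i where "\<bar>x $ i\<bar> > R" by (auto simp: cube_def not_le)
      then have "indicator {-R..R} (x $ i) = (0::real)" by (auto simp: indicator_def)
      then have "(\<Prod>i\<in>UNIV. indicator {-R..R} (x $ i) *\<^sub>R cis (pi / R * of_int (m i) * (x $ i))) = 0"
        by (intro prod_zero bexI[of _ i]) simp_all
      then show ?thesis using False by simp
    qed
  qed
  have "integrable lborel (\<lambda>t. indicator {-R..R} t *\<^sub>R cis (pi / R * of_int (m i) * t))" for i
    by (intro borel_integrable_compact continuous_intros) auto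
  from lborel_integral_prod_vec[OF this]
  have "set_lebesgue_integral lborel (cube R) (wave (\<chi> i. pi / R * of_int (m i)))
     = (\<Prod>i\<in>UNIV. if m i = 0 then complex_of_real (2 * R) else 0)"
    unfolding set_lebesgue_integral_def eq integral_cis_period[OF R] .
  also have "\<dots> = (if m = (\<lambda>_. 0) then complex_of_real ((2 * R) ^ CARD('n)) else 0)"
  proof (cases "m = (\<lambda>_. 0)")
    case False
    then obtain i where "m i \<noteq> 0" by auto
    then have "(\<Prod>i\<in>UNIV. if m i = 0 then complex_of_real (2 * R) else 0) = 0"
      by (intro prod_zero) (auto intro!: bexI[of _ i])
    then show ?thesis using False by simp
  qed simp
  finally show ?thesis .
qed

section \<open>Uniqueness of Fourier coefficients\<close>

lemma set_integrable_cube: "continuous_on (cube R) h \<Longrightarrow> set_integrable lborel (cube R) (h :: real^'n::finite \<Rightarrow> complex)"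
  unfolding set_integrable_def by (rule borel_integrable_compact[OF compact_cube])

text \<open>Spans of waves with period \<open>2 R\<close> in every coordinate. They form an algebra because waves
  multiply by adding their frequencies.\<close>

inductive_set trig_polys :: "real \<Rightarrow> (real^'n::finite \<Rightarrow> complex) set" for R where
  wave: "wave (\<chi> i. pi / R * of_int (m i)) \<in> trig_polys R"
| add: "p \<in> trig_polys R \<Longrightarrow> q \<in> trig_polys R \<Longrightarrow> (\<lambda>x. p x + q x) \<in> trig_polys R"
| scale: "p \<in> trig_polys R \<Longrightarrow> (\<lambda>x. c * p x) \<in> trig_polys R"

lemma trig_polys_mult:
  assumes "p \<in> trig_polys R" "q \<in> trig_polys R"
  shows "(\<lambda>x. p x * q x) \<in> trig_polys R"
  using assms(1)
proof induction
  case (wave m)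
  show ?case using assms(2)
  proof induction
    case (wave m')
    have "(\<lambda>x. wave (\<chi> i. pi / R * of_int (m i)) x * wave (\<chi> i. pi / R * of_int (m' i)) x)
      = wave (\<chi> i. pi / R * of_int (m i + m' i))"
    proof
      fix x
      have "(\<chi> i. pi / R * of_int (m i)) + (\<chi> i. pi / R * of_int (m' i)) = (\<chi> i. pi / R * of_int (m i + m' i))"
        by (simp add: vec_eq_iff algebra_simps)
      then show "wave (\<chi> i. pi / R * of_int (m i)) x * wave (\<chi> i. pi / R * of_int (m' i)) x
        = wave (\<chi> i. pi / R * of_int (m i + m' i)) x"
        by (metis wave_add)
    qed
    then show ?case using trig_polys.wave by metis
  next
    case (add p q)
    from trig_polys.add[OF add.IH] show ?case by (simp add: distrib_left)
  next
    case (scale p c)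
    from trig_polys.scale[OF scale.IH, of c] show ?case by (simp add: mult_ac)
  qed
next
  case (add p p')
  from trig_polys.add[OF add.IH] show ?case by (simp add: distrib_right)
next
  case (scale p c)
  from trig_polys.scale[OF scale.IH, of c] show ?case by (simp add: mult_ac)
qed

lemma trig_polys_const: "(\<lambda>x. c) \<in> trig_polys R"
  using trig_polys.scale[OF trig_polys.wave[of R "\<lambda>_. 0"], of c]
  by (simp add: vec_eq_iff[symmetric] zero_vec_def[symmetric])

lemma trig_polys_power: "p \<in> trig_polys R \<Longrightarrow> (\<lambda>x. p x ^ N) \<in> trig_polys R"
  by (induction N) (simp_all add: trig_polys_const trig_polys_mult)

lemma trig_polys_sum: "(\<And>i. i \<in> A \<Longrightarrow> p i \<in> trig_polys R) \<Longrightarrow> (\<lambda>x. \<Sum>i\<in>A. p i x) \<in> trig_polys R"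
  by (induction A rule: infinite_finite_induct) (simp_all add: trig_polys_const trig_polys.add)

lemma trig_polys_cos: "(\<lambda>x. complex_of_real (cos (pi / R * (x $ j - z)))) \<in> trig_polys R"
proof -
  define m where "m = (\<lambda>i. if i = j then 1 else 0 :: int)"
  have s1: "(\<chi> i. pi / R * of_int (m i)) = axis j (pi / R)"
    and s2: "(\<chi> i. pi / R * of_int (- m i)) = - axis j (pi / R)"
    by (simp_all add: vec_eq_iff m_def axis_def)
  have "(\<lambda>x. (cis (- (pi / R * z)) / 2) * wave (axis j (pi / R)) x + (cis (pi / R * z) / 2) * wave (- axis j (pi / R)) x)
      \<in> trig_polys R"
    using trig_polys.add[OF trig_polys.scale[OF trig_polys.wave[of R m]] trig_polys.scale[OF trig_polys.wave[of R "\<lambda>i. - m i"]]]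
    unfolding s1 s2 .
  moreover have "(cis (- (pi / R * z)) / 2) * wave (axis j (pi / R)) x + (cis (pi / R * z) / 2) * wave (- axis j (pi / R)) x
    = complex_of_real (cos (pi / R * (x $ j - z)))" for x
  proof -
    have "(cis (- (pi / R * z)) / 2) * wave (axis j (pi / R)) x + (cis (pi / R * z) / 2) * wave (- axis j (pi / R)) x
       = (cis (pi / R * (x $ j - z)) + cis (- (pi / R * (x $ j - z)))) / 2"
      by (simp add: wave_def cis_mult inner_axis' algebra_simps add_divide_distrib)
    also have "\<dots> = complex_of_real (cos (pi / R * (x $ j - z)))"
      by (simp add: complex_eq_iff)
    finally show ?thesis .
  qed
  ultimately show ?thesis by simp
qed

lemma integral_mult_trig_poly_zero:
  fixes h :: "real^'n::finite \<Rightarrow> complex"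
  assumes h: "continuous_on (cube R) h"
    and z: "\<And>m. set_lebesgue_integral lborel (cube R) (\<lambda>x. h x * wave (\<chi> i. pi / R * of_int (m i)) x) = 0"
    and p: "p \<in> trig_polys R"
  shows "set_integrable lborel (cube R) (\<lambda>x. h x * p x)"
    and "set_lebesgue_integral lborel (cube R) (\<lambda>x. h x * p x) = 0"
proof -
  have "set_integrable lborel (cube R) (\<lambda>x. h x * p x) \<and> set_lebesgue_integral lborel (cube R) (\<lambda>x. h x * p x) = 0"
    using p
  proof induction
    case (wave m)
    then show ?case using z by (intro conjI set_integrable_cube continuous_intros h) auto
  next
    case (add p q)
    then show ?case by (simp add: distrib_left set_integral_add)
  next
    case (scale p c)
    then have "set_integrable lborel (cube R) (\<lambda>x. c * (h x * p x))" "set_lebesgue_integral lborel (cube R) (\<lambda>x. c * (h x * p x)) = 0"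
      by simp_all
    then show ?case by (simp add: mult_ac)
  qed
  then show "set_integrable lborel (cube R) (\<lambda>x. h x * p x)"
    and "set_lebesgue_integral lborel (cube R) (\<lambda>x. h x * p x) = 0" by auto
qed

text \<open>A nonnegative trigonometric polynomial which on the cube attains its maximum \<open>1\<close> at the
  interior point \<open>z\<close> only. Its powers concentrate at \<open>z\<close>.\<close>

definition peak :: "real \<Rightarrow> real^'n::finite \<Rightarrow> real^'n \<Rightarrow> real" where
  "peak R z x = (\<Sum>i\<in>UNIV. 1 + cos (pi / R * (x $ i - z $ i))) / (2 * real CARD('n))"

lemma trig_polys_peak: "(\<lambda>x. complex_of_real (peak R z x)) \<in> trig_polys R"
proof -
  have eq: "inverse (2 * of_nat CARD('a)) * (\<Sum>i\<in>(UNIV :: 'a set). 1 + complex_of_real (cos (pi / R * (x $ i - z $ i))))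
      = complex_of_real (peak R z x)" for x
  proof -
    have "(\<Sum>i\<in>(UNIV :: 'a set). 1 + complex_of_real (cos (pi / R * (x $ i - z $ i))))
      = complex_of_real (\<Sum>i\<in>(UNIV :: 'a set). 1 + cos (pi / R * (x $ i - z $ i)))"
      by (simp only: of_real_sum of_real_add of_real_1)
    then show ?thesis unfolding peak_def by (simp only: of_real_divide of_real_mult of_real_numeral of_real_of_nat_eq of_real_inverse divide_inverse mult.commute)
  qed
  have "(\<lambda>x. inverse (2 * of_nat CARD('a)) * (\<Sum>i\<in>(UNIV :: 'a set). 1 + complex_of_real (cos (pi / R * (x $ i - z $ i))))) \<in> trig_polys R"
    by (intro trig_polys.scale trig_polys_sum trig_polys.add trig_polys_const trig_polys_cos)
  then show ?thesis unfolding eq .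
qed

lemma peak_nonneg: "0 \<le> peak R z x"
proof -
  have "0 \<le> 1 + cos t" for t :: real using cos_ge_minus_one[of t] by linarith
  then show ?thesis unfolding peak_def by (intro divide_nonneg_nonneg sum_nonneg) simp_all
qed

lemma peak_self: "peak R z z = 1"
  by (simp add: peak_def)

lemma peak_less_1:
  fixes z x :: "real^'n::finite"
  assumes R: "R > 0" and z: "z \<in> open_cube R" and x: "x \<in> cube R" and "x \<noteq> z"
  shows "peak R z x < 1"
proof -
  obtain j where j: "x $ j \<noteq> z $ j" using assms(4) by (auto simp: vec_eq_iff)
  have "\<bar>x $ j\<bar> \<le> R" "\<bar>z $ j\<bar> < R" using x z by (simp_all add: cube_def open_cube_def)
  then have "\<bar>x $ j - z $ j\<bar> < 2 * R" by linarith
  then have "pi / R * \<bar>x $ j - z $ j\<bar> < pi / R * (2 * R)"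
    using R by (intro mult_strict_left_mono) simp_all
  then have "\<bar>pi / R * (x $ j - z $ j)\<bar> < 2 * pi"
    unfolding abs_mult using R by simp
  moreover have "pi / R * (x $ j - z $ j) \<noteq> 0" using j R by simp
  ultimately have "cos (pi / R * (x $ j - z $ j)) \<noteq> 1"
  proof (intro notI)
    assume t: "\<bar>pi / R * (x $ j - z $ j)\<bar> < 2 * pi" "pi / R * (x $ j - z $ j) \<noteq> 0"
      and "cos (pi / R * (x $ j - z $ j)) = 1"
    then obtain n :: int where n: "pi / R * (x $ j - z $ j) = of_int n * 2 * pi"
      unfolding cos_one_2pi_int by blast
    then have "n \<noteq> 0" using t(2) by auto
    then have "1 \<le> \<bar>real_of_int n\<bar>" by linarith
    then have "2 * pi \<le> \<bar>real_of_int n\<bar> * (2 * pi)" using mult_right_mono[of 1 _ "2 * pi"] by simp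
    then show False using t(1) unfolding n by (simp add: abs_mult mult_ac)
  qed
  then have "cos (pi / R * (x $ j - z $ j)) < 1" using cos_le_one[of "pi / R * (x $ j - z $ j)"] by linarith
  then have "(\<Sum>i\<in>(UNIV::'n set). 1 + cos (pi / R * (x $ i - z $ i))) < (\<Sum>i\<in>(UNIV::'n set). 2)"
    by (intro sum_strict_mono_ex1) (auto intro!: bexI[of _ j])
  then show ?thesis by (simp add: peak_def)
qed

lemma continuous_on_peak: "continuous_on A (peak R z)"
  unfolding peak_def by (intro continuous_intros) auto

text \<open>If all coefficients vanish, \<open>h\<close> is orthogonal to all powers of the peak at \<open>z\<close>. Suppose
  \<open>h z \<noteq> 0\<close>, and let \<open>H\<close> be the real part of \<open>h\<close> multiplied by the conjugate of \<open>h z\<close>, so that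
  \<open>H z > 0\<close>. Near \<open>z\<close>, the integral of \<open>H peak\<^sup>N\<close> is at least of the size \<open>\<rho>'\<^sup>N\<close>, while the part
  away from \<open>z\<close> is at most of the size \<open>\<rho>\<^sup>N\<close> with \<open>\<rho> < \<rho>'\<close>; for large \<open>N\<close> they cannot cancel.\<close>

lemma zero_if_all_coefficients_zero:
  fixes h :: "real^'n::finite \<Rightarrow> complex"
  assumes R: "R > 0" and h: "continuous_on (cube R) h"
    and coeffs: "\<And>m. set_lebesgue_integral lborel (cube R) (\<lambda>x. h x * wave (\<chi> i. pi / R * of_int (m i)) x) = 0"
    and z: "z \<in> open_cube R"
  shows "h z = 0"
proof (rule ccontr)
  assume hz: "h z \<noteq> 0"
  define H where "H = (\<lambda>x. Re (cnj (h z) * h x))"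
  define a where "a = (cmod (h z))\<^sup>2"
  have a: "a > 0" "H z = a"
    using hz by (simp add: a_def) (simp add: a_def H_def cmod_power2 power2_eq_square[of "Re _"] power2_eq_square[of "Im _"])
  have Hc: "continuous_on (cube R) H" unfolding H_def by (intro continuous_intros h)
  have zc: "z \<in> cube R" using z open_cube_subset_cube by blast
  obtain M where M: "M > 0" "\<And>x. x \<in> cube R \<Longrightarrow> \<bar>H x\<bar> \<le> M"
  proof -
    have "bounded (H ` cube R)"
      by (intro compact_imp_bounded compact_continuous_image Hc compact_cube)
    then show ?thesis using that unfolding bounded_pos by auto
  qed
  have zero: "(\<integral>x. indicator (cube R) x * (H x * peak R z x ^ N) \<partial>lborel) = 0"
    "integrable lborel (\<lambda>x. indicator (cube R) x * (H x * peak R z x ^ N))" for N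
  proof -
    note t = trig_polys.scale[OF trig_polys_power[OF trig_polys_peak[of R z], of N], of "cnj (h z)"]
    note i = integral_mult_trig_poly_zero[OF h coeffs t]
    have eq: "Re (indicator (cube R) x *\<^sub>R (h x * (cnj (h z) * complex_of_real (peak R z x) ^ N)))
        = indicator (cube R) x * (H x * peak R z x ^ N)" for x
      by (simp add: H_def algebra_simps flip: of_real_power)
    show "integrable lborel (\<lambda>x. indicator (cube R) x * (H x * peak R z x ^ N))"
      using integrable_Re[OF i(1)[unfolded set_integrable_def]] unfolding eq .
    show "(\<integral>x. indicator (cube R) x * (H x * peak R z x ^ N) \<partial>lborel) = 0"
      using i(2) integral_Re[OF i(1)[unfolded set_integrable_def]]
      unfolding set_lebesgue_integral_def eq by simp
  qed
  \<comment> \<open>on the \<open>\<delta>\<close>-ball the integrand is nonnegative, and outside it the peak is at most \<open>\<rho> < 1\<close>\<close>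
  obtain \<delta> where \<delta>: "\<delta> > 0" "ball z \<delta> \<subseteq> cube R" "\<And>x. x \<in> ball z \<delta> \<Longrightarrow> H x \<ge> a / 2"
  proof -
    obtain d1 where d1: "d1 > 0" "ball z d1 \<subseteq> open_cube R"
      using open_open_cube z open_contains_ball by metis
    have sub: "ball z d1 \<subseteq> cube R" using d1(2) open_cube_subset_cube by (rule subset_trans)
    obtain d2 where d2: "d2 > 0" "\<And>x. x \<in> cube R \<Longrightarrow> dist x z < d2 \<Longrightarrow> dist (H x) (H z) < a / 2"
      using Hc zc a(1) unfolding continuous_on_iff by (metis half_gt_zero)
    show ?thesis
    proof (rule that[of "min d1 d2"])
      show "ball z (min d1 d2) \<subseteq> cube R"
        using subset_trans[OF subset_ball sub] by simp
      fix x assume x: "x \<in> ball z (min d1 d2)"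
      then have "x \<in> ball z d1" "dist x z < d2" by (simp_all add: dist_commute)
      then have "x \<in> cube R" "dist x z < d2" using sub by blast+
      then have "\<bar>H x - a\<bar> < a / 2" using d2(2) a(2) by (auto simp: dist_real_def)
      then show "H x \<ge> a / 2" by linarith
    qed (use d1 d2 in auto)
  qed
  obtain \<rho> where \<rho>: "0 < \<rho>" "\<rho> < 1" "\<And>x. x \<in> cube R - ball z \<delta> \<Longrightarrow> peak R z x \<le> \<rho>"
  proof (cases "cube R - ball z \<delta> = {}")
    case True
    show ?thesis
    proof (rule that[of "1/2"])
      fix x assume "x \<in> cube R - ball z \<delta>"
      then show "peak R z x \<le> 1 / 2" using True by blast
    qed simp_all
  next
    case False
    have "compact (cube R - ball z \<delta>)" by (intro compact_diff compact_cube open_ball)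
    then obtain y where y: "y \<in> cube R - ball z \<delta>" "\<And>x. x \<in> cube R - ball z \<delta> \<Longrightarrow> peak R z x \<le> peak R z y"
      using continuous_attains_sup[OF _ False continuous_on_peak] by metis
    have y1: "peak R z y < 1" using y(1) \<delta>(1) by (intro peak_less_1[OF R z]) auto
    show ?thesis
    proof (rule that[of "max (1/2) (peak R z y)"])
      fix x assume "x \<in> cube R - ball z \<delta>"
      then show "peak R z x \<le> max (1/2) (peak R z y)" using y(2) by (intro max.coboundedI2)
    qed (use y1 in simp_all)
  qed
  \<comment> \<open>by continuity the peak exceeds a fixed number between \<open>\<rho>\<close> and \<open>1\<close> on a smaller ball\<close>
  define \<rho>' where "\<rho>' = (1 + \<rho>) / 2"
  have \<rho>': "\<rho> < \<rho>'" "\<rho>' < 1" "0 < \<rho>'" using \<rho> by (auto simp: \<rho>'_def)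
  obtain \<delta>' where \<delta>': "\<delta>' > 0" "\<delta>' \<le> \<delta>" "\<And>x. x \<in> ball z \<delta>' \<Longrightarrow> \<rho>' \<le> peak R z x"
  proof -
    have "isCont (peak R z) z"
      using continuous_on_peak[of UNIV R z] by (simp add: continuous_on_eq_continuous_at)
    then obtain d where d: "d > 0" "\<And>x. dist x z < d \<Longrightarrow> dist (peak R z x) (peak R z z) < 1 - \<rho>'"
      using \<rho>'(2) unfolding continuous_at_eps_delta by (metis diff_gt_0_iff_gt)
    show ?thesis
    proof (rule that[of "min d \<delta>"])
      fix x assume "x \<in> ball z (min d \<delta>)"
      then have "dist x z < d" by (simp add: dist_commute)
      from d(2)[OF this] show "\<rho>' \<le> peak R z x" by (simp add: peak_self dist_real_def)
    qed (use d \<delta> in auto)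
  qed
  define v where "v = measure lborel (ball z \<delta>')"
  define V where "V = measure lborel (cube R :: (real^'n) set)"
  have v: "v > 0" unfolding v_def using \<delta>'(1) by (simp add: content_ball_pos)
  have Vfin: "emeasure lborel (cube R :: (real^'n) set) < \<infinity>" by (rule emeasure_compact_finite[OF compact_cube])
  have Vset: "(cube R :: (real^'n) set) \<in> sets lborel" by (simp add: borel_closed compact_imp_closed compact_cube)
  have vfin: "emeasure lborel (ball z \<delta>') < \<infinity>" by (rule emeasure_bounded_finite) simp
  \<comment> \<open>integrate a step function that minorises \<open>H peak\<^sup>N\<close>\<close>
  have ineq: "a / 2 * \<rho>' ^ N * v \<le> M * \<rho> ^ N * V" for N
  proof -
    have "(\<integral>x. indicator (ball z \<delta>') x * (a / 2 * \<rho>' ^ N) - indicator (cube R) x * (M * \<rho> ^ N) \<partial>lborel)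
        \<le> (\<integral>x. indicator (cube R) x * (H x * peak R z x ^ N) \<partial>lborel)"
    proof (rule integral_mono[OF _ zero(2)])
      show "integrable lborel (\<lambda>x. indicator (ball z \<delta>') x * (a / 2 * \<rho>' ^ N) - indicator (cube R) x * (M * \<rho> ^ N))"
        using Vfin Vset vfin by (intro Bochner_Integration.integrable_diff integrable_mult_left integrable_real_indicator) auto
      fix x
      show "indicator (ball z \<delta>') x * (a / 2 * \<rho>' ^ N) - indicator (cube R) x * (M * \<rho> ^ N)
          \<le> indicator (cube R) x * (H x * peak R z x ^ N)"
      proof (cases "x \<in> cube R")
        case False
        then have "x \<notin> ball z \<delta>'" using \<delta>(2) \<delta>'(2) subset_ball[of \<delta>' \<delta> z] by blast
        then show ?thesis using False by simp
      next
        case True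
        have p0: "0 \<le> peak R z x ^ N" by (simp add: peak_nonneg)
        have Mr: "0 \<le> M * \<rho> ^ N" using M(1) \<rho>(1) by simp
        consider "x \<in> ball z \<delta>'" | "x \<notin> ball z \<delta>'" "x \<in> ball z \<delta>" | "x \<notin> ball z \<delta>'" "x \<notin> ball z \<delta>" by blast
        then show ?thesis
        proof cases
          case 1
          then have "x \<in> ball z \<delta>" using \<delta>'(2) subset_ball[of \<delta>' \<delta> z] by blast
          then have "a / 2 * \<rho>' ^ N \<le> H x * peak R z x ^ N"
            using \<delta>(3)[of x] \<delta>'(3)[OF 1] a(1) \<rho>'(3) by (intro mult_mono power_mono) auto
          then show ?thesis using 1 True Mr by simp
        next
          case 2
          then have "0 \<le> H x * peak R z x ^ N" using \<delta>(3)[of x] a(1) p0 by simp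
          then show ?thesis using 2 True Mr by simp
        next
          case 3
          then have "peak R z x ^ N \<le> \<rho> ^ N" using \<rho>(3)[of x] True by (intro power_mono) (auto simp: peak_nonneg)
          then have "\<bar>H x * peak R z x ^ N\<bar> \<le> M * \<rho> ^ N"
            unfolding abs_mult using M True p0 by (intro mult_mono) auto
          then show ?thesis using 3 True by simp
        qed
      qed
    qed
    also have "\<dots> = 0" by (rule zero)
    also have "(\<integral>x. indicator (ball z \<delta>') x * (a / 2 * \<rho>' ^ N) - indicator (cube R) x * (M * \<rho> ^ N) \<partial>lborel)
        = v * (a / 2 * \<rho>' ^ N) - V * (M * \<rho> ^ N)"
      using Vfin Vset vfin
      by (subst Bochner_Integration.integral_diff) (auto simp: v_def V_def intro!: integrable_mult_left integrable_real_indicator)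
    finally show ?thesis by (simp add: mult_ac)
  qed
  have "(\<lambda>N. M * V * (\<rho> / \<rho>') ^ N) \<longlonglongrightarrow> M * V * 0"
    using \<rho> \<rho>' by (intro tendsto_intros LIMSEQ_power_zero) auto
  moreover have "a / 2 * v \<le> M * V * (\<rho> / \<rho>') ^ N" for N
    using ineq[of N] \<rho>'(3) by (simp add: power_divide field_simps)
  ultimately have "a / 2 * v \<le> M * V * 0"
    by (intro LIMSEQ_le_const) auto
  then show False using a(1) v by (simp add: mult_le_0_iff)
qed

section \<open>Integration by parts\<close>

lemma bounded_of_compact_support:
  fixes h :: "real^'n::finite \<Rightarrow> complex"
  assumes "continuous_on UNIV h" "compact K" "\<And>x. x \<notin> K \<Longrightarrow> h x = 0"
  obtains B where "B > 0" "\<And>x. cmod (h x) \<le> B"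
proof -
  have c: "continuous_on K h" using assms(1) continuous_on_subset by blast
  show ?thesis
  proof (rule that[of "sup_on K h + 1"])
    show "sup_on K h + 1 > 0" using sup_on_nonneg[OF assms(2) c] by simp
    fix x show "cmod (h x) \<le> sup_on K h + 1"
      using le_sup_on[OF assms(2) c, of x] sup_on_nonneg[OF assms(2) c] assms(3)[of x] by (cases "x \<in> K") auto
  qed
qed

lemma integrable_of_compact_support:
  fixes h :: "real^'n::finite \<Rightarrow> complex"
  assumes "continuous_on UNIV h" "compact K" "\<And>x. x \<notin> K \<Longrightarrow> h x = 0"
  shows "integrable lborel h"
proof -
  have "set_integrable lborel UNIV h"
    by (rule compactly_supported_integral(1)[OF assms(2) subset_UNIV assms(1) assms(3)])
  then show ?thesis by (simp add: set_integrable_def)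
qed

text \<open>The difference quotients of \<open>F\<close> have integral zero by translation invariance. They are
  bounded by the supremum of the derivative and supported in one ball, so dominated convergence
  applies.\<close>

lemma integral_pderivative_eq_0:
  fixes F :: "real^'n::finite \<Rightarrow> complex"
  assumes F: "smooth_on UNIV F" and K: "compact K" "\<And>x. x \<notin> K \<Longrightarrow> F x = 0"
  shows "integral\<^sup>L lborel (pderivative i F) = 0"
proof -
  define e where "e = (axis i 1 :: real^'n)"
  define t where "t = (\<lambda>n::nat. inverse (real (Suc n)))"
  have t: "0 < t n" "t n \<le> 1" for n by (auto simp: t_def inverse_le_1_iff)
  have t0: "t \<longlonglongrightarrow> 0" unfolding t_def by (rule LIMSEQ_inverse_real_of_nat)
  have Fc: "continuous_on UNIV F" by (rule smooth_on_continuous[OF F])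
  have pc: "continuous_on UNIV (pderivative i F)" by (rule smooth_on_continuous[OF smooth_on_pderivative[OF F]])
  have p0: "pderivative i F x = 0" if x: "x \<notin> K" for x
  proof -
    have "pderivs [i] F x = 0" by (rule pderivs_zero_off[OF compact_imp_closed[OF K(1)] K(2) x])
    then show ?thesis by simp
  qed
  have vd: "((\<lambda>s. F (x + s *\<^sub>R e)) has_vector_derivative pderivative i F (x + s *\<^sub>R e)) (at s)" for x s
    unfolding e_def by (rule has_vector_derivative_along_axis[OF smooth_on_differentiable[OF F open_UNIV UNIV_I]])
  obtain B where B: "B > 0" "\<And>x. cmod (pderivative i F x) \<le> B"
    using bounded_of_compact_support[OF pc K(1) p0] by metis
  obtain r where r: "r > 0" "\<And>x. x \<in> K \<Longrightarrow> norm x \<le> r"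
    using compact_imp_bounded[OF K(1)] unfolding bounded_pos by metis
  define D where "D = (\<lambda>n x. (F (x + t n *\<^sub>R e) - F x) /\<^sub>R t n)"
  have D_le: "cmod (D n x) \<le> indicator (cball 0 (r + 1)) x * B" for n x
  proof (cases "x \<in> cball 0 (r + 1)")
    case True
    have "\<exists>s\<in>{0<..<t n}. norm (F (x + t n *\<^sub>R e) - F (x + 0 *\<^sub>R e)) \<le> norm ((t n - 0) *\<^sub>R pderivative i F (x + s *\<^sub>R e))"
    proof (rule mvt_general)
      show "0 < t n" by (rule t)
      show "continuous_on {0..t n} (\<lambda>s. F (x + s *\<^sub>R e))"
        using vd has_vector_derivative_continuous by (intro continuous_at_imp_continuous_on) blast
      fix s show "((\<lambda>s. F (x + s *\<^sub>R e)) has_derivative (\<lambda>h. h *\<^sub>R pderivative i F (x + s *\<^sub>R e))) (at s)"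
        using vd[of x s] by (simp add: has_vector_derivative_def)
    qed
    then obtain s where "cmod (F (x + t n *\<^sub>R e) - F x) \<le> t n * cmod (pderivative i F (x + s *\<^sub>R e))"
      using t(1)[of n] by auto
    also have "\<dots> \<le> t n * B" using B(2) t(1)[of n] by (intro mult_left_mono) auto
    finally have "cmod (D n x) \<le> B"
      unfolding D_def norm_scaleR using t(1)[of n] by (simp add: field_simps)
    then show ?thesis using True by simp
  next
    case False
    then have n: "norm x > r + 1" by simp
    have "norm x \<le> norm (x + t n *\<^sub>R e) + norm (t n *\<^sub>R e)"
      using norm_triangle_ineq4[of "x + t n *\<^sub>R e" "t n *\<^sub>R e"] by simp
    moreover have "norm (t n *\<^sub>R e) \<le> 1" using t[of n] by (simp add: e_def)
    ultimately have "norm (x + t n *\<^sub>R e) > r" using n by linarith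
    then have "F (x + t n *\<^sub>R e) = 0" "F x = 0"
      using r(2)[of x] r(2)[of "x + t n *\<^sub>R e"] n K(2) by (force, force)
    then show ?thesis using B(1) by (simp add: D_def)
  qed
  have Fi: "integrable lborel F" by (rule integrable_of_compact_support[OF Fc K])
  have shift: "integrable lborel (\<lambda>x. F (x + a))" "integral\<^sup>L lborel (\<lambda>x. F (x + a)) = integral\<^sup>L lborel F" for a
  proof -
    have m: "(+) a \<in> lborel \<rightarrow>\<^sub>M borel" by simp
    have Fb: "F \<in> borel_measurable borel" using borel_measurable_integrable[OF Fi] by simp
    have "integrable (distr lborel borel ((+) a)) F" using Fi by (simp add: lborel_distr_plus)
    then show "integrable lborel (\<lambda>x. F (x + a))"
      by (simp add: integrable_distr_eq[OF m Fb] add.commute)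
    have "integral\<^sup>L lborel F = integral\<^sup>L (distr lborel borel ((+) a)) F" by (simp add: lborel_distr_plus)
    also have "\<dots> = integral\<^sup>L lborel (\<lambda>x. F (x + a))"
      by (simp add: integral_distr[OF m Fb] add.commute)
    finally show "integral\<^sup>L lborel (\<lambda>x. F (x + a)) = integral\<^sup>L lborel F" by simp
  qed
  have "integral\<^sup>L lborel (D n) = 0" for n
    unfolding D_def using shift[of "t n *\<^sub>R e"] Fi by simp
  moreover have "(\<lambda>n. integral\<^sup>L lborel (D n)) \<longlonglongrightarrow> integral\<^sup>L lborel (pderivative i F)"
  proof (rule integral_dominated_convergence[where w = "\<lambda>x. indicator (cball 0 (r + 1)) x * B"])
    show "pderivative i F \<in> borel_measurable lborel"
      using borel_measurable_continuous_onI[OF pc] by simp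
    show "D n \<in> borel_measurable lborel" for n
      unfolding D_def using shift(1)[of "t n *\<^sub>R e"] Fi by (intro borel_measurable_integrable) simp
    show "integrable lborel (\<lambda>x. indicator (cball 0 (r + 1)) x * B :: real)"
      by (intro integrable_mult_left integrable_real_indicator emeasure_bounded_finite) auto
    show "AE x in lborel. (\<lambda>n. D n x) \<longlonglongrightarrow> pderivative i F x"
    proof (rule AE_I2)
      fix x
      let ?D = "pderivative i F x"
      have "((\<lambda>s. F (x + s *\<^sub>R e)) has_derivative (\<lambda>h. h *\<^sub>R ?D)) (at 0)"
        using vd[of x 0] by (simp add: has_vector_derivative_def)
      then have lim: "((\<lambda>h. norm (F (x + h *\<^sub>R e) - F x - h *\<^sub>R ?D) / norm h) \<longlongrightarrow> 0) (at 0)"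
        unfolding has_derivative_at by simp
      have "filterlim t (at 0) sequentially"
        unfolding filterlim_at using t0 t(1) by (auto intro!: always_eventually simp: less_imp_neq[symmetric])
      from filterlim_compose[OF lim this]
      have "(\<lambda>n. norm (F (x + t n *\<^sub>R e) - F x - t n *\<^sub>R ?D) / norm (t n)) \<longlonglongrightarrow> 0" .
      moreover have "norm (F (x + t n *\<^sub>R e) - F x - t n *\<^sub>R ?D) / norm (t n) = norm (D n x - ?D)" for n
      proof -
        have "D n x - ?D = (F (x + t n *\<^sub>R e) - F x - t n *\<^sub>R ?D) /\<^sub>R t n"
          unfolding D_def scaleR_right_diff_distrib[of "inverse (t n)" "_ - _"] using t(1)[of n] by simp
        then show ?thesis by (simp only: norm_scaleR norm_inverse real_norm_def divide_inverse mult.commute abs_inverse)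
      qed
      ultimately have "(\<lambda>n. norm (D n x - ?D)) \<longlonglongrightarrow> 0" by simp
      then show "(\<lambda>n. D n x) \<longlonglongrightarrow> ?D"
        by (rule LIM_zero_cancel[OF tendsto_norm_zero_cancel])
    qed
    show "AE x in lborel. norm (D n x) \<le> indicator (cball 0 (r + 1)) x * B" for n
      using D_le by simp
  qed
  ultimately show ?thesis by (simp add: LIMSEQ_const_iff)
qed

lemma integral_by_parts:
  fixes f g :: "real^'n::finite \<Rightarrow> complex"
  assumes f: "smooth_on UNIV f" and g: "smooth_on UNIV g" and K: "compact K" "\<And>x. x \<notin> K \<Longrightarrow> f x = 0"
  shows "(\<integral>x. pderivative i f x * g x \<partial>lborel) = - (\<integral>x. f x * pderivative i g x \<partial>lborel)"
proof -
  note c = smooth_on_continuous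
  have p0: "pderivative i f x = 0" if x: "x \<notin> K" for x
  proof -
    have "pderivs [i] f x = 0" by (rule pderivs_zero_off[OF compact_imp_closed[OF K(1)] K(2) x])
    then show ?thesis by simp
  qed
  have i1: "integrable lborel (\<lambda>x. pderivative i f x * g x)"
    by (rule integrable_of_compact_support[OF continuous_on_mult[OF c[OF smooth_on_pderivative[OF f]] c[OF g]] K(1)])
       (simp add: p0)
  have i2: "integrable lborel (\<lambda>x. f x * pderivative i g x)"
    by (rule integrable_of_compact_support[OF continuous_on_mult[OF c[OF f] c[OF smooth_on_pderivative[OF g]]] K(1)])
       (simp add: K(2))
  have "pderivative i (\<lambda>x. f x * g x) = (\<lambda>x. pderivative i f x * g x + f x * pderivative i g x)"
    using smooth_on_differentiable[OF f open_UNIV UNIV_I] smooth_on_differentiable[OF g open_UNIV UNIV_I]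
    by (intro ext pderivative_mult)
  moreover have "integral\<^sup>L lborel (pderivative i (\<lambda>x. f x * g x)) = 0"
    by (rule integral_pderivative_eq_0[OF smooth_on_mult[OF open_UNIV f g] K(1)]) (simp add: K(2))
  ultimately have "(\<integral>x. pderivative i f x * g x + f x * pderivative i g x \<partial>lborel) = 0" by simp
  then show ?thesis using i1 i2 by (simp add: add_eq_0_iff)
qed

lemma integral_pderivs_mult_wave:
  fixes f :: "real^'n::finite \<Rightarrow> complex"
  assumes f: "smooth_on UNIV f" and K: "compact K" "\<And>x. x \<notin> K \<Longrightarrow> f x = 0"
  shows "(\<integral>x. pderivs is f x * wave \<xi> x \<partial>lborel)
    = (\<Prod>i\<leftarrow>is. - (\<i> * of_real (\<xi> $ i))) * (\<integral>x. f x * wave \<xi> x \<partial>lborel)"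
proof (induction "is")
  case (Cons i "is")
  have "(\<integral>x. pderivs (i # is) f x * wave \<xi> x \<partial>lborel) = - (\<integral>x. pderivs is f x * pderivative i (wave \<xi>) x \<partial>lborel)"
    using integral_by_parts[OF smooth_on_pderivs[OF f] smooth_on_wave[OF open_UNIV] K(1)]
      pderivs_zero_off[OF compact_imp_closed[OF K(1)] K(2)] by simp
  also have "\<dots> = - (\<integral>x. \<i> * of_real (\<xi> $ i) * (pderivs is f x * wave \<xi> x) \<partial>lborel)"
    by (simp add: pderivative_wave mult_ac)
  also have "\<dots> = - (\<i> * of_real (\<xi> $ i)) * (\<integral>x. pderivs is f x * wave \<xi> x \<partial>lborel)" by simp
  finally show ?case using Cons by (simp add: mult_ac)
qed simp

section \<open>Half-integer frequencies and decay of Fourier coefficients\<close>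

text \<open>The shift by \<open>1/2\<close> keeps every coordinate away from \<open>0\<close> (\<open>freq_lower_bound\<close>), so that
  dividing by powers of the frequencies is always possible. It amounts to Fourier series of
  functions that change sign under translation by \<open>2 R\<close>; for functions supported inside the cube
  this makes no difference.\<close>

definition freq :: "real \<Rightarrow> ('n::finite \<Rightarrow> int) \<Rightarrow> real^'n" where
  "freq R k = (\<chi> i. pi / R * (of_int (k i) + 1 / 2))"

definition fourier_coeff :: "real \<Rightarrow> (real^'n::finite \<Rightarrow> complex) \<Rightarrow> ('n \<Rightarrow> int) \<Rightarrow> complex" where
  "fourier_coeff R f k = set_lebesgue_integral lborel (cube R) (\<lambda>x. f x * wave (- freq R k) x) / of_real ((2 * R) ^ CARD('n))"

lemma freq_lower_bound: "R > 0 \<Longrightarrow> pi / (2 * R) \<le> \<bar>freq R k $ i\<bar>"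
proof -
  assume R: "R > 0"
  have "1 / 2 \<le> \<bar>real_of_int (k i) + 1 / 2\<bar>"
  proof (cases "k i \<ge> 0")
    case False
    then have "real_of_int (k i) \<le> -1" by linarith
    then show ?thesis by linarith
  qed simp
  then have "pi / R * (1 / 2) \<le> pi / R * \<bar>real_of_int (k i) + 1 / 2\<bar>"
    using R by (intro mult_left_mono) auto
  then show ?thesis using R by (simp add: freq_def abs_mult)
qed

lemma freq_nonzero:
  assumes "R > 0" shows "freq R k $ i \<noteq> 0"
proof -
  have "0 < pi / (2 * R)" using assms by simp
  then show ?thesis using freq_lower_bound[OF assms, of k i] by linarith
qed

lemma set_integral_of_supported:
  fixes h :: "real^'n::finite \<Rightarrow> complex"
  assumes "\<And>x. x \<notin> K \<Longrightarrow> h x = 0" "K \<subseteq> Q"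
  shows "set_lebesgue_integral lborel Q h = integral\<^sup>L lborel h"
proof -
  have "indicator Q x *\<^sub>R h x = h x" for x
    using assms by (cases "x \<in> K") (auto simp: indicator_def)
  then show ?thesis by (simp add: set_lebesgue_integral_def)
qed

lemma fourier_coeff_pderivs:
  assumes f: "smooth_on UNIV f" and K: "compact K" "\<And>x. x \<notin> K \<Longrightarrow> f x = 0" "K \<subseteq> open_cube R"
  shows "fourier_coeff R (pderivs is f) k = (\<Prod>i\<leftarrow>is. \<i> * of_real (freq R k $ i)) * fourier_coeff R f k"
proof -
  have z: "pderivs is f x = 0" if "x \<notin> K" for x
    by (rule pderivs_zero_off[OF compact_imp_closed[OF K(1)] K(2) that])
  have 1: "set_lebesgue_integral lborel (cube R) (\<lambda>x. pderivs is f x * wave (- freq R k) x)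
      = (\<integral>x. pderivs is f x * wave (- freq R k) x \<partial>lborel)"
    by (rule set_integral_of_supported[OF _ subset_trans[OF K(3) open_cube_subset_cube]]) (simp add: z)
  have 2: "set_lebesgue_integral lborel (cube R) (\<lambda>x. f x * wave (- freq R k) x)
      = (\<integral>x. f x * wave (- freq R k) x \<partial>lborel)"
    by (rule set_integral_of_supported[OF _ subset_trans[OF K(3) open_cube_subset_cube]]) (simp add: K(2))
  have 3: "(\<integral>x. pderivs is f x * wave (- freq R k) x \<partial>lborel)
      = (\<Prod>i\<leftarrow>is. \<i> * of_real (freq R k $ i)) * (\<integral>x. f x * wave (- freq R k) x \<partial>lborel)"
    using integral_pderivs_mult_wave[OF f K(1,2), of "is" "- freq R k"] by simp
  show ?thesis unfolding fourier_coeff_def 1 2 3 by simp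
qed

lemma measure_cube: "R > 0 \<Longrightarrow> measure lborel (cube R :: (real^'n::finite) set) = (2 * R) ^ CARD('n)"
proof -
  assume R: "R > 0"
  have "(\<lambda>x::real^'n. wave (\<chi> i. pi / R * of_int 0) x) = (\<lambda>x. 1)"
    by (simp add: zero_vec_def[symmetric])
  then have "set_lebesgue_integral lborel (cube R :: (real^'n) set) (\<lambda>x. 1) = complex_of_real ((2 * R) ^ CARD('n))"
    using integral_wave_cube[OF R, of "\<lambda>_ :: 'n. 0"] by simp
  moreover have "set_lebesgue_integral lborel (cube R :: (real^'n) set) (\<lambda>x. 1)
      = complex_of_real (measure lborel (cube R :: (real^'n) set))"
    using emeasure_compact_finite[OF compact_cube[of R]]
    by (simp add: set_lebesgue_integral_def scaleR_conv_of_real compact_imp_closed borel_closed compact_cube)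
  ultimately show ?thesis by (metis of_real_eq_iff)
qed

lemma fourier_coeff_bound:
  fixes f :: "real^'n::finite \<Rightarrow> complex"
  assumes R: "R > 0" and f: "continuous_on (cube R) f" "\<And>x. x \<in> cube R \<Longrightarrow> cmod (f x) \<le> A"
  shows "cmod (fourier_coeff R f k) \<le> A"
proof -
  have "cmod (set_lebesgue_integral lborel (cube R) (\<lambda>x. f x * wave (- freq R k) x)) \<le> A * measure lborel (cube R :: (real^'n) set)"
  proof -
    have i: "integrable lborel (\<lambda>x. indicator (cube R) x *\<^sub>R (f x * wave (- freq R k) x))"
      by (intro borel_integrable_compact compact_cube continuous_intros f)
    have fin: "emeasure lborel (cube R :: (real^'n) set) < \<infinity>" by (rule emeasure_compact_finite[OF compact_cube])
    have s: "(cube R :: (real^'n) set) \<in> sets lborel" by (simp add: borel_closed compact_imp_closed compact_cube)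
    have i': "integrable lborel (\<lambda>x :: real^'n. indicator (cube R) x *\<^sub>R A)"
      using s fin by (intro integrable_scaleR_left integrable_real_indicator)
    have "cmod (\<integral>x. indicator (cube R) x *\<^sub>R (f x * wave (- freq R k) x) \<partial>lborel)
        \<le> integral\<^sup>L lborel (\<lambda>x :: real^'n. indicator (cube R) x *\<^sub>R A)"
      using f(2) by (intro Bochner_Integration.integral_norm_bound_integral i i') (auto simp: indicator_def norm_mult)
    also have "\<dots> = A * measure lborel (cube R :: (real^'n) set)" using s fin by simp
    finally show ?thesis by (simp add: set_lebesgue_integral_def)
  qed
  then show ?thesis
    unfolding fourier_coeff_def measure_cube[OF R] using R
    by (simp add: norm_divide norm_power norm_mult divide_le_eq)
qed

text \<open>A summable majorant over all frequencies: \<open>\<Prod>\<^sub>i \<xi>\<^sub>i\<^bsup>-2\<^esup>\<close>.\<close>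

definition freq_weight :: "real \<Rightarrow> ('n::finite \<Rightarrow> int) \<Rightarrow> real" where
  "freq_weight R k = (\<Prod>i\<in>UNIV. inverse ((freq R k $ i)\<^sup>2))"

lemma freq_weight_nonneg: "0 \<le> freq_weight R k"
  by (simp add: freq_weight_def prod_nonneg)

lemma sum_inverse_half_integers_bounded:
  obtains P where "\<And>A :: int set. finite A \<Longrightarrow> (\<Sum>j\<in>A. inverse ((of_int j + 1 / 2)\<^sup>2)) \<le> (P :: real)"
proof -
  define a where "a = (\<lambda>n::nat. inverse ((real n + 1 / 2)\<^sup>2))"
  have "summable (\<lambda>n. inverse (real (Suc n) ^ 2))"
    using inverse_power_summable[of 2, where 'a = real] summable_Suc_iff[of "\<lambda>n. inverse (real n ^ 2)"] by simp
  then have s4: "summable (\<lambda>n. 4 * inverse (real (Suc n) ^ 2))" by (rule summable_mult)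
  have a: "summable a"
  proof (rule summable_comparison_test'[OF s4])
    fix n :: nat
    have "(real (Suc n) / 2)\<^sup>2 \<le> (real n + 1 / 2)\<^sup>2" by (intro power_mono) auto
    then have "inverse ((real n + 1 / 2)\<^sup>2) \<le> inverse ((real (Suc n) / 2)\<^sup>2)"
      by (intro le_imp_inverse_le) auto
    then show "norm (a n) \<le> 4 * inverse (real (Suc n) ^ 2)"
      by (simp add: a_def power_divide inverse_eq_divide)
  qed
  have an: "0 \<le> a n" for n by (simp add: a_def)
  have part: "(\<Sum>j\<in>B. inverse ((of_int j + 1 / 2)\<^sup>2)) \<le> suminf a"
    if "finite B" "inj_on h B" "\<And>j. j \<in> B \<Longrightarrow> inverse ((of_int j + 1 / 2)\<^sup>2) = a (h j)" for B :: "int set" and h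
  proof -
    have "(\<Sum>j\<in>B. inverse ((of_int j + 1 / 2)\<^sup>2)) = (\<Sum>j\<in>B. a (h j))" using that(3) by (rule sum.cong[OF refl])
    also have "\<dots> = sum a (h ` B)" by (simp add: sum.reindex[OF that(2)])
    also have "\<dots> \<le> suminf a" using a an that(1) by (intro sum_le_suminf) auto
    finally show ?thesis .
  qed
  show ?thesis
  proof (rule that[of "suminf a + suminf a"])
    fix A :: "int set" assume A: "finite A"
    have "(\<Sum>j\<in>A. inverse ((of_int j + 1 / 2)\<^sup>2))
      = (\<Sum>j\<in>A \<inter> {0..}. inverse ((of_int j + 1 / 2)\<^sup>2)) + (\<Sum>j\<in>A \<inter> {..<0}. inverse ((real_of_int j + 1 / 2)\<^sup>2))"
      using A by (subst sum.union_disjoint[symmetric]) (auto intro!: sum.cong)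
    also have "\<dots> \<le> suminf a + suminf a"
    proof (rule add_mono)
      show "(\<Sum>j\<in>A \<inter> {0..}. inverse ((real_of_int j + 1 / 2)\<^sup>2)) \<le> suminf a"
        by (rule part[where h = nat]) (use A in \<open>auto simp: a_def inj_on_def\<close>)
      show "(\<Sum>j\<in>A \<inter> {..<0}. inverse ((real_of_int j + 1 / 2)\<^sup>2)) \<le> suminf a"
      proof (rule part[where h = "\<lambda>j. nat (- j - 1)"])
        fix j :: int assume "j \<in> A \<inter> {..<0}"
        then have "real (nat (- j - 1)) + 1 / 2 = - (real_of_int j + 1 / 2)" by simp
        then show "inverse ((real_of_int j + 1 / 2)\<^sup>2) = a (nat (- j - 1))"
          by (simp only: a_def power2_minus)
      qed (use A in \<open>auto simp: inj_on_def\<close>)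
    qed
    finally show "(\<Sum>j\<in>A. inverse ((of_int j + 1 / 2)\<^sup>2)) \<le> suminf a + suminf a" .
  qed
qed

text \<open>A finite set of frequencies lies in a product \<open>A \<times> \<dots> \<times> A\<close>, over which the sum of products
  is the power of a one-dimensional sum.\<close>

lemma sum_freq_weight_bounded:
  assumes R: "R > 0"
  obtains W where "\<And>F :: ('n::finite \<Rightarrow> int) set. finite F \<Longrightarrow> sum (freq_weight R) F \<le> W"
proof -
  obtain P where P: "\<And>A :: int set. finite A \<Longrightarrow> (\<Sum>j\<in>A. inverse ((of_int j + 1 / 2)\<^sup>2)) \<le> (P :: real)"
    using sum_inverse_half_integers_bounded by metis
  define c where "c = inverse ((pi / R)\<^sup>2)"
  define \<psi> where "\<psi> = (\<lambda>j :: int. c * inverse ((of_int j + 1 / 2 :: real)\<^sup>2))"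
  have c: "c \<ge> 0" by (simp add: c_def)
  have w: "freq_weight R k = (\<Prod>i\<in>UNIV. \<psi> (k i))" for k :: "'n \<Rightarrow> int"
    by (simp only: freq_weight_def freq_def \<psi>_def c_def power_mult_distrib inverse_mult_distrib vec_lambda_beta)
  show ?thesis
  proof (rule that[of "(c * P) ^ CARD('n)"])
    fix F :: "('n \<Rightarrow> int) set" assume F: "finite F"
    define A where "A = (\<Union>k\<in>F. range k)"
    have A: "finite A" using F by (auto simp: A_def)
    have "sum (freq_weight R) F \<le> sum (freq_weight R) (PiE (UNIV :: 'n set) (\<lambda>_. A))"
      using A by (intro sum_mono2) (auto simp: A_def freq_weight_nonneg intro!: finite_PiE)
    also have "\<dots> = (\<Prod>i\<in>(UNIV :: 'n set). \<Sum>j\<in>A. \<psi> j)"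
      unfolding w using A by (subst prod_sum_PiE) auto
    also have "\<dots> \<le> (\<Prod>i\<in>(UNIV :: 'n set). c * P)"
    proof (rule prod_mono)
      have "(\<Sum>j\<in>A. \<psi> j) = c * (\<Sum>j\<in>A. inverse ((of_int j + 1 / 2)\<^sup>2))"
        by (simp add: \<psi>_def sum_distrib_left)
      also have "\<dots> \<le> c * P" by (intro mult_left_mono P A c)
      finally show "0 \<le> (\<Sum>j\<in>A. \<psi> j) \<and> (\<Sum>j\<in>A. \<psi> j) \<le> c * P"
        by (simp add: \<psi>_def c sum_nonneg)
    qed
    finally show "sum (freq_weight R) F \<le> (c * P) ^ CARD('n)" by simp
  qed
qed

lemma prod_list_mindex_list:
  fixes x :: "'n::finite \<Rightarrow> 'b::comm_monoid_mult"
  shows "(\<Prod>i\<leftarrow>mindex_list \<alpha>. x i) = (\<Prod>i\<in>UNIV. x i ^ \<alpha> i)"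
proof -
  have r: "(\<Prod>i\<leftarrow>replicate n j. x i) = x j ^ n" for n j by (induction n) auto
  have "(\<Prod>i\<leftarrow>concat (map (\<lambda>i. replicate (\<alpha> i) i) is). x i) = (\<Prod>i\<in>set is. x i ^ \<alpha> i)" if "distinct is" for "is"
    using that by (induction "is") (simp_all add: r)
  then show ?thesis unfolding mindex_list_def using coordinates_distinct[where 'n = 'n] by simp
qed

text \<open>A quantity at least \<open>1\<close> that dominates every coordinate, and whose factors match those of
  \<^const>\<open>freq_weight\<close>; a Euclidean norm would not factor.\<close>

definition freq_size :: "real \<Rightarrow> ('n::finite \<Rightarrow> int) \<Rightarrow> real" where
  "freq_size R k = (\<Prod>i\<in>UNIV. 1 + \<bar>freq R k $ i\<bar>)"

lemma freq_size_ge_1: "1 \<le> freq_size R k"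
  unfolding freq_size_def by (rule prod_ge_1) simp

lemma abs_freq_le_size: "\<bar>freq R k $ i\<bar> \<le> freq_size R k"
proof -
  have "(\<Prod>j\<in>UNIV - {i}. 1 + \<bar>freq R k $ j\<bar>) \<ge> 1" by (rule prod_ge_1) simp
  then have "(1 + \<bar>freq R k $ i\<bar>) * 1 \<le> (1 + \<bar>freq R k $ i\<bar>) * (\<Prod>j\<in>UNIV - {i}. 1 + \<bar>freq R k $ j\<bar>)"
    by (intro mult_left_mono) auto
  also have "\<dots> = freq_size R k" unfolding freq_size_def by (rule prod.remove[symmetric]) auto
  finally show ?thesis by simp
qed

lemma norm_pderivs_wave_le:
  assumes "length is \<le> j"
  shows "cmod (pderivs is (wave (freq R k)) x) \<le> freq_size R k ^ j"
proof -
  have "cmod (\<Prod>i\<leftarrow>is. \<i> * of_real (freq R k $ i)) \<le> freq_size R k ^ length is"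
  proof (induction "is")
    case (Cons i "is")
    then show ?case
      using mult_mono[OF abs_freq_le_size[of R k i] Cons] order_trans[OF zero_le_one freq_size_ge_1[of R k]]
      by (simp add: norm_mult)
  qed simp
  also have "\<dots> \<le> freq_size R k ^ j" using assms freq_size_ge_1 by (rule power_increasing)
  finally show ?thesis by (simp add: pderivs_wave norm_mult)
qed

text \<open>The exponent \<open>j + 2\<close>: \<open>j\<close> powers of every coordinate compensate the \<open>j\<close>-th power of the
  size, and two remain for summability. As no coordinate is smaller than \<open>\<pi> / (2 R)\<close>, the factor
  \<open>1 + |\<xi>\<^sub>i|\<close> is comparable to \<open>|\<xi>\<^sub>i|\<close>.\<close>

lemma freq_size_weight:
  fixes k :: "'n::finite \<Rightarrow> int"
  assumes R: "R > 0"
  shows "freq_size R k ^ j / (\<Prod>i\<in>UNIV. \<bar>freq R k $ i\<bar> ^ (j + 2)) \<le> (1 + 2 * R / pi) ^ (j * CARD('n)) * freq_weight R k"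
proof -
  define B where "B = 1 + 2 * R / pi"
  have B0: "B \<ge> 0" using R by (simp add: B_def)
  have le: "(1 + \<bar>freq R k $ i\<bar>) \<le> B * \<bar>freq R k $ i\<bar>" for i
  proof -
    have "(2 * R / pi) * (pi / (2 * R)) \<le> (2 * R / pi) * \<bar>freq R k $ i\<bar>"
      using freq_lower_bound[OF R, of k i] R by (intro mult_left_mono) auto
    then show ?thesis using R by (simp add: B_def algebra_simps)
  qed
  have "freq_size R k ^ j / (\<Prod>i\<in>UNIV. \<bar>freq R k $ i\<bar> ^ (j + 2))
      = (\<Prod>i\<in>UNIV. (1 + \<bar>freq R k $ i\<bar>) ^ j / \<bar>freq R k $ i\<bar> ^ (j + 2))"
    by (simp add: freq_size_def prod_dividef prod_power_distrib)
  also have "\<dots> \<le> (\<Prod>i\<in>UNIV. B ^ j * inverse ((freq R k $ i)\<^sup>2))"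
  proof (rule prod_mono)
    fix i
    have nz: "\<bar>freq R k $ i\<bar> > 0" using freq_nonzero[OF R, of k i] by simp
    have "(1 + \<bar>freq R k $ i\<bar>) ^ j \<le> (B * \<bar>freq R k $ i\<bar>) ^ j" by (rule power_mono[OF le]) simp
    then have "(1 + \<bar>freq R k $ i\<bar>) ^ j / \<bar>freq R k $ i\<bar> ^ (j + 2) \<le> (B * \<bar>freq R k $ i\<bar>) ^ j / \<bar>freq R k $ i\<bar> ^ (j + 2)"
      by (intro divide_right_mono) auto
    also have "\<dots> = B ^ j * inverse ((freq R k $ i)\<^sup>2)"
    proof -
      have "\<bar>freq R k $ i\<bar> ^ (j + 2) = \<bar>freq R k $ i\<bar> ^ j * (freq R k $ i)\<^sup>2"
        by (simp only: power_add power2_abs)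
      moreover have "\<bar>freq R k $ i\<bar> ^ j \<noteq> 0" using nz by simp
      ultimately show ?thesis by (simp only: power_mult_distrib divide_inverse inverse_mult_distrib) (simp add: mult_ac)
    qed
    finally show "0 \<le> (1 + \<bar>freq R k $ i\<bar>) ^ j / \<bar>freq R k $ i\<bar> ^ (j + 2) \<and>
      (1 + \<bar>freq R k $ i\<bar>) ^ j / \<bar>freq R k $ i\<bar> ^ (j + 2) \<le> B ^ j * inverse ((freq R k $ i)\<^sup>2)" by simp
  qed
  also have "\<dots> = B ^ (j * CARD('n)) * freq_weight R k"
    by (simp add: freq_weight_def prod.distrib power_mult)
  finally show ?thesis by (simp add: B_def)
qed

text \<open>The coefficients of \<open>\<partial>\<^sup>\<alpha> f\<close>, \<open>\<alpha> = (j+2,\<dots>,j+2)\<close>, are bounded and equal \<open>(i \<xi>\<^sub>k)\<^sup>\<alpha> c\<^sub>k\<close>.\<close>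

lemma fourier_coeff_decay:
  fixes f :: "real^'n::finite \<Rightarrow> complex"
  assumes R: "R > 0" and f: "smooth_on UNIV f" and K: "compact K" "\<And>x. x \<notin> K \<Longrightarrow> f x = 0" "K \<subseteq> open_cube R"
  obtains A where "A > 0" "\<And>k. cmod (fourier_coeff R f k) * freq_size R k ^ j \<le> A * freq_weight R k"
proof -
  let ?is = "mindex_list (\<lambda>_ :: 'n. j + 2)"
  have c: "continuous_on UNIV (pderivs ?is f)" by (rule smooth_on_continuous[OF smooth_on_pderivs[OF f]])
  obtain B where B: "B > 0" "\<And>x. cmod (pderivs ?is f x) \<le> B"
    using bounded_of_compact_support[OF c K(1) pderivs_zero_off[OF compact_imp_closed[OF K(1)] K(2)]] by metis
  define A where "A = B * (1 + 2 * R / pi) ^ (j * CARD('n))"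
  show ?thesis
  proof (rule that[of A])
    show "A > 0" using B(1) R by (simp add: A_def add_pos_pos)
    fix k :: "'n \<Rightarrow> int"
    let ?p = "\<Prod>i\<in>UNIV. \<bar>freq R k $ i\<bar> ^ (j + 2)"
    have p: "?p > 0" using freq_nonzero[OF R, of k] by (intro prod_pos) simp
    have "cmod (fourier_coeff R (pderivs ?is f) k) \<le> B"
      using B(2) continuous_on_subset[OF c] by (intro fourier_coeff_bound[OF R]) auto
    moreover have eq: "cmod (\<Prod>i\<in>UNIV. (\<i> * of_real (freq R k $ i)) ^ (j + 2)) = ?p"
      by (simp add: norm_mult norm_power prod_norm[symmetric])
    moreover have "cmod (fourier_coeff R (pderivs ?is f) k) = ?p * cmod (fourier_coeff R f k)"
    proof -
      have "fourier_coeff R (pderivs ?is f) k = (\<Prod>i\<leftarrow>?is. \<i> * of_real (freq R k $ i)) * fourier_coeff R f k"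
        by (rule fourier_coeff_pderivs[OF f K])
      then show ?thesis unfolding eq[symmetric] prod_list_mindex_list by (simp only: norm_mult)
    qed
    ultimately have "?p * cmod (fourier_coeff R f k) \<le> B" by linarith
    then have "cmod (fourier_coeff R f k) \<le> B / ?p" using p by (simp add: field_simps)
    then have "cmod (fourier_coeff R f k) * freq_size R k ^ j \<le> B / ?p * freq_size R k ^ j"
      using freq_size_ge_1[of R k] by (intro mult_right_mono) auto
    also have "\<dots> = B * (freq_size R k ^ j / ?p)" by simp
    also have "\<dots> \<le> B * ((1 + 2 * R / pi) ^ (j * CARD('n)) * freq_weight R k)"
      using B(1) by (intro mult_left_mono freq_size_weight[OF R]) auto
    finally show "cmod (fourier_coeff R f k) * freq_size R k ^ j \<le> A * freq_weight R k"
      by (simp add: A_def)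
  qed
qed

section \<open>Fourier inversion\<close>

text \<open>Frequencies are enumerated by natural numbers, so that series over them are ordinary
  series; their convergence is absolute and the enumeration is immaterial.\<close>

definition freq_enum :: "nat \<Rightarrow> 'n::finite \<Rightarrow> int" where
  "freq_enum = from_nat_into UNIV"

lemma bij_freq_enum: "bij (freq_enum :: nat \<Rightarrow> 'n::finite \<Rightarrow> int)"
proof -
  have "inj (\<lambda>(j :: int) (i :: 'n). j)" by (rule injI) (metis)
  then have "infinite (UNIV :: ('n \<Rightarrow> int) set)"
    using infinite_UNIV_int finite_imageD[of "\<lambda>(j :: int) (i :: 'n). j" UNIV] finite_subset[OF subset_UNIV] by blast
  then show ?thesis unfolding freq_enum_def by (intro bij_betw_from_nat_into) auto
qed

lemma summable_freq_weight:
  assumes R: "R > 0"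
  shows "summable (\<lambda>n. freq_weight R (freq_enum n :: 'n::finite \<Rightarrow> int))"
proof -
  obtain W where W: "\<And>F :: ('n \<Rightarrow> int) set. finite F \<Longrightarrow> sum (freq_weight R) F \<le> W"
    using sum_freq_weight_bounded[OF R] by metis
  show ?thesis
  proof (rule summableI_nonneg_bounded)
    show "0 \<le> freq_weight R (freq_enum n :: 'n \<Rightarrow> int)" for n by (rule freq_weight_nonneg)
    fix N
    have "inj_on (freq_enum :: nat \<Rightarrow> 'n \<Rightarrow> int) {..<N}"
      using bij_is_inj[OF bij_freq_enum] inj_on_subset by blast
    then have "(\<Sum>n<N. freq_weight R (freq_enum n :: 'n \<Rightarrow> int)) = sum (freq_weight R) (freq_enum ` {..<N} :: ('n \<Rightarrow> int) set)"
      by (simp add: sum.reindex)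
    also have "\<dots> \<le> W" by (intro W) auto
    finally show "(\<Sum>n<N. freq_weight R (freq_enum n :: 'n \<Rightarrow> int)) \<le> W" .
  qed
qed

lemma integral_wave_orthogonal:
  fixes k l :: "'n::finite \<Rightarrow> int"
  assumes R: "R > 0"
  shows "set_lebesgue_integral lborel (cube R) (\<lambda>x. wave (freq R k) x * wave (- freq R l) x)
    = (if k = l then complex_of_real ((2 * R) ^ CARD('n)) else 0)"
proof -
  have "freq R k + - freq R l = (\<chi> i. pi / R * of_int (k i - l i))"
    by (simp add: vec_eq_iff freq_def algebra_simps)
  then have "(\<lambda>x. wave (freq R k) x * wave (- freq R l) x) = wave (\<chi> i. pi / R * of_int (k i - l i))"
    by (intro ext) (metis wave_add)
  moreover have "(\<lambda>i. k i - l i) = (\<lambda>_. 0) \<longleftrightarrow> k = l" by (auto simp: fun_eq_iff)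
  ultimately show ?thesis using integral_wave_cube[OF R, of "\<lambda>i. k i - l i"] by simp
qed

lemma continuous_on_suminf_weierstrass:
  fixes F :: "nat \<Rightarrow> 'a::topological_space \<Rightarrow> complex"
  assumes "\<And>n. continuous_on A (F n)" "\<And>n x. x \<in> A \<Longrightarrow> norm (F n x) \<le> M n" "summable M"
  shows "continuous_on A (\<lambda>x. \<Sum>n. F n x)"
proof (rule uniform_limit_theorem)
  show "uniform_limit A (\<lambda>N x. \<Sum>n<N. F n x) (\<lambda>x. \<Sum>n. F n x) sequentially"
    by (rule Weierstrass_m_test[OF assms(2,3)])
  show "\<forall>\<^sub>F N in sequentially. continuous_on A (\<lambda>x. \<Sum>n<N. F n x)"
    by (intro always_eventually allI continuous_on_sum assms(1))
qed simp

lemma norm_sums_remainder_le: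
  fixes a :: "nat \<Rightarrow> complex"
  assumes "a sums s" "\<And>n. norm (a n) \<le> b n" "summable b"
  shows "norm (s - (\<Sum>n<N. a n)) \<le> suminf b - (\<Sum>n<N. b n)"
proof -
  have "(\<lambda>n. a (n + N)) sums (s - (\<Sum>n<N. a n))"
    using assms(1) by (rule sums_split_initial_segment)
  moreover have "(\<lambda>n. b (n + N)) sums (suminf b - (\<Sum>n<N. b n))"
    using summable_sums[OF assms(3)] by (rule sums_split_initial_segment)
  ultimately show ?thesis
    using norm_sums_le[of "\<lambda>n. a (n + N)" _ "\<lambda>n. b (n + N)"] assms(2) by blast
qed

text \<open>The Fourier series converges uniformly to a continuous function \<open>G\<close> which, by
  orthogonality, has the same coefficients as \<open>f\<close>. The function \<open>f - G\<close> is orthogonal to all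
  shifted waves; multiplying it by the single wave that undoes the half-integer shift gives a
  function orthogonal to all periodic waves, which therefore vanishes.\<close>

lemma fourier_inversion_value:
  fixes f :: "real^'n::finite \<Rightarrow> complex"
  assumes R: "R > 0" and f: "smooth_on UNIV f" and K: "compact K" "\<And>x. x \<notin> K \<Longrightarrow> f x = 0" "K \<subseteq> open_cube R"
    and z: "z \<in> open_cube R"
  shows "(\<lambda>n. fourier_coeff R f (freq_enum n) * wave (freq R (freq_enum n)) z) sums f z"
proof -
  define c where "c = (\<lambda>n. fourier_coeff R f (freq_enum n))"
  define e where "e = (\<lambda>n. wave (freq R (freq_enum n :: 'n \<Rightarrow> int)))"
  define w where "w = (\<lambda>n. freq_weight R (freq_enum n :: 'n \<Rightarrow> int))"
  define M where "M = complex_of_real ((2 * R) ^ CARD('n))"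
  have M0: "M \<noteq> 0" using R by (simp add: M_def)
  obtain A where A: "A > 0" "\<And>k. cmod (fourier_coeff R f k) * freq_size R k ^ 0 \<le> A * freq_weight R k"
    using fourier_coeff_decay[OF R f K, of 0] by metis
  have c: "cmod (c n) \<le> A * w n" for n using A(2)[of "freq_enum n"] by (simp add: c_def w_def)
  have wsum: "summable (\<lambda>n. A * w n)" unfolding w_def by (intro summable_mult summable_freq_weight R)
  have ce: "cmod (c n * e n x) \<le> A * w n" for n x using c by (simp add: norm_mult e_def)
  define G where "G = (\<lambda>x. \<Sum>n. c n * e n x)"
  have Gsums: "(\<lambda>n. c n * e n x) sums G x" for x
    unfolding G_def by (intro summable_sums summable_comparison_test'[OF wsum, of 0] ce)
  have Gc: "continuous_on UNIV G"
    unfolding G_def by (rule continuous_on_suminf_weierstrass[OF _ ce wsum]) (auto simp: e_def intro!: continuous_intros)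
  have fc: "continuous_on UNIV f" by (rule smooth_on_continuous[OF f])
  have Gint: "set_lebesgue_integral lborel (cube R) (\<lambda>x. G x * wave (- freq R k) x) = fourier_coeff R f k * M" for k
  proof -
    define h where "h = (\<lambda>n x. indicator (cube R) x *\<^sub>R (c n * e n x * wave (- freq R k) x))"
    have hi: "integrable lborel (h n)" for n
      unfolding h_def e_def by (intro borel_integrable_compact compact_cube continuous_intros)
    have hn: "norm (h n x) \<le> A * w n" for n x
      using c[of n] order_trans[OF norm_ge_zero c[of n]]
      by (simp add: h_def e_def norm_mult indicator_def)
    have hs: "(\<lambda>n. h n x) sums (indicator (cube R) x *\<^sub>R (G x * wave (- freq R k) x))" for x
      unfolding h_def by (intro sums_scaleR_right sums_mult2 Gsums)
    have fin: "emeasure lborel (cube R :: (real^'n) set) < \<infinity>" by (rule emeasure_compact_finite[OF compact_cube])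
    have s: "(cube R :: (real^'n) set) \<in> sets lborel" by (simp add: borel_closed compact_imp_closed compact_cube)
    have ib: "integrable lborel (\<lambda>x :: real^'n. indicator (cube R) x *\<^sub>R (A * w n))" for n
      using s fin by (intro integrable_scaleR_left integrable_real_indicator)
    have "integral\<^sup>L lborel (\<lambda>x. norm (h n x)) \<le> measure lborel (cube R :: (real^'n) set) * (A * w n)" for n
    proof -
      have "integral\<^sup>L lborel (\<lambda>x. norm (h n x)) \<le> integral\<^sup>L lborel (\<lambda>x :: real^'n. indicator (cube R) x *\<^sub>R (A * w n))"
      proof (rule integral_mono[OF integrable_norm[OF hi] ib])
        fix x show "norm (h n x) \<le> indicator (cube R) x *\<^sub>R (A * w n)"
          using hn[of n x] by (cases "x \<in> cube R") (simp_all add: h_def)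
      qed
      then show ?thesis using s fin by simp
    qed
    then have int_sum: "summable (\<lambda>n. integral\<^sup>L lborel (\<lambda>x. norm (h n x)))"
      by (intro summable_comparison_test'[OF summable_mult[OF wsum, of "measure lborel (cube R :: (real^'n) set)"], of 0])
        (simp add: integral_nonneg_AE)
    have nsum: "AE x in lborel. summable (\<lambda>n. norm (h n x))"
      by (intro AE_I2 summable_comparison_test'[OF wsum, of 0]) (simp add: hn)
    have "(\<lambda>n. integral\<^sup>L lborel (h n)) sums (\<integral>x. (\<Sum>n. h n x) \<partial>lborel)"
      by (rule sums_integral[OF hi nsum int_sum])
    moreover have "(\<Sum>n. h n x) = indicator (cube R) x *\<^sub>R (G x * wave (- freq R k) x)" for x
      using sums_unique[OF hs[of x]] by simp
    ultimately have 1: "(\<lambda>n. integral\<^sup>L lborel (h n)) sums set_lebesgue_integral lborel (cube R) (\<lambda>x. G x * wave (- freq R k) x)"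
      by (simp add: set_lebesgue_integral_def)
    obtain m where m: "freq_enum m = k" using bij_is_surj[OF bij_freq_enum] by (metis surjD)
    have "integral\<^sup>L lborel (h n) = (if n = m then c n * M else 0)" for n
    proof -
      have "integral\<^sup>L lborel (h n) = set_lebesgue_integral lborel (cube R) (\<lambda>x. c n * (wave (freq R (freq_enum n)) x * wave (- freq R k) x))"
        by (simp only: h_def e_def set_lebesgue_integral_def mult.assoc)
      also have "\<dots> = c n * (if freq_enum n = k then M else 0)"
        by (simp only: set_integral_mult_right integral_wave_orthogonal[OF R] M_def)
      also have "\<dots> = (if n = m then c n * M else 0)"
        using bij_is_inj[OF bij_freq_enum] m by (auto dest: injD)
      finally show ?thesis .
    qed
    then have "(\<lambda>n. integral\<^sup>L lborel (h n)) sums (c m * M)"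
      using sums_single[of m "\<lambda>n. c n * M"] by simp
    then show ?thesis using sums_unique2[OF 1] m by (simp add: c_def)
  qed
  \<comment> \<open>the frequency of index \<open>0\<close> is the half-integer shift itself\<close>
  define h where "h = (\<lambda>x. (f x - G x) * wave (- freq R (\<lambda>_. 0)) x)"
  have "h z = 0"
  proof (rule zero_if_all_coefficients_zero[OF R _ _ z])
    show "continuous_on (cube R) h"
      unfolding h_def using continuous_on_subset[OF fc] continuous_on_subset[OF Gc]
      by (intro continuous_intros) auto
    fix m :: "'n \<Rightarrow> int"
    have "- freq R (\<lambda>_. 0) + (\<chi> i. pi / R * of_int (m i)) = - freq R (\<lambda>i. - m i)"
      by (simp add: vec_eq_iff freq_def algebra_simps)
    then have eq: "h x * wave (\<chi> i. pi / R * of_int (m i)) x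
        = f x * wave (- freq R (\<lambda>i. - m i)) x - G x * wave (- freq R (\<lambda>i. - m i)) x" for x
      unfolding h_def mult.assoc wave_add[symmetric] by (simp add: left_diff_distrib)
    have si: "set_integrable lborel (cube R) (\<lambda>x. F x * wave \<xi> x)" if "continuous_on UNIV F" for F \<xi>
      by (intro set_integrable_cube continuous_intros continuous_on_subset[OF that]) auto
    have "set_lebesgue_integral lborel (cube R) (\<lambda>x. f x * wave (- freq R (\<lambda>i. - m i)) x) = fourier_coeff R f (\<lambda>i. - m i) * M"
      using M0 by (simp add: fourier_coeff_def M_def)
    then show "set_lebesgue_integral lborel (cube R) (\<lambda>x. h x * wave (\<chi> i. pi / R * of_int (m i)) x) = 0"
      unfolding eq using set_integral_diff(2)[OF si[OF fc] si[OF Gc]] Gint by simp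
  qed
  moreover have "wave (- freq R (\<lambda>_. 0)) z \<noteq> 0"
    using norm_wave[of "- freq R (\<lambda>_. 0)" z] by force
  ultimately have "f z = G z" by (simp add: h_def)
  then show ?thesis using Gsums[of z] by (simp add: c_def e_def)
qed

text \<open>The coefficients of a derivative of \<open>f\<close> are those of the termwise derivative, so it
  suffices to expand the derivative.\<close>

lemma fourier_inversion:
  fixes f :: "real^'n::finite \<Rightarrow> complex"
  assumes R: "R > 0" and f: "smooth_on UNIV f" and K: "compact K" "\<And>x. x \<notin> K \<Longrightarrow> f x = 0" "K \<subseteq> open_cube R"
    and z: "z \<in> open_cube R"
  shows "(\<lambda>n. fourier_coeff R f (freq_enum n) * pderivs is (wave (freq R (freq_enum n))) z) sums pderivs is f z"
proof -
  have "(\<lambda>n. fourier_coeff R (pderivs is f) (freq_enum n) * wave (freq R (freq_enum n)) z) sums pderivs is f z"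
    by (rule fourier_inversion_value[OF R smooth_on_pderivs[OF f] K(1) pderivs_zero_off[OF compact_imp_closed[OF K(1)] K(2)] K(3) z])
  moreover have "fourier_coeff R (pderivs is f) k * wave (freq R k) z = fourier_coeff R f k * pderivs is (wave (freq R k)) z" for k
  proof -
    have "fourier_coeff R (pderivs is f) k = (\<Prod>i\<leftarrow>is. \<i> * of_real (freq R k $ i)) * fourier_coeff R f k"
      by (rule fourier_coeff_pderivs[OF f K])
    then show ?thesis by (simp only: pderivs_wave mult_ac)
  qed
  ultimately show ?thesis by simp
qed

text \<open>The remainder of the termwise differentiated series is dominated, uniformly in the point
  and in all derivatives up to order \<open>j\<close>, by the remainder of one convergent numerical series.\<close>

lemma fourier_partial_sums_ck_norm:
  fixes f :: "real^'n::finite \<Rightarrow> complex"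
  assumes R: "R > 0" and f: "smooth_on UNIV f" and K: "compact K" "\<And>x. x \<notin> K \<Longrightarrow> f x = 0" "K \<subseteq> open_cube R"
    and K': "K' \<subseteq> open_cube R"
  shows "\<exists>\<rho>. \<rho> \<longlonglongrightarrow> 0 \<and>
    (\<forall>N. ck_norm K' j (\<lambda>x. f x - (\<Sum>n<N. fourier_coeff R f (freq_enum n) * wave (freq R (freq_enum n)) x)) \<le> \<rho> N)"
proof -
  define c where "c = (\<lambda>n. fourier_coeff R f (freq_enum n))"
  define e where "e = (\<lambda>n. wave (freq R (freq_enum n :: 'n \<Rightarrow> int)))"
  define w where "w = (\<lambda>n. freq_weight R (freq_enum n :: 'n \<Rightarrow> int))"
  obtain A where A: "A > 0" "\<And>k. cmod (fourier_coeff R f k) * freq_size R k ^ j \<le> A * freq_weight R k"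
    using fourier_coeff_decay[OF R f K, of j] by metis
  have wsum: "summable (\<lambda>n. A * w n)" unfolding w_def by (intro summable_mult summable_freq_weight R)
  have w0: "0 \<le> A * w n" for n using A(1) by (simp add: w_def freq_weight_nonneg)
  have es: "smooth_on UNIV (\<lambda>x. c n * e n x)" for n
    unfolding e_def by (intro smooth_on_cmult smooth_on_wave open_UNIV)
  show ?thesis
  proof (intro exI conjI allI)
    show "(\<lambda>N. suminf (\<lambda>n. A * w n) - (\<Sum>n<N. A * w n)) \<longlonglongrightarrow> 0"
      using tendsto_diff[OF tendsto_const[of "suminf (\<lambda>n. A * w n)"] summable_LIMSEQ[OF wsum]] by simp
    fix N
    show "ck_norm K' j (\<lambda>x. f x - (\<Sum>n<N. fourier_coeff R f (freq_enum n) * wave (freq R (freq_enum n)) x))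
        \<le> suminf (\<lambda>n. A * w n) - (\<Sum>n<N. A * w n)"
    proof (rule ck_norm_le)
      show "0 \<le> suminf (\<lambda>n. A * w n) - (\<Sum>n<N. A * w n)"
        using sum_le_suminf[OF wsum, of "{..<N}"] w0 by simp
      fix "is" :: "'n list" and x assume "is": "length is \<le> j" and x: "x \<in> K'"
      have sums: "(\<lambda>n. c n * pderivs is (e n) x) sums pderivs is f x"
        unfolding c_def e_def using fourier_inversion[OF R f K] K' x by blast
      have bd: "norm (c n * pderivs is (e n) x) \<le> A * w n" for n
      proof -
        have "norm (c n * pderivs is (e n) x) \<le> cmod (c n) * freq_size R (freq_enum n :: 'n \<Rightarrow> int) ^ j"
          unfolding norm_mult e_def by (intro mult_left_mono norm_pderivs_wave_le "is") auto
        also have "\<dots> \<le> A * w n" using A(2) by (simp add: c_def w_def)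
        finally show ?thesis .
      qed
      have eq: "pderivs is (\<lambda>x. f x - (\<Sum>n<N. c n * e n x)) x = pderivs is f x - (\<Sum>n<N. c n * pderivs is (e n) x)"
      proof -
        have "pderivs is (\<lambda>x. \<Sum>n<N. c n * e n x) x = (\<Sum>n<N. pderivs is (\<lambda>x. c n * e n x) x)"
          by (rule pderivs_sum[OF open_UNIV es UNIV_I])
        also have "\<dots> = (\<Sum>n<N. c n * pderivs is (e n) x)"
          unfolding e_def by (intro sum.cong refl pderivs_cmult[OF open_UNIV smooth_on_wave[OF open_UNIV] UNIV_I])
        finally have sum: "pderivs is (\<lambda>x. \<Sum>n<N. c n * e n x) x = (\<Sum>n<N. c n * pderivs is (e n) x)" .
        have "pderivs is (\<lambda>x. f x - (\<Sum>n<N. c n * e n x)) x = pderivs is f x - pderivs is (\<lambda>x. \<Sum>n<N. c n * e n x) x"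
          by (rule pderivs_diff[OF open_UNIV f smooth_on_sum[OF open_UNIV es] UNIV_I])
        then show ?thesis by (simp only: sum)
      qed
      have "cmod (pderivs is (\<lambda>x. f x - (\<Sum>n<N. c n * e n x)) x) \<le> suminf (\<lambda>n. A * w n) - (\<Sum>n<N. A * w n)"
        unfolding eq by (rule norm_sums_remainder_le[OF sums bd wsum])
      then show "cmod (pderivs is (\<lambda>x. f x - (\<Sum>n<N. fourier_coeff R f (freq_enum n) * wave (freq R (freq_enum n)) x)) x)
        \<le> suminf (\<lambda>n. A * w n) - (\<Sum>n<N. A * w n)"
        by (simp add: c_def e_def)
    qed
  qed
qed

section \<open>Cut-off distributions as derivatives of continuous functions\<close>

lemma linear_functional_onD:
  assumes "linear_functional_on F S"
  shows "f \<in> F \<Longrightarrow> g \<in> F \<Longrightarrow> S (\<lambda>x. f x + g x) = S f + S g"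
    and "f \<in> F \<Longrightarrow> S (\<lambda>x. c * f x) = c * S f"
  using assms unfolding linear_functional_on_def by simp_all

lemma linear_functional_sum:
  fixes N :: nat
  assumes S: "linear_functional_on (test_functions UNIV) S"
    and t: "\<And>n. t n \<in> smooth_supported UNIV K" and K: "compact K"
  shows "S (\<lambda>x. \<Sum>n<N. c n * t n x) = (\<Sum>n<N. c n * S (t n))"
proof -
  have tf: "f \<in> test_functions UNIV" if "f \<in> smooth_supported UNIV K" for f
    using that K by (auto simp: test_functions_def)
  have sm: "(\<lambda>x. \<Sum>n<N. c n * t n x) \<in> smooth_supported UNIV K" for N
    using t by (auto simp: smooth_supported_def intro!: smooth_on_sum smooth_on_cmult)
  have sc: "(\<lambda>x. c n * t n x) \<in> smooth_supported UNIV K" for n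
    using t by (auto simp: smooth_supported_def intro!: smooth_on_cmult)
  have scale: "S (\<lambda>x. a * f x) = a * S f" if "f \<in> test_functions UNIV" for a f
    by (rule linear_functional_onD(2)[OF S that])
  show ?thesis
  proof (induction N)
    case 0
    show ?case using scale[OF tf[OF t[of 0]], of 0] by simp
  next
    case (Suc N)
    have "S (\<lambda>x. (\<Sum>n<N. c n * t n x) + c N * t N x) = S (\<lambda>x. \<Sum>n<N. c n * t n x) + S (\<lambda>x. c N * t N x)"
      by (rule linear_functional_onD(1)[OF S tf[OF sm] tf[OF sc]])
    then show ?case using Suc scale[OF tf[OF t]] by simp
  qed
qed

text \<open>Both sides are expanded into Fourier series. The left one is \<open>\<Sum> c\<^sub>n s\<^sub>n\<close> with
  \<open>s\<^sub>n = S (\<theta> e\<^sub>n)\<close>, by convergence of the partial sums in the \<open>C\<^sup>j\<close> norm. The right one,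
  integrated term by term, has the terms \<open>a\<^sub>n (2R)\<^sup>n p\<^sub>n c\<^sub>n\<close>, where \<open>p\<^sub>n\<close> is the symbol
  \<open>(i \<xi>)\<^sup>\<alpha>\<close>; the coefficients \<open>a\<^sub>n\<close> of \<open>g\<close> are chosen to make the terms equal.

  The constant \<open>D\<close> is quantified before \<open>S\<close> and \<open>C\<close>, since the lemma is applied to all members
  of a net of distributions at once.\<close>

lemma cut_off_distribution_is_derivative:
  fixes \<theta> :: "real^'n::finite \<Rightarrow> complex"
  assumes R: "R > 0" and \<theta>: "smooth_on UNIV \<theta>" "\<And>x. x \<notin> K \<Longrightarrow> \<theta> x = 0"
    and K: "compact K" "K \<subseteq> open_cube R"
  shows "\<exists>D. \<forall>S C. linear_functional_on (test_functions UNIV) S \<longrightarrow> 0 \<le> C \<longrightarrow>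
     (\<forall>f\<in>smooth_supported UNIV K. cmod (S f) \<le> C * ck_norm K j f) \<longrightarrow>
     (\<exists>g. continuous_on UNIV g \<and> (\<forall>x. cmod (g x) \<le> D * C) \<and>
       (\<forall>f L. compact L \<longrightarrow> L \<subseteq> open_cube R \<longrightarrow> f \<in> smooth_supported UNIV L \<longrightarrow>
          S (\<lambda>x. \<theta> x * f x) = (\<integral>x. g x * mderivative (\<lambda>_. j + 2) f x \<partial>lborel)))"
proof -
  define e where "e = (\<lambda>n. wave (freq R (freq_enum n :: 'n \<Rightarrow> int)))"
  define w where "w = (\<lambda>n. freq_weight R (freq_enum n :: 'n \<Rightarrow> int))"
  define M where "M = (2 * R) ^ CARD('n)"
  define B where "B = 2 ^ j * ck_norm K j \<theta>"
  define B' where "B' = (1 + 2 * R / pi) ^ (j * CARD('n))"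
  define D where "D = B * B' / M * suminf w"
  have M: "M > 0" using R by (simp add: M_def)
  have B: "0 \<le> B" unfolding B_def using ck_norm_nonneg[OF open_UNIV \<theta>(1) K(1)] by simp
  have wsum: "summable w" unfolding w_def by (rule summable_freq_weight[OF R])
  have es: "smooth_on UNIV (e n)" for n unfolding e_def by (rule smooth_on_wave[OF open_UNIV])
  have te: "(\<lambda>x. \<theta> x * e n x) \<in> smooth_supported UNIV K" for n
    using \<theta> es by (auto simp: smooth_supported_def intro!: smooth_on_mult)
  \<comment> \<open>the symbol of \<open>\<partial>\<^sup>\<alpha>\<close> at the \<open>n\<close>-th frequency\<close>
  define p where "p = (\<lambda>n. \<Prod>i\<in>(UNIV :: 'n set). (\<i> * complex_of_real (freq R (freq_enum n) $ i)) ^ (j + 2))"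
  have pn: "cmod (p n) = (\<Prod>i\<in>(UNIV :: 'n set). \<bar>freq R (freq_enum n) $ i\<bar> ^ (j + 2))" for n
    by (simp add: p_def norm_mult norm_power prod_norm[symmetric])
  have p0: "p n \<noteq> 0" for n
  proof -
    have "cmod (p n) \<noteq> 0"
      unfolding pn using freq_nonzero[OF R, of "freq_enum n"] by (auto simp: prod_zero_iff[OF finite] simp del: prod_power_distrib)
    then show ?thesis by simp
  qed
  show ?thesis
  proof (rule exI[of _ D], intro allI impI)
    fix S C
    assume S: "linear_functional_on (test_functions UNIV) S" and C: "0 \<le> C"
      and bd: "\<forall>f\<in>smooth_supported UNIV K. cmod (S f) \<le> C * ck_norm K j f"
    define s where "s = (\<lambda>n. S (\<lambda>x. \<theta> x * e n x))"
    define a where "a = (\<lambda>n. s n / (of_real M * p n))"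
    have s: "cmod (s n) \<le> C * B * freq_size R (freq_enum n :: 'n \<Rightarrow> int) ^ j" for n
    proof -
      have "cmod (s n) \<le> C * ck_norm K j (\<lambda>x. \<theta> x * e n x)" unfolding s_def using bd te by blast
      also have "\<dots> \<le> C * (2 ^ j * (ck_norm K j \<theta> * ck_norm K j (e n)))"
        using C by (intro mult_left_mono ck_norm_mult_le[OF open_UNIV \<theta>(1) es K(1)]) auto
      also have "\<dots> \<le> C * (2 ^ j * (ck_norm K j \<theta> * freq_size R (freq_enum n :: 'n \<Rightarrow> int) ^ j))"
      proof -
        have "0 \<le> freq_size R (freq_enum n :: 'n \<Rightarrow> int) ^ j"
          using freq_size_ge_1[of R "freq_enum n :: 'n \<Rightarrow> int"] by simp
        then have "ck_norm K j (e n) \<le> freq_size R (freq_enum n :: 'n \<Rightarrow> int) ^ j"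
          unfolding e_def by (intro ck_norm_le norm_pderivs_wave_le) auto
        then show ?thesis
          using C ck_norm_nonneg[OF open_UNIV \<theta>(1) K(1)] by (intro mult_left_mono) auto
      qed
      finally show ?thesis by (simp add: B_def mult_ac)
    qed
    have a: "cmod (a n) \<le> C * (B * B' / M) * w n" for n
    proof -
      have "cmod (a n) = cmod (s n) / (M * cmod (p n))" using M by (simp add: a_def norm_divide norm_mult)
      also have "\<dots> \<le> C * B * freq_size R (freq_enum n :: 'n \<Rightarrow> int) ^ j / (M * cmod (p n))"
        using M s by (intro divide_right_mono) auto
      also have "\<dots> = C * B / M * (freq_size R (freq_enum n :: 'n \<Rightarrow> int) ^ j / cmod (p n))" by simp
      also have "\<dots> \<le> C * B / M * (B' * w n)"
        unfolding pn B'_def w_def using C B M by (intro mult_left_mono freq_size_weight[OF R]) auto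
      finally show ?thesis by (simp add: mult_ac)
    qed
    have asum: "summable (\<lambda>n. C * (B * B' / M) * w n)" by (intro summable_mult wsum)
    define e' where "e' = (\<lambda>n. wave (- freq R (freq_enum n :: 'n \<Rightarrow> int)))"
    define g where "g = (\<lambda>x. \<Sum>n. a n * e' n x)"
    have ae: "cmod (a n * e' n x) \<le> C * (B * B' / M) * w n" for n x using a by (simp add: norm_mult e'_def)
    have gsums: "(\<lambda>n. a n * e' n x) sums g x" for x
      unfolding g_def by (intro summable_sums summable_comparison_test'[OF asum, of 0] ae)
    have gc: "continuous_on UNIV g"
      unfolding g_def by (rule continuous_on_suminf_weierstrass[OF _ ae asum]) (auto simp: e'_def intro!: continuous_intros)
    have gb: "cmod (g x) \<le> D * C" for x
    proof -
      have "cmod (g x) \<le> suminf (\<lambda>n. C * (B * B' / M) * w n)"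
        using norm_sums_remainder_le[OF gsums ae asum, of x 0] by simp
      also have "\<dots> = D * C" unfolding D_def by (subst suminf_mult[OF wsum]) (simp add: mult_ac)
      finally show ?thesis .
    qed
    have rep: "S (\<lambda>x. \<theta> x * f x) = (\<integral>x. g x * mderivative (\<lambda>_. j + 2) f x \<partial>lborel)"
      if L: "compact L" "L \<subseteq> open_cube R" and f': "f \<in> smooth_supported UNIV L" for f L
    proof -
      have f: "smooth_on UNIV f" "\<And>x. x \<notin> L \<Longrightarrow> f x = 0" using f' by (auto simp: smooth_supported_def)
      define c where "c = (\<lambda>n. fourier_coeff R f (freq_enum n))"
      have "\<exists>\<rho>. \<rho> \<longlonglongrightarrow> 0 \<and> (\<forall>N. ck_norm K j (\<lambda>x. f x - (\<Sum>n<N. c n * e n x)) \<le> \<rho> N)"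
        unfolding c_def e_def by (rule fourier_partial_sums_ck_norm[OF R f(1) L(1) f(2) L(2) K(2)])
      then obtain \<rho> where \<rho>: "\<rho> \<longlonglongrightarrow> 0" "\<And>N. ck_norm K j (\<lambda>x. f x - (\<Sum>n<N. c n * e n x)) \<le> \<rho> N"
        by blast
      \<comment> \<open>the difference is \<open>S\<close> applied to \<open>\<theta>\<close> times the remainder \<open>d\<close> of the Fourier series\<close>
      have close: "cmod (S (\<lambda>x. \<theta> x * f x) - (\<Sum>n<N. c n * s n)) \<le> C * B * \<rho> N" for N
      proof -
        define d where "d = (\<lambda>x. f x - (\<Sum>n<N. c n * e n x))"
        have d: "smooth_on UNIV d"
          unfolding d_def by (intro smooth_on_diff smooth_on_sum smooth_on_cmult f(1) es open_UNIV)
        have 1: "(\<lambda>x. \<theta> x * f x) \<in> smooth_supported UNIV K" "(\<lambda>x. \<theta> x * d x) \<in> smooth_supported UNIV K"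
          using \<theta> f(1) d by (auto simp: smooth_supported_def intro!: smooth_on_mult)
        have 2: "(\<lambda>x. \<Sum>n<N. c n * (\<theta> x * e n x)) \<in> smooth_supported UNIV K"
          unfolding smooth_supported_def using \<theta>(2)
          by (auto intro!: smooth_on_sum smooth_on_cmult smooth_on_mult \<theta>(1) es)
        have tf: "h \<in> test_functions UNIV" if "h \<in> smooth_supported UNIV K" for h
          using that K(1) by (auto simp: test_functions_def)
        have "(\<lambda>x. \<theta> x * f x) = (\<lambda>x. \<theta> x * d x + (\<Sum>n<N. c n * (\<theta> x * e n x)))"
          by (simp add: d_def fun_eq_iff right_diff_distrib sum_distrib_left mult_ac)
        moreover have "S (\<lambda>x. \<theta> x * d x + (\<Sum>n<N. c n * (\<theta> x * e n x)))
            = S (\<lambda>x. \<theta> x * d x) + S (\<lambda>x. \<Sum>n<N. c n * (\<theta> x * e n x))"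
          by (rule linear_functional_onD(1)[OF S tf[OF 1(2)] tf[OF 2]])
        moreover have "S (\<lambda>x. \<Sum>n<N. c n * (\<theta> x * e n x)) = (\<Sum>n<N. c n * s n)"
          unfolding s_def by (rule linear_functional_sum[OF S te K(1)])
        ultimately have "S (\<lambda>x. \<theta> x * f x) - (\<Sum>n<N. c n * s n) = S (\<lambda>x. \<theta> x * d x)" by simp
        moreover have "cmod (S (\<lambda>x. \<theta> x * d x)) \<le> C * ck_norm K j (\<lambda>x. \<theta> x * d x)" using bd 1(2) by blast
        moreover have "C * ck_norm K j (\<lambda>x. \<theta> x * d x) \<le> C * (2 ^ j * (ck_norm K j \<theta> * ck_norm K j d))"
          using C by (intro mult_left_mono ck_norm_mult_le[OF open_UNIV \<theta>(1) d K(1)]) auto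
        moreover have "C * (2 ^ j * (ck_norm K j \<theta> * ck_norm K j d)) = C * B * ck_norm K j d" by (simp add: B_def)
        moreover have "C * B * ck_norm K j d \<le> C * B * \<rho> N"
          using \<rho>(2)[of N] C B by (intro mult_left_mono) (auto simp: d_def)
        ultimately show ?thesis by simp
      qed
      have "(\<lambda>N. C * B * \<rho> N) \<longlonglongrightarrow> 0" by (rule tendsto_mult_right_zero[OF \<rho>(1)])
      from Lim_null_comparison[OF always_eventually[OF allI[OF close]] this]
      have "(\<lambda>N. S (\<lambda>x. \<theta> x * f x) - (\<Sum>n<N. c n * s n)) \<longlonglongrightarrow> 0" .
      from tendsto_minus[OF this]
      have "(\<lambda>N. (\<Sum>n<N. c n * s n) - S (\<lambda>x. \<theta> x * f x)) \<longlonglongrightarrow> 0" by simp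
      then have "(\<lambda>N. \<Sum>n<N. c n * s n) \<longlonglongrightarrow> S (\<lambda>x. \<theta> x * f x)" by (rule LIM_zero_cancel)
      then have lhs: "(\<lambda>n. c n * s n) sums S (\<lambda>x. \<theta> x * f x)" by (simp add: sums_def)
      define F where "F = mderivative (\<lambda>_. j + 2) f"
      have Fs: "smooth_on UNIV F" unfolding F_def by (rule smooth_on_mderivative[OF f(1)])
      have F0: "F x = 0" if "x \<notin> L" for x
        unfolding F_def mderivative_eq_pderivs by (rule pderivs_zero_off[OF compact_imp_closed[OF L(1)] f(2) that])
      note Fc = smooth_on_continuous[OF Fs]
      have Fi: "integrable lborel F" by (rule integrable_of_compact_support[OF Fc L(1) F0])
      define h where "h = (\<lambda>n x. a n * e' n x * F x)"
      have hi: "integrable lborel (h n)" for n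
        unfolding h_def e'_def
        by (rule integrable_of_compact_support[OF _ L(1)]) (auto simp: F0 intro!: continuous_intros Fc)
      \<comment> \<open>this majorant justifies integrating the series of \<open>g\<close> against \<open>F\<close> term by term\<close>
      have hb: "norm (h n x) \<le> C * (B * B' / M) * w n * norm (F x)" for n x
        unfolding h_def norm_mult[of _ "F x"] by (rule mult_right_mono[OF ae]) simp
      have hs: "(\<lambda>n. h n x) sums (g x * F x)" for x
        unfolding h_def by (intro sums_mult2 gsums)
      have nsum: "AE x in lborel. summable (\<lambda>n. norm (h n x))"
      proof (rule AE_I2)
        fix x
        show "summable (\<lambda>n. norm (h n x))"
          by (rule summable_comparison_test'[OF summable_mult2[OF asum, of "norm (F x)"], of 0])
             (simp only: real_norm_def abs_norm_cancel hb)
      qed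
      have "integral\<^sup>L lborel (\<lambda>x. norm (h n x)) \<le> C * (B * B' / M) * w n * integral\<^sup>L lborel (\<lambda>x. norm (F x))" for n
      proof -
        have "integral\<^sup>L lborel (\<lambda>x. norm (h n x)) \<le> integral\<^sup>L lborel (\<lambda>x. C * (B * B' / M) * w n * norm (F x))"
          by (intro integral_mono integrable_norm hi integrable_mult_right Fi hb)
        then show ?thesis by simp
      qed
      then have int_sum: "summable (\<lambda>n. integral\<^sup>L lborel (\<lambda>x. norm (h n x)))"
        by (intro summable_comparison_test'[OF summable_mult2[OF asum, of "integral\<^sup>L lborel (\<lambda>x. norm (F x))"], of 0])
          (simp add: integral_nonneg_AE)
      have "(\<lambda>n. integral\<^sup>L lborel (h n)) sums (\<integral>x. (\<Sum>n. h n x) \<partial>lborel)"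
        by (rule sums_integral[OF hi nsum int_sum])
      moreover have "(\<Sum>n. h n x) = g x * F x" for x using sums_unique[OF hs[of x]] by simp
      moreover have "integral\<^sup>L lborel (h n) = c n * s n" for n
      proof -
        have "integral\<^sup>L lborel (h n) = a n * (\<integral>x. F x * e' n x \<partial>lborel)"
        proof -
          have "h n = (\<lambda>x. a n * (F x * e' n x))" by (simp add: h_def fun_eq_iff mult_ac)
          then show ?thesis by simp
        qed
        also have "(\<integral>x. F x * e' n x \<partial>lborel) = set_lebesgue_integral lborel (cube R) (\<lambda>x. F x * e' n x)"
          by (rule set_integral_of_supported[symmetric, OF _ subset_trans[OF L(2) open_cube_subset_cube]]) (simp add: F0)
        also have "\<dots> = of_real M * fourier_coeff R F (freq_enum n)"
          using R by (simp add: fourier_coeff_def e'_def M_def)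
        also have "fourier_coeff R F (freq_enum n) = p n * c n"
        proof -
          have "fourier_coeff R (pderivs (mindex_list (\<lambda>_. j + 2)) f) (freq_enum n)
             = (\<Prod>i\<leftarrow>mindex_list (\<lambda>_. j + 2). \<i> * of_real (freq R (freq_enum n :: 'n \<Rightarrow> int) $ i)) * fourier_coeff R f (freq_enum n)"
            by (rule fourier_coeff_pderivs[OF f(1) L(1) f(2) L(2)])
          then show ?thesis by (simp only: F_def mderivative_eq_pderivs prod_list_mindex_list p_def c_def)
        qed
        finally show ?thesis using M p0[of n] by (simp add: a_def)
      qed
      ultimately have "(\<lambda>n. c n * s n) sums (\<integral>x. g x * F x \<partial>lborel)" by simp
      then show ?thesis using sums_unique2[OF lhs] by (simp add: F_def)
    qed
    show "\<exists>g. continuous_on UNIV g \<and> (\<forall>x. cmod (g x) \<le> D * C) \<and>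
       (\<forall>f L. compact L \<longrightarrow> L \<subseteq> open_cube R \<longrightarrow> f \<in> smooth_supported UNIV L \<longrightarrow>
          S (\<lambda>x. \<theta> x * f x) = (\<integral>x. g x * mderivative (\<lambda>_. j + 2) f x \<partial>lborel))"
      by (rule exI[of _ g]) (intro conjI allI impI gc gb, rule rep)
  qed
qed

section \<open>Structure of basic functionals\<close>

text \<open>A smooth function on \<open>\<Omega>\<close> that vanishes off the compact set \<open>K \<subseteq> \<Omega>\<close> is smooth on \<open>\<Omega>\<close> and on
  the complement of \<open>K\<close>, which together cover the space. This turns extension by zero into the
  identity on compactly supported nets.\<close>

lemma compact_net_UNIV:
  assumes \<Omega>: "open \<Omega>" and w: "compact_net \<Omega> w"
  shows "compact_net UNIV w"
proof -
  obtain K where K: "compact K" "K \<subseteq> \<Omega>" and s: "\<And>\<epsilon>. \<epsilon> \<in> {0<..1} \<Longrightarrow> w \<epsilon> \<in> smooth_supported \<Omega> K"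
    using w unfolding compact_net_def by blast
  have Kc: "open (- K)" using K(1) by (simp add: compact_imp_closed open_Compl)
  have s': "w \<epsilon> \<in> smooth_supported UNIV K" if e: "\<epsilon> \<in> {0<..1}" for \<epsilon>
  proof -
    have "smooth_on (- K) (w \<epsilon>)"
      by (rule smooth_on_cong[OF Kc _ smooth_on_const[OF Kc, of 0]]) (use s[OF e] in \<open>auto simp: smooth_supported_def\<close>)
    then have "smooth_on (\<Omega> \<union> - K) (w \<epsilon>)"
      using s[OF e] \<Omega> Kc by (intro smooth_on_Un) (auto simp: smooth_supported_def)
    moreover have "\<Omega> \<union> - K = UNIV" using K(2) by blast
    ultimately show ?thesis using s[OF e] by (simp add: smooth_supported_def)
  qed
  have "net_bound w K' is (- real N)" if N: "net_bound w K is (- real N)" for K' "is" N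
    using N eventually_eps unfolding net_bound_def
  proof eventually_elim
    case (elim \<epsilon>)
    have z: "pderivs is (w \<epsilon>) x = 0" if "x \<notin> K" for x
      by (rule pderivs_zero_off[OF compact_imp_closed[OF K(1)] _ that])
        (use s'[OF elim(2)] in \<open>auto simp: smooth_supported_def\<close>)
    show ?case
    proof
      fix x assume "x \<in> K'"
      show "cmod (pderivs is (w \<epsilon>) x) \<le> \<epsilon> powr - real N"
        using elim(1) z[of x] by (cases "x \<in> K") auto
    qed
  qed
  then have "\<exists>N::nat. net_bound w K' is (- real N)" for K' "is"
    using w K unfolding compact_net_def moderate_nets_iff[OF \<Omega>] by meson
  then have "w \<in> moderate_nets UNIV"
    unfolding moderate_nets_iff[OF open_UNIV] smooth_net_def
    using s' by (simp add: smooth_supported_def)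
  then show ?thesis using K(1) s' unfolding compact_net_def by blast
qed

lemma moderate_continuous_netI:
  assumes "\<And>\<epsilon>. continuous_on UNIV (g \<epsilon>)"
    and b: "\<And>K. compact K \<Longrightarrow> \<exists>B N::nat. \<forall>\<^sub>F \<epsilon> in at_right 0. \<forall>x\<in>K. cmod (g \<epsilon> x) \<le> B * \<epsilon> powr - real N"
  shows "g \<in> moderate_continuous_nets \<Omega>"
proof -
  have c: "continuous_on A (g \<epsilon>)" for A \<epsilon> by (rule continuous_on_subset[OF assms(1)]) simp
  have "moderate (\<lambda>\<epsilon>. sup_on K (g \<epsilon>))" if K: "compact K" for K
  proof -
    obtain B and N :: nat where BN: "\<forall>\<^sub>F \<epsilon> in at_right 0. \<forall>x\<in>K. cmod (g \<epsilon> x) \<le> B * \<epsilon> powr - real N"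
      using b[OF K] by blast
    have "\<forall>\<^sub>F \<epsilon> in at_right 0. B * \<epsilon> powr - real N \<le> \<epsilon> powr - real (Suc N)"
      by (rule eventually_mult_powr_le) simp
    with BN have "\<forall>\<^sub>F \<epsilon> in at_right 0. \<bar>sup_on K (g \<epsilon>)\<bar> \<le> \<epsilon> powr - real (Suc N)"
    proof eventually_elim
      case (elim \<epsilon>)
      have "sup_on K (g \<epsilon>) \<le> \<epsilon> powr - real (Suc N)"
        using elim by (intro sup_on_le) (auto intro: order_trans)
      then show ?case using sup_on_nonneg[OF K c, of \<epsilon>] by simp
    qed
    then show ?thesis unfolding moderate_iff by blast
  qed
  then show ?thesis using c unfolding moderate_continuous_nets_def by blast
qed

lemma sign_mult_abs_gcomplex:
  assumes "moderate (\<lambda>\<epsilon>. cmod (r \<epsilon>))"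
  shows "(- 1) ^ k * abs_gcomplex r = abs_gcomplex (\<lambda>\<epsilon>. (- 1) ^ k * r \<epsilon>)"
proof (cases "even k")
  case False
  then show ?thesis using assms by (simp add: uminus_gcomplex.abs_eq moderate_eq_refl)
qed simp

lemma sum_abs_gcomplex:
  assumes "finite A" "\<And>a. a \<in> A \<Longrightarrow> moderate (\<lambda>\<epsilon>. cmod (r a \<epsilon>))"
  shows "moderate (\<lambda>\<epsilon>. cmod (\<Sum>a\<in>A. r a \<epsilon>)) \<and> (\<Sum>a\<in>A. abs_gcomplex (r a)) = abs_gcomplex (\<lambda>\<epsilon>. \<Sum>a\<in>A. r a \<epsilon>)"
  using assms
proof (induction A)
  case empty
  then show ?case by (simp add: zero_gcomplex_def moderate_const)
next
  case (insert a A)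
  then have m: "moderate (\<lambda>\<epsilon>. cmod (r a \<epsilon>))" "moderate (\<lambda>\<epsilon>. cmod (\<Sum>a\<in>A. r a \<epsilon>))"
    and eq: "(\<Sum>a\<in>A. abs_gcomplex (r a)) = abs_gcomplex (\<lambda>\<epsilon>. \<Sum>a\<in>A. r a \<epsilon>)" by simp_all
  have "abs_gcomplex (r a) + abs_gcomplex (\<lambda>\<epsilon>. \<Sum>a\<in>A. r a \<epsilon>) = abs_gcomplex (\<lambda>\<epsilon>. r a \<epsilon> + (\<Sum>a\<in>A. r a \<epsilon>))"
    using m by (simp add: plus_gcomplex.abs_eq moderate_eq_refl)
  then show ?case using insert.hyps m eq by (simp add: moderate_norm_add)
qed

lemma functional_deriv_net_functional:
  assumes \<Omega>: "open \<Omega>" and g: "g \<in> moderate_continuous_nets \<Omega>"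
    and u: "u \<in> colombeau \<Omega>" and w: "w \<in> compact_reps \<Omega> u"
  shows "functional_deriv \<Omega> \<alpha> (net_functional \<Omega> g) u
    = abs_gcomplex (\<lambda>\<epsilon>. (- 1) ^ morder \<alpha> * gpair \<Omega> g (\<lambda>\<epsilon>. mderivative \<alpha> (w \<epsilon>)) \<epsilon>)"
    and "moderate (\<lambda>\<epsilon>. cmod ((- 1) ^ morder \<alpha> * gpair \<Omega> g (\<lambda>\<epsilon>. mderivative \<alpha> (w \<epsilon>)) \<epsilon>))"
proof -
  have m: "moderate (\<lambda>\<epsilon>. cmod (gpair \<Omega> g (\<lambda>\<epsilon>. mderivative \<alpha> (w \<epsilon>)) \<epsilon>))"
    by (intro moderate_gpair[OF \<Omega> g] compact_net_mderivative[OF \<Omega>] compact_reps_net(1)[OF \<Omega> u w])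
  then show "moderate (\<lambda>\<epsilon>. cmod ((- 1) ^ morder \<alpha> * gpair \<Omega> g (\<lambda>\<epsilon>. mderivative \<alpha> (w \<epsilon>)) \<epsilon>))"
    by (simp add: norm_mult norm_power)
  show "functional_deriv \<Omega> \<alpha> (net_functional \<Omega> g) u
    = abs_gcomplex (\<lambda>\<epsilon>. (- 1) ^ morder \<alpha> * gpair \<Omega> g (\<lambda>\<epsilon>. mderivative \<alpha> (w \<epsilon>)) \<epsilon>)"
    unfolding functional_deriv_def sign_mult_abs_gcomplex[OF m, symmetric]
    by (simp add: net_functional_eq[OF \<Omega> g colombeau_c_colombeau[OF gderiv_compact_rep(1)[OF \<Omega> u w]] gderiv_compact_rep(2)[OF \<Omega> u w]])
qed

lemma bounded_subset_open_cube:
  fixes A :: "(real^'n::finite) set"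
  assumes "bounded A"
  obtains R where "R > 0" "A \<subseteq> open_cube R"
proof -
  obtain r where r: "r > 0" "\<And>x. x \<in> A \<Longrightarrow> norm x \<le> r" using assms unfolding bounded_pos by metis
  show ?thesis
  proof (rule that[of "r + 1"])
    show "A \<subseteq> open_cube (r + 1)"
    proof
      fix x assume "x \<in> A"
      then have "\<bar>x $ i\<bar> < r + 1" for i
        using r(2)[of x] component_le_norm_cart[of x i] by linarith
      then show "x \<in> open_cube (r + 1)" by (simp add: open_cube_def)
    qed
  qed (use r in simp)
qed

text \<open>The structure theorem applied for every \<open>\<epsilon> \<le> \<eta>\<close> with the constant \<open>C = c \<epsilon>\<^bsup>-N\<^esup>\<close>, so that
  the growth of the estimate passes to the continuous functions.\<close>

lemma basic_net_representation:
  fixes S :: "real \<Rightarrow> (real^'n::finite \<Rightarrow> complex) \<Rightarrow> complex"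
  assumes R: "R > 0" and \<theta>: "smooth_on UNIV \<theta>" "\<And>x. x \<notin> K \<Longrightarrow> \<theta> x = 0"
    and K: "compact K" "K \<subseteq> open_cube R"
    and S: "\<And>\<epsilon>. \<epsilon> \<in> {0<..1} \<Longrightarrow> linear_functional_on (test_functions UNIV) (S \<epsilon>)"
    and c: "c > 0" "\<eta> \<in> {0<..1}"
    and bd: "\<And>f \<epsilon>. f \<in> smooth_supported UNIV K \<Longrightarrow> \<epsilon> \<in> {0<..\<eta>} \<Longrightarrow>
      cmod (S \<epsilon> f) \<le> c * \<epsilon> powr (- real N) * ck_norm K j f"
  shows "\<exists>g D. (\<forall>\<epsilon>. continuous_on UNIV (g \<epsilon>)) \<and> (\<forall>\<epsilon>\<in>{0<..\<eta>}. \<forall>x. cmod (g \<epsilon> x) \<le> D * \<epsilon> powr - real N) \<and>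
      (\<forall>\<epsilon>\<in>{0<..\<eta>}. \<forall>f L. compact L \<longrightarrow> L \<subseteq> open_cube R \<longrightarrow> f \<in> smooth_supported UNIV L \<longrightarrow>
          S \<epsilon> (\<lambda>x. \<theta> x * f x) = (\<integral>x. g \<epsilon> x * mderivative (\<lambda>_. j + 2) f x \<partial>lborel))"
proof -
  obtain D where D: "\<forall>S C. linear_functional_on (test_functions UNIV) S \<longrightarrow> 0 \<le> C \<longrightarrow>
     (\<forall>f\<in>smooth_supported UNIV K. cmod (S f) \<le> C * ck_norm K j f) \<longrightarrow>
     (\<exists>g. continuous_on UNIV g \<and> (\<forall>x. cmod (g x) \<le> D * C) \<and>
       (\<forall>f L. compact L \<longrightarrow> L \<subseteq> open_cube R \<longrightarrow> f \<in> smooth_supported UNIV L \<longrightarrow>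
          S (\<lambda>x. \<theta> x * f x) = (\<integral>x. g x * mderivative (\<lambda>_. j + 2) f x \<partial>lborel)))"
    using cut_off_distribution_is_derivative[OF R \<theta> K, of j] by (rule exE)
  define P where "P = (\<lambda>\<epsilon> g. continuous_on UNIV g \<and> (\<forall>x. cmod (g x) \<le> D * (c * \<epsilon> powr - real N)) \<and>
       (\<forall>f L. compact L \<longrightarrow> L \<subseteq> open_cube R \<longrightarrow> f \<in> smooth_supported UNIV L \<longrightarrow>
          S \<epsilon> (\<lambda>x. \<theta> x * f x) = (\<integral>x. g x * mderivative (\<lambda>_. j + 2) f x \<partial>lborel)))"
  have ex: "\<exists>g. P \<epsilon> g" if e: "\<epsilon> \<in> {0<..\<eta>}" for \<epsilon>
    unfolding P_def
  proof (rule D[THEN spec, THEN spec, THEN mp, THEN mp, THEN mp])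
    show "linear_functional_on (test_functions UNIV) (S \<epsilon>)" using S e c(2) by simp
    show "0 \<le> c * \<epsilon> powr - real N" using c(1) by simp
    show "\<forall>f\<in>smooth_supported UNIV K. cmod (S \<epsilon> f) \<le> c * \<epsilon> powr - real N * ck_norm K j f"
      using bd e by blast
  qed
  \<comment> \<open>at parameters above \<open>\<eta>\<close> there is no estimate, but the net still has to consist of
    continuous functions\<close>
  define g where "g = (\<lambda>\<epsilon>. if \<epsilon> \<in> {0<..\<eta>} then (SOME g. P \<epsilon> g) else (\<lambda>x. 0))"
  have P: "P \<epsilon> (g \<epsilon>)" if e: "\<epsilon> \<in> {0<..\<eta>}" for \<epsilon>
    using someI_ex[OF ex[OF e]] e unfolding g_def by simp
  have gc: "continuous_on UNIV (g \<epsilon>)" for \<epsilon>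
  proof (cases "\<epsilon> \<in> {0<..\<eta>}")
    case True
    from P[OF this] show ?thesis by (simp add: P_def)
  next
    case False
    then have "g \<epsilon> = (\<lambda>x. 0)" unfolding g_def by (rule if_not_P)
    then show ?thesis by simp
  qed
  have gb: "\<forall>\<epsilon>\<in>{0<..\<eta>}. \<forall>x. cmod (g \<epsilon> x) \<le> D * c * \<epsilon> powr - real N"
    using P by (simp add: P_def mult.assoc)
  have gr: "\<forall>\<epsilon>\<in>{0<..\<eta>}. \<forall>f L. compact L \<longrightarrow> L \<subseteq> open_cube R \<longrightarrow> f \<in> smooth_supported UNIV L \<longrightarrow>
          S \<epsilon> (\<lambda>x. \<theta> x * f x) = (\<integral>x. g \<epsilon> x * mderivative (\<lambda>_. j + 2) f x \<partial>lborel)"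
    using P by (simp add: P_def)
  show ?thesis by (rule exI[of _ g], rule exI[of _ "D * c"]) (use gc gb gr in simp)
qed

text \<open>With a cutoff \<open>\<theta>\<close> equal to \<open>1\<close> near the closure of \<open>\<Omega>\<close>, \<open>S\<^sub>\<epsilon> w = S\<^sub>\<epsilon> (\<theta> w)\<close> for all \<open>w\<close>
  supported in \<open>\<Omega>\<close>. Boundedness of \<open>\<Omega>\<close> is what allows one compact set, hence one order \<open>j\<close> and
  one exponent \<open>N\<close>, for all of \<open>\<Omega>\<close>.\<close>

lemma restriction_of_basic_functional:
  fixes T :: "'n::finite functional"
  assumes T: "basic_Gc UNIV T" and \<Omega>: "open \<Omega>" "bounded \<Omega>"
  obtains g \<alpha> where "g \<in> moderate_continuous_nets \<Omega>"
    "\<forall>u\<in>colombeau_c \<Omega>. functional_restrict UNIV \<Omega> T u = functional_deriv \<Omega> \<alpha> (net_functional \<Omega> g) u"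
proof -
  obtain S where S: "\<forall>\<epsilon>\<in>{0<..1}. S \<epsilon> \<in> distributions UNIV"
    and bd: "\<forall>K. compact K \<and> K \<subseteq> UNIV \<longrightarrow> (\<exists>(j::nat) (N::nat) (c::real) \<eta>. c > 0 \<and> \<eta> \<in> {0<..1} \<and>
           (\<forall>f\<in>smooth_supported UNIV K. \<forall>\<epsilon>\<in>{0<..\<eta>}.
              cmod (S \<epsilon> f) \<le> c * \<epsilon> powr (- real N) * ck_norm K j f))"
    and TS: "\<forall>u\<in>colombeau_c UNIV. \<forall>w\<in>compact_reps UNIV u. T u = abs_gcomplex (\<lambda>\<epsilon>. S \<epsilon> (w \<epsilon>))"
    using T unfolding basic_Gc_def by (elim exE conjE) (rule that)
  have lin: "linear_functional_on (test_functions UNIV) (S \<epsilon>)" if "\<epsilon> \<in> {0<..1}" for \<epsilon>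
    using bspec[OF S that] by (simp add: distributions_def)
  have cl: "compact (closure \<Omega>)" using \<Omega>(2) by (simp add: compact_closure)
  obtain R where R: "R > 0" "closure \<Omega> \<subseteq> open_cube R"
    using bounded_subset_open_cube[OF compact_imp_bounded[OF cl]] by metis
  obtain \<theta> V K where \<theta>: "smooth_on UNIV \<theta>" "open V" "closure \<Omega> \<subseteq> V" "\<And>x. x \<in> V \<Longrightarrow> \<theta> x = 1"
    "compact K" "V \<subseteq> K" "K \<subseteq> open_cube R" "\<And>x. x \<notin> K \<Longrightarrow> \<theta> x = 0"
    using smooth_cutoff[OF cl open_open_cube R(2)] by metis
  have "compact K \<and> K \<subseteq> UNIV" using \<theta>(5) by simp
  from bd[THEN spec, THEN mp, OF this] obtain j N :: nat and c \<eta> :: real where c: "c > 0" "\<eta> \<in> {0<..1}"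
    and est0: "\<forall>f\<in>smooth_supported UNIV K. \<forall>\<epsilon>\<in>{0<..\<eta>}.
      cmod (S \<epsilon> f) \<le> c * \<epsilon> powr (- real N) * ck_norm K j f"
    by (elim exE conjE) (rule that)
  have est: "cmod (S \<epsilon> f) \<le> c * \<epsilon> powr (- real N) * ck_norm K j f"
    if "f \<in> smooth_supported UNIV K" "\<epsilon> \<in> {0<..\<eta>}" for f \<epsilon>
    using est0 that by blast
  have "\<exists>G D. (\<forall>\<epsilon>. continuous_on UNIV (G \<epsilon>)) \<and> (\<forall>\<epsilon>\<in>{0<..\<eta>}. \<forall>x. cmod (G \<epsilon> x) \<le> D * \<epsilon> powr - real N) \<and>
      (\<forall>\<epsilon>\<in>{0<..\<eta>}. \<forall>f L. compact L \<longrightarrow> L \<subseteq> open_cube R \<longrightarrow> f \<in> smooth_supported UNIV L \<longrightarrow>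
          S \<epsilon> (\<lambda>x. \<theta> x * f x) = (\<integral>x. G \<epsilon> x * mderivative (\<lambda>_. j + 2) f x \<partial>lborel))"
    by (rule basic_net_representation[OF R(1) \<theta>(1,8,5,7) lin c est])
  then obtain G D where G0: "\<forall>\<epsilon>. continuous_on UNIV (G \<epsilon>)"
      "\<forall>\<epsilon>\<in>{0<..\<eta>}. \<forall>x. cmod (G \<epsilon> x) \<le> D * \<epsilon> powr - real N"
      "\<forall>\<epsilon>\<in>{0<..\<eta>}. \<forall>f L. compact L \<longrightarrow> L \<subseteq> open_cube R \<longrightarrow> f \<in> smooth_supported UNIV L \<longrightarrow>
          S \<epsilon> (\<lambda>x. \<theta> x * f x) = (\<integral>x. G \<epsilon> x * mderivative (\<lambda>_. j + 2) f x \<partial>lborel)"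
    by (elim exE conjE) (rule that)
  note G = G0[rule_format]
  define \<alpha> :: "'n mindex" where "\<alpha> = (\<lambda>_. j + 2)"
  \<comment> \<open>the sign cancels the one in the definition of the derivative of a functional\<close>
  define g where "g = (\<lambda>\<epsilon> x. (- 1) ^ morder \<alpha> * G \<epsilon> x)"
  have g: "g \<in> moderate_continuous_nets \<Omega>"
  proof (rule moderate_continuous_netI)
    show "continuous_on UNIV (g \<epsilon>)" for \<epsilon> unfolding g_def by (intro continuous_intros G)
    fix A :: "(real^'n) set"
    have "\<forall>\<^sub>F \<epsilon> in at_right 0. \<forall>x\<in>A. cmod (g \<epsilon> x) \<le> D * \<epsilon> powr - real N"
      using eventually_eps_le[of \<eta>] c(2) G(2) by (auto simp: g_def norm_mult norm_power elim!: eventually_mono)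
    then show "\<exists>B N::nat. \<forall>\<^sub>F \<epsilon> in at_right 0. \<forall>x\<in>A. cmod (g \<epsilon> x) \<le> B * \<epsilon> powr - real N" by blast
  qed
  show ?thesis
  proof (rule that[OF g], rule ballI)
    fix u assume uc: "u \<in> colombeau_c \<Omega>"
    note u = colombeau_c_colombeau[OF uc]
    define w where "w = (SOME w. w \<in> compact_reps \<Omega> u)"
    obtain w0 where "w0 \<in> compact_reps \<Omega> u" using compact_reps_nonempty[OF \<Omega>(1) uc] .
    then have w: "w \<in> compact_reps \<Omega> u" unfolding w_def by (rule someI[of "\<lambda>w. w \<in> compact_reps \<Omega> u"])
    note cn = compact_reps_net(1)[OF \<Omega>(1) u w]
    obtain A where A: "compact A" "A \<subseteq> \<Omega>" and ws: "\<And>\<epsilon>. \<epsilon> \<in> {0<..1} \<Longrightarrow> w \<epsilon> \<in> smooth_supported \<Omega> A"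
      using cn unfolding compact_net_def by blast
    note cU = compact_net_UNIV[OF \<Omega>(1) cn]
    have wU: "w \<epsilon> \<in> smooth_supported UNIV A" if "\<epsilon> \<in> {0<..1}" for \<epsilon>
      using cU ws[OF that] that unfolding compact_net_def smooth_supported_def by blast
    have AR: "A \<subseteq> open_cube R" using A(2) closure_subset[of \<Omega>] R(2) by blast
    have AV: "x \<in> V" if "x \<in> A" for x using that A(2) closure_subset[of \<Omega>] \<theta>(3) by blast
    have "functional_restrict UNIV \<Omega> T u = T (gclass UNIV w)"
      by (simp add: functional_restrict_def gextend_def w_def)
    also have "\<dots> = abs_gcomplex (\<lambda>\<epsilon>. S \<epsilon> (w \<epsilon>))"
      by (rule TS[rule_format, OF compact_net_rep[OF open_UNIV cU]])
    also have "\<dots> = abs_gcomplex (\<lambda>\<epsilon>. (- 1) ^ morder \<alpha> * gpair \<Omega> g (\<lambda>\<epsilon>. mderivative \<alpha> (w \<epsilon>)) \<epsilon>)"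
    proof (rule abs_gcomplex_eventually_eq)
      show "moderate (\<lambda>\<epsilon>. cmod ((- 1) ^ morder \<alpha> * gpair \<Omega> g (\<lambda>\<epsilon>. mderivative \<alpha> (w \<epsilon>)) \<epsilon>))"
        by (rule functional_deriv_net_functional(2)[OF \<Omega>(1) g u w])
      show "\<forall>\<^sub>F \<epsilon> in at_right 0. S \<epsilon> (w \<epsilon>) = (- 1) ^ morder \<alpha> * gpair \<Omega> g (\<lambda>\<epsilon>. mderivative \<alpha> (w \<epsilon>)) \<epsilon>"
      proof (rule eventually_mono[OF eventually_eps_le[of \<eta>]])
        show "0 < \<eta>" using c(2) by simp
        fix \<epsilon> assume e: "\<epsilon> \<in> {0<..\<eta>}"
        then have e1: "\<epsilon> \<in> {0<..1}" using c(2) by auto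
        have w0: "w \<epsilon> x = 0" if "x \<notin> A" for x using wU[OF e1] that by (simp add: smooth_supported_def)
        have "w \<epsilon> = (\<lambda>x. \<theta> x * w \<epsilon> x)"
        proof
          fix x show "w \<epsilon> x = \<theta> x * w \<epsilon> x"
            using \<theta>(4)[OF AV, of x] w0[of x] by (cases "x \<in> A") auto
        qed
        then have "S \<epsilon> (w \<epsilon>) = S \<epsilon> (\<lambda>x. \<theta> x * w \<epsilon> x)" by simp
        also have "\<dots> = (\<integral>x. G \<epsilon> x * mderivative \<alpha> (w \<epsilon>) x \<partial>lborel)"
          unfolding \<alpha>_def by (rule G(3)[OF e A(1) AR wU[OF e1]])
        also have "\<dots> = set_lebesgue_integral lborel \<Omega> (\<lambda>x. G \<epsilon> x * mderivative \<alpha> (w \<epsilon>) x)"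
        proof (rule set_integral_of_supported[symmetric, OF _ A(2)])
          fix x assume x: "x \<notin> A"
          have "mderivative \<alpha> (w \<epsilon>) x = 0"
            unfolding mderivative_eq_pderivs by (rule pderivs_zero_off[OF compact_imp_closed[OF A(1)] w0 x])
          then show "G \<epsilon> x * mderivative \<alpha> (w \<epsilon>) x = 0" by simp
        qed
        also have "\<dots> = (- 1) ^ morder \<alpha> * gpair \<Omega> g (\<lambda>\<epsilon>. mderivative \<alpha> (w \<epsilon>)) \<epsilon>"
          unfolding gpair_def g_def set_integral_mult_right[symmetric]
          by (simp add: mult.assoc[symmetric] power_mult_distrib[symmetric])
        finally show "S \<epsilon> (w \<epsilon>) = (- 1) ^ morder \<alpha> * gpair \<Omega> g (\<lambda>\<epsilon>. mderivative \<alpha> (w \<epsilon>)) \<epsilon>" .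
      qed
    qed
    also have "\<dots> = functional_deriv \<Omega> \<alpha> (net_functional \<Omega> g) u"
      by (rule functional_deriv_net_functional(1)[OF \<Omega>(1) g u w, symmetric])
    finally show "functional_restrict UNIV \<Omega> T u = functional_deriv \<Omega> \<alpha> (net_functional \<Omega> g) u" .
  qed
qed

lemma ck_norm_mono_set:
  assumes "open \<Omega>" "smooth_on \<Omega> f" "compact K" "K \<subseteq> \<Omega>" "K' \<subseteq> K"
  shows "ck_norm K' j f \<le> ck_norm K j f"
  by (rule ck_norm_le[OF ck_norm_nonneg[OF assms(1-4)] le_ck_norm[OF assms(1-4)]]) (use assms(5) in auto)

text \<open>Collects the terms of the Leibniz rule according to the multi-index of the derivative that
  falls on the second factor.\<close>

lemma sum_list_group_by_count:
  fixes A :: "'a list \<Rightarrow> complex" and X :: "('a \<Rightarrow> nat) \<Rightarrow> complex"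
  assumes "finite M" "\<And>a b. (a, b) \<in> set ps \<Longrightarrow> count_list b \<in> M"
  shows "(\<Sum>(a, b)\<leftarrow>ps. A a * X (count_list b))
    = (\<Sum>\<beta>\<in>M. (\<Sum>(a, b)\<leftarrow>ps. if count_list b = \<beta> then A a else 0) * X \<beta>)"
  using assms(2)
proof (induction ps)
  case (Cons p ps)
  obtain a b where p: "p = (a, b)" by (cases p)
  have b: "count_list b \<in> M" using Cons.prems[of a b] by (simp add: p)
  have "(\<Sum>\<beta>\<in>M. (if count_list b = \<beta> then A a else 0) * X \<beta>) = A a * X (count_list b)"
  proof -
    have "(\<Sum>\<beta>\<in>M. (if count_list b = \<beta> then A a else 0) * X \<beta>)
        = (\<Sum>\<beta>\<in>M. if count_list b = \<beta> then A a * X \<beta> else 0)"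
      by (intro sum.cong) auto
    then show ?thesis using b assms(1) by simp
  qed
  moreover have "(\<Sum>(a, b)\<leftarrow>ps. A a * X (count_list b))
    = (\<Sum>\<beta>\<in>M. (\<Sum>(a, b)\<leftarrow>ps. if count_list b = \<beta> then A a else 0) * X \<beta>)"
  proof (rule Cons.IH)
    show "count_list b \<in> M" if "(a, b) \<in> set ps" for a b
      using Cons.prems[of a b] that by simp
  qed
  ultimately show ?case by (simp add: p distrib_right sum.distrib)
qed simp

text \<open>Two nested cutoffs are needed: \<open>\<theta>\<^sub>1\<close>, equal to \<open>1\<close> near the compact set \<open>K\<^sub>0\<close> of the
  estimate, makes \<open>\<theta>\<^sub>1 f\<close> compactly supported in the cube without changing \<open>S\<^sub>\<epsilon> f\<close>; and \<open>\<theta>\<close>,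
  equal to \<open>1\<close> near the support of \<open>\<theta>\<^sub>1\<close>, brings \<open>S\<^sub>\<epsilon> (\<theta>\<^sub>1 f)\<close> into the form \<open>S\<^sub>\<epsilon> (\<theta> \<theta>\<^sub>1 f)\<close> of
  the structure theorem. The derivative of \<open>\<theta>\<^sub>1 f\<close> is then expanded by the Leibniz rule.\<close>

lemma basic_functional_sum_of_derivatives:
  fixes T :: "'n::finite functional"
  assumes T: "basic_G UNIV T"
  shows "\<exists>(m :: nat) g. (\<forall>\<beta>. g \<beta> \<in> moderate_continuous_nets UNIV) \<and>
    (\<forall>u\<in>colombeau_c UNIV. T u = (\<Sum>\<beta> | morder \<beta> \<le> m. functional_deriv UNIV \<beta> (net_functional UNIV (g \<beta>)) u))"
proof -
  obtain S K0 and j N :: nat and c \<eta> :: real where S: "\<forall>\<epsilon>\<in>{0<..1}. S \<epsilon> \<in> compact_distributions UNIV"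
    and K0: "compact K0" and c: "c > 0" "\<eta> \<in> {0<..1}"
    and est0: "\<forall>f. smooth_on UNIV f \<longrightarrow> (\<forall>\<epsilon>\<in>{0<..\<eta>}. cmod (S \<epsilon> f) \<le> c * \<epsilon> powr (- real N) * ck_norm K0 j f)"
    and TS: "\<forall>u\<in>colombeau UNIV. \<forall>w\<in>u. T u = abs_gcomplex (\<lambda>\<epsilon>. S \<epsilon> (w \<epsilon>))"
    using T unfolding basic_G_def by (elim exE conjE) (rule that)
  have lin: "linear_functional_on {f. smooth_on UNIV f} (S \<epsilon>)" if "\<epsilon> \<in> {0<..1}" for \<epsilon>
    using bspec[OF S that] by (simp add: compact_distributions_def)
  have lin': "linear_functional_on (test_functions UNIV) (S \<epsilon>)" if "\<epsilon> \<in> {0<..1}" for \<epsilon>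
    using lin[OF that] unfolding linear_functional_on_def by (auto simp: test_functions_def smooth_supported_def)
  obtain R where R: "R > 0" "K0 \<subseteq> open_cube R"
    using bounded_subset_open_cube[OF compact_imp_bounded[OF K0]] by metis
  obtain \<theta>1 V1 K1 where \<theta>1: "smooth_on UNIV \<theta>1" "open V1" "K0 \<subseteq> V1" "\<And>x. x \<in> V1 \<Longrightarrow> \<theta>1 x = 1"
    "compact K1" "V1 \<subseteq> K1" "K1 \<subseteq> open_cube R" "\<And>x. x \<notin> K1 \<Longrightarrow> \<theta>1 x = 0"
    using smooth_cutoff[OF K0 open_open_cube R(2)] by metis
  obtain \<theta> V K where \<theta>: "smooth_on UNIV \<theta>" "open V" "K1 \<subseteq> V" "\<And>x. x \<in> V \<Longrightarrow> \<theta> x = 1"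
    "compact K" "V \<subseteq> K" "K \<subseteq> open_cube R" "\<And>x. x \<notin> K \<Longrightarrow> \<theta> x = 0"
    using smooth_cutoff[OF \<theta>1(5) open_open_cube \<theta>1(7)] by metis
  have K0K: "K0 \<subseteq> K" using \<theta>1(3,6) \<theta>(3,6) by blast
  have est: "cmod (S \<epsilon> f) \<le> c * \<epsilon> powr (- real N) * ck_norm K j f"
    if f: "f \<in> smooth_supported UNIV K" and e: "\<epsilon> \<in> {0<..\<eta>}" for f \<epsilon>
  proof -
    have fs: "smooth_on UNIV f" using f by (simp add: smooth_supported_def)
    have "cmod (S \<epsilon> f) \<le> c * \<epsilon> powr (- real N) * ck_norm K0 j f" using est0 fs e by blast
    also have "\<dots> \<le> c * \<epsilon> powr (- real N) * ck_norm K j f"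
      using c(1) by (intro mult_left_mono ck_norm_mono_set[OF open_UNIV fs \<theta>(5) subset_UNIV K0K]) simp
    finally show ?thesis .
  qed
  have "\<exists>G D. (\<forall>\<epsilon>. continuous_on UNIV (G \<epsilon>)) \<and> (\<forall>\<epsilon>\<in>{0<..\<eta>}. \<forall>x. cmod (G \<epsilon> x) \<le> D * \<epsilon> powr - real N) \<and>
      (\<forall>\<epsilon>\<in>{0<..\<eta>}. \<forall>f L. compact L \<longrightarrow> L \<subseteq> open_cube R \<longrightarrow> f \<in> smooth_supported UNIV L \<longrightarrow>
          S \<epsilon> (\<lambda>x. \<theta> x * f x) = (\<integral>x. G \<epsilon> x * mderivative (\<lambda>_. j + 2) f x \<partial>lborel))"
    by (rule basic_net_representation[OF R(1) \<theta>(1,8,5,7) lin' c est])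
  then obtain G D where G0: "\<forall>\<epsilon>. continuous_on UNIV (G \<epsilon>)"
      "\<forall>\<epsilon>\<in>{0<..\<eta>}. \<forall>x. cmod (G \<epsilon> x) \<le> D * \<epsilon> powr - real N"
      "\<forall>\<epsilon>\<in>{0<..\<eta>}. \<forall>f L. compact L \<longrightarrow> L \<subseteq> open_cube R \<longrightarrow> f \<in> smooth_supported UNIV L \<longrightarrow>
          S \<epsilon> (\<lambda>x. \<theta> x * f x) = (\<integral>x. G \<epsilon> x * mderivative (\<lambda>_. j + 2) f x \<partial>lborel)"
    by (elim exE conjE) (rule that)
  note G = G0[rule_format]
  define \<alpha> :: "'n mindex" where "\<alpha> = (\<lambda>_. j + 2)"
  define ps where "ps = splits (mindex_list \<alpha>)"
  define m where "m = morder \<alpha>"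
  define M where "M = {\<beta> :: 'n mindex. morder \<beta> \<le> m}"
  \<comment> \<open>the coefficient of \<open>\<partial>\<^sup>\<beta> f\<close> in \<open>\<partial>\<^sup>\<alpha>(\<theta>\<^sub>1 f)\<close>\<close>
  define h where "h = (\<lambda>\<beta> x. \<Sum>(a, b)\<leftarrow>ps. if count_list b = \<beta> then pderivs a \<theta>1 x else 0)"
  define g where "g = (\<lambda>\<beta> \<epsilon> x. (- 1) ^ morder \<beta> * (G \<epsilon> x * h \<beta> x))"
  have M: "finite M" unfolding M_def by (rule finite_morder_le)
  have psM: "count_list b \<in> M" if "(a, b) \<in> set ps" for a b
    using length_splits_parts[of a b "mindex_list \<alpha>"] that
    by (simp add: ps_def M_def m_def morder_count_list length_mindex_list)
  have hc: "continuous_on UNIV (h \<beta>)" for \<beta>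
  proof -
    have "continuous_on UNIV (\<lambda>x. \<Sum>(a, b)\<leftarrow>qs. if count_list b = \<beta> then pderivs a \<theta>1 x else 0)" for qs
    proof (induction qs)
      case (Cons q qs)
      obtain a b where q: "q = (a, b)" by (cases q)
      have "continuous_on UNIV (\<lambda>x. if count_list b = \<beta> then pderivs a \<theta>1 x else 0)"
        using smooth_on_continuous[OF smooth_on_pderivs[OF \<theta>1(1), of a]] by (cases "count_list b = \<beta>") simp_all
      from continuous_on_add[OF this Cons.IH] show ?case by (simp add: q)
    qed simp
    then show ?thesis by (simp add: h_def)
  qed
  have gM: "g \<beta> \<in> moderate_continuous_nets UNIV" for \<beta>
  proof (rule moderate_continuous_netI)
    show "continuous_on UNIV (g \<beta> \<epsilon>)" for \<epsilon> unfolding g_def by (intro continuous_intros G hc)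
    fix A :: "(real^'n) set" assume A: "compact A"
    have hA: "continuous_on A (h \<beta>)" by (rule continuous_on_subset[OF hc]) simp
    have "\<forall>\<^sub>F \<epsilon> in at_right 0. \<forall>x\<in>A. cmod (g \<beta> \<epsilon> x) \<le> D * sup_on A (h \<beta>) * \<epsilon> powr - real N"
    proof (rule eventually_mono[OF eventually_eps_le[of \<eta>]])
      show "0 < \<eta>" using c(2) by simp
      fix \<epsilon> assume e: "\<epsilon> \<in> {0<..\<eta>}"
      show "\<forall>x\<in>A. cmod (g \<beta> \<epsilon> x) \<le> D * sup_on A (h \<beta>) * \<epsilon> powr - real N"
      proof
        fix x assume x: "x \<in> A"
        have "cmod (g \<beta> \<epsilon> x) = cmod (G \<epsilon> x) * cmod (h \<beta> x)" by (simp add: g_def norm_mult norm_power)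
        also have "\<dots> \<le> (D * \<epsilon> powr - real N) * sup_on A (h \<beta>)"
          using order_trans[OF norm_ge_zero G(2)[OF e, of x]]
          by (intro mult_mono G(2)[OF e] le_sup_on[OF A hA x]) auto
        finally show "cmod (g \<beta> \<epsilon> x) \<le> D * sup_on A (h \<beta>) * \<epsilon> powr - real N" by (simp add: mult_ac)
      qed
    qed
    then show "\<exists>B N::nat. \<forall>\<^sub>F \<epsilon> in at_right 0. \<forall>x\<in>A. cmod (g \<beta> \<epsilon> x) \<le> B * \<epsilon> powr - real N" by blast
  qed
  have rep: "S \<epsilon> f = (\<Sum>\<beta>\<in>M. (- 1) ^ morder \<beta> * (\<integral>x. g \<beta> \<epsilon> x * mderivative \<beta> f x \<partial>lborel))"
    if e: "\<epsilon> \<in> {0<..\<eta>}" and f: "smooth_on UNIV f" and A: "compact A" "\<And>x. x \<notin> A \<Longrightarrow> f x = 0" for \<epsilon> f A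
  proof -
    have e1: "\<epsilon> \<in> {0<..1}" using e c(2) by auto
    define f1 where "f1 = (\<lambda>x. \<theta>1 x * f x)"
    have f1: "smooth_on UNIV f1" unfolding f1_def by (rule smooth_on_mult[OF open_UNIV \<theta>1(1) f])
    define d where "d = (\<lambda>x. f x - f1 x)"
    have d: "smooth_on UNIV d" unfolding d_def by (rule smooth_on_diff[OF open_UNIV f f1])
    have d0: "d x = 0" if "x \<in> V1" for x using \<theta>1(4)[OF that] by (simp add: d_def f1_def)
    \<comment> \<open>\<open>f - \<theta>\<^sub>1 f\<close> vanishes near \<open>K\<^sub>0\<close>, so by the estimate \<open>S\<^sub>\<epsilon>\<close> does not see it\<close>
    have "ck_norm K0 j d \<le> 0"
    proof (rule ck_norm_le)
      fix "is" :: "'n list" and x assume "x \<in> K0"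
      then have "x \<in> V1" using \<theta>1(3) by blast
      from pderivs_cong[OF \<theta>1(2) this, of d "\<lambda>x. 0" "is"] d0
      show "cmod (pderivs is d x) \<le> 0" by (simp add: pderivs_zero)
    qed simp
    then have "c * \<epsilon> powr (- real N) * ck_norm K0 j d \<le> 0" using c(1) by (simp add: mult_nonneg_nonpos)
    moreover have "cmod (S \<epsilon> d) \<le> c * \<epsilon> powr (- real N) * ck_norm K0 j d" using est0 d e by blast
    ultimately have "cmod (S \<epsilon> d) \<le> 0" by linarith
    then have Sd: "S \<epsilon> d = 0" by simp
    have "S \<epsilon> (\<lambda>x. d x + f1 x) = S \<epsilon> d + S \<epsilon> f1"
      using linear_functional_onD(1)[OF lin[OF e1]] d f1 by simp
    moreover have "(\<lambda>x. d x + f1 x) = f" by (simp add: d_def fun_eq_iff)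
    ultimately have Sf: "S \<epsilon> f = S \<epsilon> f1" using Sd by simp
    have f1_eq: "f1 = (\<lambda>x. \<theta> x * f1 x)"
    proof
      fix x show "f1 x = \<theta> x * f1 x"
        using \<theta>(3,4) \<theta>1(8) by (cases "x \<in> K1") (auto simp: f1_def)
    qed
    have "S \<epsilon> f = S \<epsilon> (\<lambda>x. \<theta> x * f1 x)"
      using Sf arg_cong[OF f1_eq, of "S \<epsilon>"] by (rule trans)
    also have "S \<epsilon> (\<lambda>x. \<theta> x * f1 x) = (\<integral>x. G \<epsilon> x * mderivative \<alpha> f1 x \<partial>lborel)"
      unfolding \<alpha>_def by (rule G(3)[OF e \<theta>1(5,7)]) (use f1 \<theta>1(8) in \<open>auto simp: smooth_supported_def f1_def\<close>)
    also have "\<dots> = (\<integral>x. (\<Sum>\<beta>\<in>M. (- 1) ^ morder \<beta> * (g \<beta> \<epsilon> x * mderivative \<beta> f x)) \<partial>lborel)"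
    proof (rule Bochner_Integration.integral_cong[OF refl])
      fix x
      have "mderivative \<alpha> f1 x = (\<Sum>(a, b)\<leftarrow>ps. pderivs a \<theta>1 x * pderivs b f x)"
        unfolding mderivative_eq_pderivs f1_def ps_def by (rule pderivs_mult[OF open_UNIV \<theta>1(1) f UNIV_I])
      also have "\<dots> = (\<Sum>(a, b)\<leftarrow>ps. pderivs a \<theta>1 x * mderivative (count_list b) f x)"
        by (simp only: pderivs_eq_mderivative[OF open_UNIV f UNIV_I])
      also have "\<dots> = (\<Sum>\<beta>\<in>M. h \<beta> x * mderivative \<beta> f x)"
        unfolding h_def by (rule sum_list_group_by_count[OF M psM])
      finally have eq: "mderivative \<alpha> f1 x = (\<Sum>\<beta>\<in>M. h \<beta> x * mderivative \<beta> f x)" .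
      have sgn: "(- 1) ^ k * ((- 1) ^ k * z) = z" for k :: nat and z :: complex
        by (simp add: mult.assoc[symmetric] power_mult_distrib[symmetric])
      show "G \<epsilon> x * mderivative \<alpha> f1 x = (\<Sum>\<beta>\<in>M. (- 1) ^ morder \<beta> * (g \<beta> \<epsilon> x * mderivative \<beta> f x))"
        unfolding eq g_def sum_distrib_left by (intro sum.cong refl) (simp only: mult.assoc sgn)
    qed
    also have "\<dots> = (\<Sum>\<beta>\<in>M. (\<integral>x. (- 1) ^ morder \<beta> * (g \<beta> \<epsilon> x * mderivative \<beta> f x) \<partial>lborel))"
    proof (rule Bochner_Integration.integral_sum)
      fix \<beta> assume "\<beta> \<in> M"
      have z: "mderivative \<beta> f x = 0" if "x \<notin> A" for x
        unfolding mderivative_eq_pderivs by (rule pderivs_zero_off[OF compact_imp_closed[OF A(1)] A(2) that])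
      have "integrable lborel (\<lambda>x. g \<beta> \<epsilon> x * mderivative \<beta> f x)"
      proof (rule integrable_of_compact_support[OF _ A(1)])
        show "continuous_on UNIV (\<lambda>x. g \<beta> \<epsilon> x * mderivative \<beta> f x)"
          unfolding g_def by (intro continuous_intros G hc smooth_on_continuous[OF smooth_on_mderivative[OF f]])
      qed (simp add: z)
      then show "integrable lborel (\<lambda>x. (- 1) ^ morder \<beta> * (g \<beta> \<epsilon> x * mderivative \<beta> f x))" by simp
    qed
    also have "\<dots> = (\<Sum>\<beta>\<in>M. (- 1) ^ morder \<beta> * (\<integral>x. g \<beta> \<epsilon> x * mderivative \<beta> f x \<partial>lborel))" by simp
    finally show ?thesis .
  qed
  show ?thesis
  proof (rule exI[of _ m], rule exI[of _ g], intro conjI allI ballI)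
    show "g \<beta> \<in> moderate_continuous_nets UNIV" for \<beta> by (rule gM)
    fix u :: "'n net set" assume uc: "u \<in> colombeau_c UNIV"
    note u = colombeau_c_colombeau[OF uc]
    obtain w where w: "w \<in> compact_reps UNIV u" using compact_reps_nonempty[OF open_UNIV uc] .
    note cn = compact_reps_net[OF open_UNIV u w]
    obtain A where A: "compact A" and ws: "\<And>\<epsilon>. \<epsilon> \<in> {0<..1} \<Longrightarrow> w \<epsilon> \<in> smooth_supported UNIV A"
      using cn(1) unfolding compact_net_def by blast
    define r where "r = (\<lambda>\<beta> \<epsilon>. (- 1) ^ morder \<beta> * gpair UNIV (g \<beta>) (\<lambda>\<epsilon>. mderivative \<beta> (w \<epsilon>)) \<epsilon>)"
    have rm: "moderate (\<lambda>\<epsilon>. cmod (r \<beta> \<epsilon>))" for \<beta>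
      unfolding r_def by (rule functional_deriv_net_functional(2)[OF open_UNIV gM u w])
    have rf: "functional_deriv UNIV \<beta> (net_functional UNIV (g \<beta>)) u = abs_gcomplex (r \<beta>)" for \<beta>
      unfolding r_def by (rule functional_deriv_net_functional(1)[OF open_UNIV gM u w])
    note sum = sum_abs_gcomplex[OF M rm]
    have "T u = abs_gcomplex (\<lambda>\<epsilon>. S \<epsilon> (w \<epsilon>))" using TS u cn(2) by blast
    also have "\<dots> = abs_gcomplex (\<lambda>\<epsilon>. \<Sum>\<beta>\<in>M. r \<beta> \<epsilon>)"
    proof (rule abs_gcomplex_eventually_eq[OF conjunct1[OF sum]])
      show "\<forall>\<^sub>F \<epsilon> in at_right 0. S \<epsilon> (w \<epsilon>) = (\<Sum>\<beta>\<in>M. r \<beta> \<epsilon>)"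
      proof (rule eventually_mono[OF eventually_eps_le[of \<eta>]])
        show "0 < \<eta>" using c(2) by simp
        fix \<epsilon> assume e: "\<epsilon> \<in> {0<..\<eta>}"
        then have e1: "\<epsilon> \<in> {0<..1}" using c(2) by auto
        have "smooth_on UNIV (w \<epsilon>)" "\<And>x. x \<notin> A \<Longrightarrow> w \<epsilon> x = 0"
          using ws[OF e1] by (auto simp: smooth_supported_def)
        from rep[OF e this(1) A this(2)]
        show "S \<epsilon> (w \<epsilon>) = (\<Sum>\<beta>\<in>M. r \<beta> \<epsilon>)"
          by (simp add: r_def gpair_def set_lebesgue_integral_def)
      qed
    qed
    also have "\<dots> = (\<Sum>\<beta>\<in>M. functional_deriv UNIV \<beta> (net_functional UNIV (g \<beta>)) u)"
      unfolding rf by (rule conjunct2[OF sum, symmetric])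
    finally show "T u = (\<Sum>\<beta> | morder \<beta> \<le> m. functional_deriv UNIV \<beta> (net_functional UNIV (g \<beta>)) u)"
      unfolding M_def .
  qed
qed

theorem theorem4p12:
  shows
    "(\<forall>T\<in>dual_Gc (UNIV :: (real^'n::finite) set). basic_Gc UNIV T \<longrightarrow>
        (\<forall>\<Omega>. open \<Omega> \<and> bounded \<Omega> \<longrightarrow>
          (\<exists>T\<^sub>0\<in>dual_Gcm 0 \<Omega>. (\<exists>g\<in>moderate_continuous_nets \<Omega>. defined_by_net \<Omega> T\<^sub>0 g) \<and>
             (\<exists>\<alpha>. \<forall>u\<in>colombeau_c \<Omega>.
                functional_restrict UNIV \<Omega> T u = functional_deriv \<Omega> \<alpha> T\<^sub>0 u)))) \<and>
     (\<forall>T\<in>dual_G (UNIV :: (real^'n) set). basic_G UNIV T \<longrightarrow>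
        (\<exists>(m::nat) T'.
           (\<forall>\<alpha>. morder \<alpha> \<le> m \<longrightarrow> T' \<alpha> \<in> dual_Gcm 0 UNIV \<and>
              (\<exists>g\<in>moderate_continuous_nets UNIV. defined_by_net UNIV (T' \<alpha>) g)) \<and>
           (\<forall>u\<in>colombeau_c UNIV.
              T u = (\<Sum>\<alpha> | morder \<alpha> \<le> m. functional_deriv UNIV \<alpha> (T' \<alpha>) u))))"
proof (intro conjI ballI impI allI)
  fix T :: "'n functional" and \<Omega> :: "(real^'n) set"
  assume "basic_Gc UNIV T" and \<Omega>: "open \<Omega> \<and> bounded \<Omega>"
  then obtain g \<alpha> where g: "g \<in> moderate_continuous_nets \<Omega>"
    "\<forall>u\<in>colombeau_c \<Omega>. functional_restrict UNIV \<Omega> T u = functional_deriv \<Omega> \<alpha> (net_functional \<Omega> g) u"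
    using restriction_of_basic_functional by metis
  show "\<exists>T\<^sub>0\<in>dual_Gcm 0 \<Omega>. (\<exists>g\<in>moderate_continuous_nets \<Omega>. defined_by_net \<Omega> T\<^sub>0 g) \<and>
             (\<exists>\<alpha>. \<forall>u\<in>colombeau_c \<Omega>. functional_restrict UNIV \<Omega> T u = functional_deriv \<Omega> \<alpha> T\<^sub>0 u)"
  proof (intro bexI conjI exI)
    show "net_functional \<Omega> g \<in> dual_Gcm 0 \<Omega>" using \<Omega> g(1) by (intro net_functional_dual) auto
    show "defined_by_net \<Omega> (net_functional \<Omega> g) g" using \<Omega> g(1) by (intro defined_by_net_functional) auto
  qed (rule g)+
next
  fix T :: "'n functional"
  assume "basic_G UNIV T"
  from basic_functional_sum_of_derivatives[OF this]
  obtain m :: nat and g :: "'n mindex \<Rightarrow> 'n net" where g0: "\<forall>\<beta>. g \<beta> \<in> moderate_continuous_nets UNIV"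
    and g:
    "\<forall>u\<in>colombeau_c UNIV. T u = (\<Sum>\<beta> | morder \<beta> \<le> m. functional_deriv UNIV \<beta> (net_functional UNIV (g \<beta>)) u)"
    by (elim exE conjE) (rule that)
  show "\<exists>(m::nat) T'. (\<forall>\<alpha>. morder \<alpha> \<le> m \<longrightarrow> T' \<alpha> \<in> dual_Gcm 0 UNIV \<and>
              (\<exists>g\<in>moderate_continuous_nets UNIV. defined_by_net UNIV (T' \<alpha>) g)) \<and>
           (\<forall>u\<in>colombeau_c UNIV. T u = (\<Sum>\<alpha> | morder \<alpha> \<le> m. functional_deriv UNIV \<alpha> (T' \<alpha>) u))"
  proof (rule exI[of _ m], rule exI[of _ "\<lambda>\<beta>. net_functional UNIV (g \<beta>)"], intro conjI allI impI)
    fix \<alpha>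
    show "net_functional UNIV (g \<alpha>) \<in> dual_Gcm 0 UNIV" by (rule net_functional_dual[OF open_UNIV g0[rule_format]])
    show "\<exists>h\<in>moderate_continuous_nets UNIV. defined_by_net UNIV (net_functional UNIV (g \<alpha>)) h"
      by (rule bexI[of _ "g \<alpha>"]) (rule defined_by_net_functional[OF open_UNIV], rule g0[rule_format], rule g0[rule_format])
  qed (rule g)
qed

end
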